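(* Let $\Omega\subset\mathbb{R}^3$ be a bounded connected open set, and let $v$ be a velocity field on $[0,\infty)\times\bar\Omega$ satisfying (H1)–(H3) of the context, with flow $X$. Let $\Sigma(0)\subset\Omega$ be a closed (i.e. compact, without boundary) $C^2$-smooth surface, and let $\phi^0:\Omega\to\mathbb{R}$ be a $C^2$-function with $\{x\in\Omega \mid \phi^0(x)=0\}=\Sigma(0)$ and $\nabla\phi^0\neq 0$ on $\Sigma(0)$. Put $\Sigma(t):=X(t,0,\Sigma(0))$ for $t\ge 0$. Then there exists a tubular neighborhood $\Theta\subset[0,\infty)\times\Omega$ of $\{\Sigma(t)\}_{t\ge0}$ for which the problem $$\frac{\partial\phi}{\partial t}+v\cdot\nabla\phi=\phi\,\Big\langle(\nabla v)\frac{\nabla\phi}{|\nabla\phi|},\frac{\nabla\phi}{|\nabla\phi|}\Big\rangle\ \text{ in }\Theta,\qquad \phi(0,\cdot)=\phi^0\ \text{ on }\Theta|_{t=0}$$ admits a unique $C^2$-solution $\phi:\Theta\to\mathbb{R}$ (with $\nabla\phi\ne0$ in $\Theta$, so that the equation makes sense), and this $\phi$ satisfies: 1. $\{x\in\Omega \mid (t,x)\in\Theta,\ \phi(t,x)=0\}=\Sigma(t)$ for all $t\in[0,\infty)$; 2. for every $t\in[0,\infty)$ and every $x\in\Sigma(t)$ there exists $\xi\in\Sigma(0)$ such that $|\nabla\phi(t,x)|=|\nabla\phi^0(\xi)|$.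
   Context: Notation. $\nabla$ is the gradient in $x\in\mathbb{R}^3$; $(\nabla v)_{ij}=\partial v_i/\partial x_j$; $\langle\cdot,\cdot\rangle$ is the Euclidean inner product and $|\cdot|$ the Euclidean norm; $\Theta|_{t=0}=\{x \mid (0,x)\in\Theta\}$. Contingent cone. For a closed set $K\subset\mathbb{R}^d$ and $x\in K$, $T_K(x):=\{z\in\mathbb{R}^d \mid \liminf_{h\to0+}h^{-1}\,\mathrm{dist}(x+hz,K)=0\}$. Hypotheses on $v$. (H1) $v\in C^0([0,\infty)\times\bar\Omega;\mathbb{R}^3)\cap C^1([0,\infty)\times\Omega;\mathbb{R}^3)$ is locally Lipschitz in $x\in\bar\Omega$ (for every $(t_0,x_0)$ there are $\delta,L>0$ with $|v(t,x)-v(t,\bar x)|\le L|x-\bar x|$ for all $t\ge 0$ with $|t-t_0|<\delta$ and $x,\bar x\in\bar\Omega$ within distance $\delta$ of $x_0$); $v$ is three times partially differentiable in $x$; all of the partial derivatives of $v$ belong to $C^0([0,\infty)\times\Omega;\mathbb{R}^3)$. (H2) $\pm v(s,x)\in T_{\partial\Omega}(x)$ for all $s\in[0,\infty)$, $x\in\partial\Omega$. (H3) $|\partial v_i/\partial x_j|$ ($i,j=1,2,3$) are bounded on $[0,\infty)\times\Omega$. Flow. Under these hypotheses, for each $(\tau,\xi)\in[0,\infty)\times\bar\Omega$ the ODE $x'(s)=v(s,x(s))$, $x(\tau)=\xi$ has a unique solution on $[0,\infty)$ staying in $\bar\Omega$; its value at time $s$ is denoted $X(s,\tau,\xi)$.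 The sets $\bar\Omega$, $\partial\Omega$ and $\Omega$ are invariant under this flow; in particular $\Sigma(t)\subset\Omega$ for all $t\ge0$. Tubular neighborhood. For $\varepsilon>0$ let $\Sigma_\varepsilon(t):=\bigcup_{x\in\Sigma(t)}\{y\in\mathbb{R}^3 \mid |x-y|<\varepsilon\}$; only $\varepsilon$ with $\Sigma_\varepsilon(t)\subset\Omega$ are considered. A set $\Theta\subset[0,\infty)\times\Omega$ is a ($t$-global) tubular neighborhood of $\{\Sigma(t)\}_{t\ge0}$ if it contains $\bigcup_{t\ge0}(\{t\}\times\Sigma(t))$ and there is a nonincreasing function $\varepsilon:[0,\infty)\to\mathbb{R}_{>0}$ such that $\{t\}\times\Sigma_{\varepsilon(t)}(t)\subset\Theta$ for all $t\ge0$.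
   Formalization: Under (H1) as written, φ need not be twice differentiable in t; proved: φ has all continuous derivatives of order ≤ 2 except ∂²φ/∂t² and is unique in that class; φ is jointly C² on Θ if moreover each ∂v/∂x_j is C¹ in (t,x) on [0,∞)×Ω. *)

theory Defs
  imports "HOL-Analysis.Analysis"
begin

text \<open>Partial derivatives are taken within the domain \<open>D\<close> of the function: on an open set they
  are the usual ones; on a relatively open subset of \<open>[0,\<infinity>) \<times> \<Omega>\<close> the time derivative at
  \<open>t = 0\<close> is the one-sided one. Points of space-time are pairs \<open>(t, x)\<close>, so \<open>(1, 0)\<close> is the
  time direction and \<open>(0, axis j 1)\<close> is the \<open>j\<close>-th space direction.\<close>

definition has_pderiv :: "'a::real_normed_vector set \<Rightarrow> 'a \<Rightarrow> ('a \<Rightarrow> 'b::real_normed_vector) \<Rightarrow> 'a \<Rightarrow> bool" where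
  "has_pderiv D b f p \<longleftrightarrow>
     (\<lambda>s::real. f (p + s *\<^sub>R b)) differentiable (at 0 within {s. p + s *\<^sub>R b \<in> D})"

definition pderiv_on :: "'a::real_normed_vector set \<Rightarrow> 'a \<Rightarrow> ('a \<Rightarrow> 'b::real_normed_vector) \<Rightarrow> 'a \<Rightarrow> 'b" where
  "pderiv_on D b f p =
     vector_derivative (\<lambda>s::real. f (p + s *\<^sub>R b)) (at 0 within {s. p + s *\<^sub>R b \<in> D})"

text \<open>All iterated partial derivatives of order at most \<open>k\<close> in directions from \<open>B\<close> exist and
  are continuous on \<open>D\<close>.\<close>

primrec Ck_dirs :: "nat \<Rightarrow> 'a::real_normed_vector set \<Rightarrow> 'a set \<Rightarrow> ('a \<Rightarrow> 'b::real_normed_vector) \<Rightarrow> bool" where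
  "Ck_dirs 0 B D f \<longleftrightarrow> continuous_on D f"
| "Ck_dirs (Suc k) B D f \<longleftrightarrow> continuous_on D f \<and>
     (\<forall>b\<in>B. (\<forall>p\<in>D. has_pderiv D b f p) \<and> Ck_dirs k B D (pderiv_on D b f))"

definition Ck_on :: "nat \<Rightarrow> 'a::euclidean_space set \<Rightarrow> ('a \<Rightarrow> 'b::real_normed_vector) \<Rightarrow> bool" where
  "Ck_on k D f \<longleftrightarrow> Ck_dirs k Basis D f"

definition space_dirs :: "(real \<times> (real^3)) set" where
  "space_dirs = {(0, axis j 1) |j. True}"

definition spacetime :: "(real^3) set \<Rightarrow> (real \<times> (real^3)) set" where
  "spacetime \<Omega> = {0..} \<times> \<Omega>"

definition slice :: "(real \<times> (real^3)) set \<Rightarrow> real \<Rightarrow> (real^3) set" where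
  "slice \<Theta> t = {x. (t, x) \<in> \<Theta>}"

definition grad :: "(real^3) set \<Rightarrow> (real^3 \<Rightarrow> real) \<Rightarrow> real^3 \<Rightarrow> real^3" where
  "grad D f x = (\<chi> j. pderiv_on D (axis j 1) f x)"

definition grad_vec :: "(real^3) set \<Rightarrow> (real^3 \<Rightarrow> real^3) \<Rightarrow> real^3 \<Rightarrow> real^3^3" where
  "grad_vec D w x = (\<chi> i j. pderiv_on D (axis j 1) (\<lambda>y. w y $ i) x)"

definition contingent_cone :: "'a::real_normed_vector set \<Rightarrow> 'a \<Rightarrow> 'a set" where
  "contingent_cone K x =
     {z. Liminf (at_right 0) (\<lambda>h::real. ereal (infdist (x + h *\<^sub>R z) K / h)) = 0}"

definition H1 :: "(real^3) set \<Rightarrow> (real \<times> (real^3) \<Rightarrow> real^3) \<Rightarrow> bool" where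
  "H1 \<Omega> v \<longleftrightarrow>
     continuous_on (spacetime (closure \<Omega>)) v \<and>
     Ck_on 1 (spacetime \<Omega>) v \<and>
     (\<forall>t0\<ge>0. \<forall>x0\<in>closure \<Omega>. \<exists>\<delta>>0. \<exists>L>0. \<forall>t\<ge>0. \<bar>t - t0\<bar> < \<delta> \<longrightarrow>
        (\<forall>x\<in>closure \<Omega>. \<forall>y\<in>closure \<Omega>. dist x x0 < \<delta> \<longrightarrow> dist y x0 < \<delta> \<longrightarrow>
           norm (v (t, x) - v (t, y)) \<le> L * norm (x - y))) \<and>
     Ck_dirs 3 space_dirs (spacetime \<Omega>) v"

definition H2 :: "(real^3) set \<Rightarrow> (real \<times> (real^3) \<Rightarrow> real^3) \<Rightarrow> bool" where
  "H2 \<Omega> v \<longleftrightarrow>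
     (\<forall>s\<ge>0. \<forall>x\<in>frontier \<Omega>.
        v (s, x) \<in> contingent_cone (frontier \<Omega>) x \<and> - v (s, x) \<in> contingent_cone (frontier \<Omega>) x)"

definition H3 :: "(real^3) set \<Rightarrow> (real \<times> (real^3) \<Rightarrow> real^3) \<Rightarrow> bool" where
  "H3 \<Omega> v \<longleftrightarrow>
     (\<exists>M. \<forall>t\<ge>0. \<forall>x\<in>\<Omega>. \<forall>i j. \<bar>grad_vec \<Omega> (\<lambda>y. v (t, y)) x $ i $ j\<bar> \<le> M)"

text \<open>Under (H1)--(H3) the solution exists and is unique, so this determines \<open>X s \<tau> \<xi>\<close> for all
  \<open>s, \<tau> \<ge> 0\<close> and \<open>\<xi> \<in> closure \<Omega>\<close>. Times \<open>s < \<tau>\<close> are included.\<close>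

definition is_flow :: "(real^3) set \<Rightarrow> (real \<times> (real^3) \<Rightarrow> real^3) \<Rightarrow> (real \<Rightarrow> real \<Rightarrow> real^3 \<Rightarrow> real^3) \<Rightarrow> bool" where
  "is_flow \<Omega> v X \<longleftrightarrow>
     (\<forall>\<tau>\<ge>0. \<forall>\<xi>\<in>closure \<Omega>. X \<tau> \<tau> \<xi> = \<xi> \<and>
        (\<forall>s\<ge>0. X s \<tau> \<xi> \<in> closure \<Omega> \<and>
           ((\<lambda>r. X r \<tau> \<xi>) has_vector_derivative v (s, X s \<tau> \<xi>)) (at s within {0..})))"

text \<open>A compact two-dimensional \<open>C\<^sup>2\<close> submanifold of \<open>\<real>\<^sup>3\<close>: near each of its points a
  \<open>C\<^sup>2\<close>-diffeomorphism of open sets maps it onto a piece of the plane \<open>y\<^sub>3 = 0\<close>. Half-planes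
  are not admitted as local models, so there is no boundary.\<close>

definition closed_C2_surface :: "(real^3) set \<Rightarrow> bool" where
  "closed_C2_surface S \<longleftrightarrow> compact S \<and>
     (\<forall>x\<in>S. \<exists>U V. \<exists>(\<Phi> :: real^3 \<Rightarrow> real^3) \<Psi>. open U \<and> open V \<and> x \<in> U \<and> homeomorphism U V \<Phi> \<Psi> \<and>
        Ck_on 2 U \<Phi> \<and> Ck_on 2 V \<Psi> \<and> \<Phi> ` (S \<inter> U) = {y\<in>V. y $ 3 = (0::real)})"

definition tubular_neighborhood :: "(real^3) set \<Rightarrow> (real \<Rightarrow> (real^3) set) \<Rightarrow> (real \<times> (real^3)) set \<Rightarrow> bool" where
  "tubular_neighborhood \<Omega> \<Sigma> \<Theta> \<longleftrightarrow>
     \<Theta> \<subseteq> spacetime \<Omega> \<and>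
     (\<Union>t\<in>{0..}. {t} \<times> \<Sigma> t) \<subseteq> \<Theta> \<and>
     (\<exists>\<epsilon>::real \<Rightarrow> real. (\<forall>t\<ge>0. \<epsilon> t > 0) \<and> (\<forall>s t. 0 \<le> s \<longrightarrow> s \<le> t \<longrightarrow> \<epsilon> t \<le> \<epsilon> s) \<and>
        (\<forall>t\<ge>0. {t} \<times> (\<Union>x\<in>\<Sigma> t. ball x (\<epsilon> t)) \<subseteq> \<Theta>))"

text \<open>Regularity class of solutions: \<open>\<phi>\<close> and all components of its spatial gradient are
  \<open>C\<^sup>1\<close> in \<open>(t, x)\<close>. These are all derivatives of order at most two except
  \<open>\<partial>\<^sup>2\<phi>/\<partial>t\<^sup>2\<close> (\<open>\<partial>\<^sup>2\<phi>/\<partial>x\<^sub>j\<partial>t\<close> then exists and equals \<open>\<partial>\<^sup>2\<phi>/\<partial>t\<partial>x\<^sub>j\<close> by the Schwarz theorem).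
  By the equation itself \<open>\<partial>\<^sup>2\<phi>/\<partial>t\<^sup>2\<close> involves \<open>\<partial>(\<nabla>v)/\<partial>t\<close>.\<close>

definition C2_upto_tt :: "(real \<times> (real^3)) set \<Rightarrow> (real \<times> (real^3) \<Rightarrow> real) \<Rightarrow> bool" where
  "C2_upto_tt \<Theta> \<phi> \<longleftrightarrow> Ck_on 1 \<Theta> \<phi> \<and> (\<forall>b\<in>space_dirs. Ck_on 1 \<Theta> (pderiv_on \<Theta> b \<phi>))"

definition solves_problem ::
  "(real^3) set \<Rightarrow> (real \<times> (real^3) \<Rightarrow> real^3) \<Rightarrow> (real^3 \<Rightarrow> real) \<Rightarrow> (real \<times> (real^3)) set
     \<Rightarrow> (real \<times> (real^3) \<Rightarrow> real) \<Rightarrow> bool" where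
  "solves_problem \<Omega> v \<phi>0 \<Theta> \<phi> \<longleftrightarrow>
     (\<forall>(t, x)\<in>\<Theta>.
        let p = grad (slice \<Theta> t) (\<lambda>y. \<phi> (t, y)) x; n = p /\<^sub>R norm p in
          p \<noteq> 0 \<and>
          pderiv_on \<Theta> (1, 0) \<phi> (t, x) + v (t, x) \<bullet> p
            = \<phi> (t, x) * ((grad_vec \<Omega> (\<lambda>y. v (t, y)) x *v n) \<bullet> n)) \<and>
     (\<forall>x\<in>slice \<Theta> 0. \<phi> (0, x) = \<phi>0 x)"

end

theory Submission
  imports Defs
begin

text \<open>
The equation is a first-order equation \<open>\<phi>\<^sub>t + v \<bullet> p = \<phi> R(t, x, p)\<close> with \<open>p = \<nabla>\<phi>\<close> and \<open>R\<close> homogeneous of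
degree \<open>0\<close> in \<open>p\<close>, and it is solved by characteristics. Where \<open>\<phi> = 0\<close> the characteristics are the
trajectories of \<open>v\<close>, along which \<open>|p|\<close> is constant, so those starting on \<open>\<Sigma>0\<close> exist for all times; this
is where property 2 comes from. The spatial projection of the characteristic flow has an injective
differential over \<open>\<Sigma>0\<close>, although it differs from that of the flow of \<open>v\<close>: if \<open>dx\<close> vanishes at
some time, so does \<open>d\<phi> = p \<bullet> dx\<close>, hence \<open>d\<phi>\<close> vanishes identically and \<open>dx\<close> satisfies the linearised
equation of \<open>v\<close>. By compactness the projection is a diffeomorphism on a neighbourhood of
\<open>[0, \<infinity>) \<times> \<Sigma>0\<close> that contains, with each point, the whole past of its characteristic; its image is
\<open>\<Theta>\<close>. Another solution \<open>\<psi>\<close> is compared with \<open>\<phi>\<close> along the characteristics of \<open>\<phi>\<close>, where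
\<open>(\<psi> - \<phi>, \<nabla>\<psi> - \<nabla>\<phi>)\<close> satisfies a Gronwall inequality.
\<close>

section \<open>Ordinary differential equations\<close>

text \<open>Four obstacles shape the proof. (1) Off the surface a characteristic may leave
  \<open>\<Omega>\<close> or blow up in finite time, so nothing uniform in time is available: the
  flow is treated on its open domain, and radii are chosen on \<open>[0, n]\<close> by compactness
  and may shrink with \<open>n\<close>. (2) The inverse function theorem and invariance of domain
  need open sets, whereas \<open>t = 0\<close> is a boundary time; for this reason the
  characteristic flow, not \<open>v\<close>, is continued to negative times. (3)
  \<open>field\<close> contains second spatial derivatives of \<open>v\<close>, and its flow must be
  C1 in the initial value; this is where third derivatives of \<open>v\<close> enter. (4)
  \<open>phi\<close>, obtained by inverting a C1 map, is at first only C1; its second derivatives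
  come from recognising its gradient as the \<open>p\<close>-component, which is C1 for the same
  reason. Uniqueness follows the characteristics of \<open>phi\<close> and not those of the
  competitor, since only the former are known to fill \<open>\<Theta>\<close> and to stay in it back
  to time \<open>0\<close>. The surface stays in \<open>\<Omega>\<close> because the tangency
  condition (H2) keeps the trajectories of \<open>v\<close> off the frontier.\<close>

lemma gronwall:
  fixes e :: "real \<Rightarrow> 'a::real_normed_vector"
  assumes cont: "continuous_on {0..T} e"
    and deriv: "\<And>t. 0 < t \<Longrightarrow> t < T \<Longrightarrow> (e has_vector_derivative e' t) (at t)"
    and bound: "\<And>t. 0 < t \<Longrightarrow> t < T \<Longrightarrow> norm (e' t) \<le> L * norm (e t) + \<epsilon>"
    and "0 \<le> L" "0 \<le> \<epsilon>" and t: "t \<in> {0..T}"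
  shows "norm (e t) \<le> (norm (e 0) + \<epsilon> * t) * exp (L * t)"
proof (cases "t = 0")
  case False
  with t have t0: "0 < t" "t \<le> T" by auto
  \<comment> \<open>\<open>norm (e s)\<close> need not be differentiable where \<open>e\<close>
    vanishes, so it is majorised by \<open>norm (e 0) + \<phi> s\<close>, with \<open>\<phi>\<close>
    a primitive of the bound \<open>g\<close>; derivative tests apply to
    \<open>\<phi>\<close>.\<close>
  define g where "g s = L * norm (e s) + \<epsilon>" for s
  define \<phi> where "\<phi> s = integral {0..s} g" for s
  have cg: "continuous_on {0..T} g"
    unfolding g_def by (intro continuous_intros cont)
  have d\<phi>: "(\<phi> has_vector_derivative g s) (at s within {0..T})" if "s \<in> {0..T}" for s
    unfolding \<phi>_def using integral_has_vector_derivative[OF cg that] .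
  have d\<phi>': "(\<phi> has_vector_derivative g s) (at s)" if "0 < s" "s < T" for s
    using d\<phi>[of s] that by (simp add: at_within_Icc_at)
  have c\<phi>: "continuous_on {0..T} \<phi>"
    using d\<phi> by (meson continuous_on_vector_derivative)
  have \<phi>0: "\<phi> 0 = 0" by (simp add: \<phi>_def)
  have grow: "norm (e s) \<le> norm (e 0) + \<phi> s" if s: "s \<in> {0..T}" for s
  proof (cases "s = 0")
    case False
    have "norm (e s - e 0) \<le> \<phi> s - \<phi> 0"
    proof (rule differentiable_bound_general[where f' = e' and \<phi>' = g])
      show "0 < s" using s False by auto
      show "continuous_on {0..s} e" "continuous_on {0..s} \<phi>"
        using s cont c\<phi> by (auto elim: continuous_on_subset)
    qed (use s deriv d\<phi>' bound in \<open>auto simp: g_def\<close>)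
    then show ?thesis using norm_triangle_sub[of "e s" "e 0"] \<phi>0 by simp
  qed (simp add: \<phi>0)
  define m where "m s = (norm (e 0) + \<phi> s) * exp (- L * s) - \<epsilon> * s" for s
  have "m t \<le> m 0"
  proof (rule DERIV_nonpos_imp_decreasing_open[of 0 t m])
    show "continuous_on {0..t} m" unfolding m_def
      using c\<phi> t0 by (auto intro!: continuous_intros elim: continuous_on_subset)
    fix s assume s: "0 < s" "s < t"
    let ?d = "(g s - L * (norm (e 0) + \<phi> s)) * exp (- L * s) - \<epsilon>"
    have "(m has_field_derivative ?d) (at s)" unfolding m_def
      using d\<phi>'[of s] s t0
      by (auto intro!: derivative_eq_intros simp: algebra_simps has_real_derivative_iff_has_vector_derivative[symmetric])
    moreover have "?d \<le> 0"
    proof -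
      have "L * norm (e s) \<le> L * (norm (e 0) + \<phi> s)"
        using grow[of s] s t0 \<open>0 \<le> L\<close> by (intro mult_left_mono) auto
      then have 1: "g s - L * (norm (e 0) + \<phi> s) \<le> \<epsilon>" by (simp add: g_def)
      have "?d \<le> \<epsilon> * exp (- L * s) - \<epsilon>"
        using mult_right_mono[OF 1, of "exp (- L * s)"] by simp
      also have "\<dots> \<le> 0" using \<open>0 \<le> \<epsilon>\<close> \<open>0 \<le> L\<close> s by (simp add: mult_left_le)
      finally show ?thesis .
    qed
    ultimately show "\<exists>y. (m has_field_derivative y) (at s) \<and> y \<le> 0" by blast
  qed (use t0 in auto)
  then have "(norm (e 0) + \<phi> t) * exp (- L * t) \<le> norm (e 0) + \<epsilon> * t"
    by (simp add: m_def \<phi>0)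
  then have "norm (e 0) + \<phi> t \<le> (norm (e 0) + \<epsilon> * t) * exp (L * t)"
    by (simp add: exp_minus field_simps)
  then show ?thesis using grow[of t] t by linarith
qed simp

text \<open>Reversing time about \<open>s\<close> turns the claim for earlier times into the forward
  one. The backward direction is what later gives injectivity of the flow of \<open>v\<close> and of
  its linearisation.\<close>

lemma gronwall_zero:
  fixes e :: "real \<Rightarrow> 'a::real_normed_vector"
  assumes cont: "continuous_on {0..T} e"
    and deriv: "\<And>t. 0 < t \<Longrightarrow> t < T \<Longrightarrow> (e has_vector_derivative e' t) (at t)"
    and bound: "\<And>t. 0 < t \<Longrightarrow> t < T \<Longrightarrow> norm (e' t) \<le> L * norm (e t)"
    and s: "s \<in> {0..T}" "e s = 0" and t: "t \<in> {0..T}"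
  shows "e t = 0"
proof -
  define L' where "L' = max L 0"
  have bd: "norm (e' t) \<le> L' * norm (e t) + 0" if "0 < t" "t < T" for t
    using bound[OF that] mult_right_mono[of L L' "norm (e t)"] by (auto simp: L'_def)
  consider "s \<le> t" | "t \<le> s" by linarith
  then show ?thesis
  proof cases
    case 1
    have "norm (e ((t - s) + s)) \<le> (norm (e (0 + s)) + 0 * (t - s)) * exp (L' * (t - s))"
    proof (rule gronwall[where T = "T - s" and e' = "\<lambda>r. e' (r + s)"])
      show "continuous_on {0..T - s} (\<lambda>r. e (r + s))"
        by (rule continuous_on_compose2[OF cont]) (use s in \<open>auto intro!: continuous_intros\<close>)
      show "((\<lambda>r. e (r + s)) has_vector_derivative e' (r + s)) (at r)" if "0 < r" "r < T - s" for r
      proof -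
        have "((\<lambda>r. r + s) has_vector_derivative 1) (at r)"
          by (auto intro!: derivative_eq_intros simp: has_real_derivative_iff_has_vector_derivative[symmetric])
        from vector_diff_chain_at[OF this deriv[of "r + s"]] show ?thesis
          using that s by (simp add: o_def)
      qed
    qed (use 1 s t bd in \<open>auto simp: L'_def\<close>)
    then show ?thesis using s by simp
  next
    case 2
    have "norm (e (s - (s - t))) \<le> (norm (e (s - 0)) + 0 * (s - t)) * exp (L' * (s - t))"
    proof (rule gronwall[where T = s and e' = "\<lambda>r. - e' (s - r)"])
      show "continuous_on {0..s} (\<lambda>r. e (s - r))"
        by (rule continuous_on_compose2[OF cont]) (use s in \<open>auto intro!: continuous_intros\<close>)
      show "((\<lambda>r. e (s - r)) has_vector_derivative - e' (s - r)) (at r)" if "0 < r" "r < s" for r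
      proof -
        have "((\<lambda>r. s - r) has_vector_derivative - 1) (at r)"
          by (auto intro!: derivative_eq_intros simp: has_real_derivative_iff_has_vector_derivative[symmetric])
        from vector_diff_chain_at[OF this deriv[of "s - r"]] show ?thesis
          using that s by (simp add: o_def)
      qed
    qed (use 2 s t bd in \<open>auto simp: L'_def\<close>)
    then show ?thesis using s by simp
  qed
qed

text \<open>In the unknown \<open>z t = exp (- 2 K t) y t\<close> the Picard map is a contraction with factor \<open>1/2\<close> on the
  whole time interval.\<close>

lemma lipschitz_ode_exists:
  fixes g :: "real \<Rightarrow> 'a::banach \<Rightarrow> 'a"
  assumes "0 \<le> T"
    and cont: "continuous_on ({0..T} \<times> UNIV) (\<lambda>(t, y). g t y)"
    and lip: "\<And>t x y. t \<in> {0..T} \<Longrightarrow> norm (g t x - g t y) \<le> L * norm (x - y)"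
  obtains y where "y 0 = y0" "continuous_on {0..T} y"
    "\<And>t. t \<in> {0..T} \<Longrightarrow> (y has_vector_derivative g t (y t)) (at t within {0..T})"
proof -
  define K where "K = max L 1"
  have K: "0 < K" and lipK: "norm (g t x - g t y) \<le> K * norm (x - y)" if "t \<in> {0..T}" for t x y
    using lip[OF that, of x y] mult_right_mono[of L K "norm (x - y)"] by (auto simp: K_def)
  have K: "0 < K" by (simp add: K_def)
  \<comment> \<open>Clamping the time to \<open>{0..T}\<close> turns the Picard iterates into
    bounded continuous functions on the whole line, a complete space for the supremum
    metric.\<close>
  define c where "c t = max 0 (min t T)" for t :: real
  have c: "c t \<in> {0..T}" "t \<in> {0..T} \<Longrightarrow> c t = t" for t using \<open>0 \<le> T\<close> by (auto simp: c_def)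
  have contc: "continuous_on UNIV c" unfolding c_def by (intro continuous_intros)
  define h where "h z s = g s (exp (2 * K * s) *\<^sub>R z s)" for z :: "real \<Rightarrow> 'a" and s
  define F where "F z t = exp (- 2 * K * c t) *\<^sub>R (y0 + integral {0..c t} (h z))" for z t
  have conth: "continuous_on {0..T} (h z)" if "continuous_on {0..T} z" for z
    using continuous_on_compose2[OF cont, of "{0..T}" "\<lambda>s. (s, exp (2 * K * s) *\<^sub>R z s)"] that
    by (force simp: h_def[abs_def] intro!: continuous_intros)
  have contI: "continuous_on {0..T} (\<lambda>t. integral {0..t} (h z))" if "continuous_on {0..T} z" for z
    using conth[OF that] by (intro indefinite_integral_continuous_1 integrable_continuous_interval)
  have contF0: "continuous_on {0..T} (\<lambda>t. exp (- 2 * K * t) *\<^sub>R (y0 + integral {0..t} (h z)))"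
    if "continuous_on {0..T} z" for z
    by (intro continuous_intros contI that)
  have F_b: "F z \<in> bcontfun" if "continuous_on {0..T} z" for z
  proof -
    have "continuous_on UNIV (F z)" unfolding F_def
      by (rule continuous_on_compose2[OF contF0[OF that] contc]) (use c in auto)
    moreover have "bounded (range (F z))"
    proof (rule bounded_subset)
      show "bounded ((\<lambda>t. exp (- 2 * K * t) *\<^sub>R (y0 + integral {0..t} (h z))) ` {0..T})"
        by (intro compact_imp_bounded compact_continuous_image contF0 that) simp
    qed (use c in \<open>auto simp: F_def image_def\<close>)
    ultimately show ?thesis by (simp add: bcontfun_def)
  qed
  define B where "B z = Bcontfun (F (apply_bcontfun z))" for z :: "real \<Rightarrow>\<^sub>C 'a"
  have B: "apply_bcontfun (B z) t = F (apply_bcontfun z) t" for z t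
    unfolding B_def by (subst Bcontfun_inverse) (auto intro!: F_b)
  have "dist (B z) (B w) \<le> 1/2 * dist z w" for z w
  proof (rule dist_bound)
    fix t
    let ?z = "apply_bcontfun z" and ?w = "apply_bcontfun w"
    define s where "s = c t"
    have s: "0 \<le> s" "s \<le> T" using c(1)[of t] by (auto simp: s_def)
    have int: "h ?z integrable_on {0..s}" "h ?w integrable_on {0..s}"
      using s by (auto intro!: integrable_continuous_interval continuous_on_subset[OF conth])
    \<comment> \<open>Integrating \<open>K * exp (2 * K * r)\<close> leaves
      \<open>exp (2 * K * s) / 2\<close>. The exponential cancels against the prefactor in
      \<open>F\<close>, and the half is the contraction factor.\<close>
    have I: "((\<lambda>r. K * exp (2 * K * r) * dist z w) has_integral
          (exp (2 * K * s) / 2 * dist z w - exp (2 * K * 0) / 2 * dist z w)) {0..s}"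
      by (intro fundamental_theorem_of_calculus)
        (auto intro!: derivative_eq_intros simp: s has_real_derivative_iff_has_vector_derivative[symmetric])
    have "norm (integral {0..s} (\<lambda>r. h ?z r - h ?w r)) \<le> integral {0..s} (\<lambda>r. K * exp (2 * K * r) * dist z w)"
    proof (rule integral_norm_bound_integral)
      fix r assume "r \<in> {0..s}"
      then have "norm (h ?z r - h ?w r) \<le> K * norm (exp (2 * K * r) *\<^sub>R ?z r - exp (2 * K * r) *\<^sub>R ?w r)"
        unfolding h_def using s by (intro lipK) auto
      also have "\<dots> = K * exp (2 * K * r) * dist (?z r) (?w r)"
        by (simp add: scaleR_diff_right[symmetric] dist_norm)
      also have "\<dots> \<le> K * exp (2 * K * r) * dist z w"
        using K by (intro mult_left_mono dist_bounded) auto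
      finally show "norm (h ?z r - h ?w r) \<le> K * exp (2 * K * r) * dist z w" .
    qed (use int I in \<open>auto intro!: integrable_diff\<close>)
    also have "\<dots> \<le> exp (2 * K * s) / 2 * dist z w"
      using I by (auto simp: has_integral_iff)
    finally have *: "norm (integral {0..s} (h ?z) - integral {0..s} (h ?w)) \<le> exp (2 * K * s) / 2 * dist z w"
      using int by (simp add: integral_diff)
    have "dist (B z t) (B w t) = exp (- 2 * K * s) * norm (integral {0..s} (h ?z) - integral {0..s} (h ?w))"
      unfolding B F_def s_def[symmetric] dist_norm by (simp add: scaleR_diff_right[symmetric])
    also have "\<dots> \<le> exp (- 2 * K * s) * (exp (2 * K * s) / 2 * dist z w)"
      using * by (intro mult_left_mono) auto
    also have "\<dots> = 1/2 * dist z w" by (simp add: exp_minus field_simps)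
    finally show "dist (B z t) (B w t) \<le> 1/2 * dist z w" .
  qed
  then obtain z where z: "B z = z" using banach_fix_type[of "1/2" B] by auto
  let ?z = "apply_bcontfun z"
  define y where "y t = exp (2 * K * t) *\<^sub>R ?z t" for t
  have y: "y t = y0 + integral {0..t} (\<lambda>s. g s (y s))" if "t \<in> {0..T}" for t
  proof -
    have "?z t = exp (- 2 * K * t) *\<^sub>R (y0 + integral {0..t} (h ?z))"
      using B[of z t] c(2)[OF that] by (simp add: z F_def)
    then show ?thesis by (simp add: y_def h_def[abs_def] exp_minus)
  qed
  have cy: "continuous_on {0..T} y" unfolding y_def by (intro continuous_intros) auto
  have cgy: "continuous_on {0..T} (\<lambda>s. g s (y s))"
    using conth[of ?z] by (simp add: h_def y_def)
  show thesis
  proof (rule that)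
    show "y 0 = y0" using y[of 0] \<open>0 \<le> T\<close> by simp
    fix t assume t: "t \<in> {0..T}"
    have "((\<lambda>t. y0 + integral {0..t} (\<lambda>s. g s (y s))) has_vector_derivative 0 + g t (y t)) (at t within {0..T})"
      by (intro has_vector_derivative_add has_vector_derivative_const integral_has_vector_derivative cgy t)
    from has_vector_derivative_transform[OF t _ this, of y] y
    show "(y has_vector_derivative g t (y t)) (at t within {0..T})" by simp
  qed (rule cy)
qed

text \<open>The Minkowski sum of \<open>K\<close> and a closed ball is compact, so a continuous
  quantity can be bounded on all the balls at once.\<close>

lemma compact_thickening:
  fixes K :: "'a::euclidean_space set"
  assumes "compact K" "open U" "K \<subseteq> U"
  obtains \<delta> C where "0 < \<delta>" "compact C" "C \<subseteq> U" "\<And>x. x \<in> K \<Longrightarrow> cball x \<delta> \<subseteq> C"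
proof -
  obtain \<delta> where \<delta>: "\<delta> > 0" "(\<Union>x\<in>K. cball x \<delta>) \<subseteq> U"
    using compact_subset_open_imp_cball_epsilon_subset[OF assms] by blast
  define C where "C = {x + d |x d. x \<in> K \<and> d \<in> cball 0 \<delta>}"
  show thesis
  proof (rule that[of \<delta> C])
    show "compact C" unfolding C_def by (intro compact_sums assms compact_cball)
    show "C \<subseteq> U" using \<delta>(2) by (force simp: C_def dist_norm)
    show "cball x \<delta> \<subseteq> C" if "x \<in> K" for x
    proof
      fix y assume "y \<in> cball x \<delta>"
      then have "y = x + (y - x)" "y - x \<in> cball 0 \<delta>" by (auto simp: dist_norm norm_minus_commute)
      then show "y \<in> C" unfolding C_def using that by blast
    qed
  qed (rule \<delta>)
qed

section \<open>Local flow of a time-dependent C1 vector field\<close>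

locale c1_ode =
  fixes f :: "real \<Rightarrow> 'a::euclidean_space \<Rightarrow> 'a" and f' :: "real \<Rightarrow> 'a \<Rightarrow> 'a \<Rightarrow>\<^sub>L 'a"
    and U :: "'a set"
  assumes open_U: "open U"
    and cont_f: "continuous_on ({0..} \<times> U) (\<lambda>(t, y). f t y)"
    and deriv_f: "\<And>t y. 0 \<le> t \<Longrightarrow> y \<in> U \<Longrightarrow> (f t has_derivative f' t y) (at y)"
    and cont_f': "continuous_on ({0..} \<times> U) (\<lambda>(t, y). f' t y)"
begin

definition solves :: "(real \<Rightarrow> 'a) \<Rightarrow> real \<Rightarrow> bool" where
  "solves y T \<longleftrightarrow> (\<forall>t\<in>{0..T}. y t \<in> U \<and> (y has_vector_derivative f t (y t)) (at t within {0..T}))"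

lemma solves_mono: "solves y T \<Longrightarrow> S \<le> T \<Longrightarrow> solves y S"
  unfolding solves_def by (auto intro: has_vector_derivative_within_subset[where S = "{0..T}"])

lemma solves_cong:
  assumes "solves y T" and eq: "\<And>t. t \<in> {0..T} \<Longrightarrow> z t = y t"
  shows "solves z T"
  unfolding solves_def
proof (intro ballI conjI)
  fix t assume t: "t \<in> {0..T}"
  with assms(1) have y: "y t \<in> U" "(y has_vector_derivative f t (y t)) (at t within {0..T})"
    by (auto simp: solves_def)
  show "z t \<in> U" using y eq[OF t] by simp
  show "(z has_vector_derivative f t (z t)) (at t within {0..T})"
    unfolding eq[OF t] by (rule has_vector_derivative_transform[OF t eq y(2)])
qed

lemma solves_continuous: "solves y T \<Longrightarrow> continuous_on {0..T} y"
  unfolding solves_def by (rule continuous_on_vector_derivative[of _ _ "\<lambda>t. f t (y t)"]) simp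

lemma solves_at: "solves y T \<Longrightarrow> 0 < t \<Longrightarrow> t < T \<Longrightarrow> (y has_vector_derivative f t (y t)) (at t)"
  unfolding solves_def by (drule bspec[of _ _ t]) (auto simp: at_within_Icc_at)

text \<open>\<open>K\<close> need not be convex, so the mean value inequality does not apply on it
  directly; a local Lipschitz condition together with compactness replaces it.\<close>

lemma lipschitz_on_compact:
  assumes "compact K" "K \<subseteq> U"
  obtains L where "\<And>t x y. t \<in> {0..T} \<Longrightarrow> x \<in> K \<Longrightarrow> y \<in> K \<Longrightarrow> norm (f t x - f t y) \<le> L * norm (x - y)"
proof -
  \<comment> \<open>\<open>\<bar>t\<bar>\<close> continues the equation evenly to all times, so that
    time ranges over an open set.\<close>
  have *: "continuous_on (UNIV \<times> U) (\<lambda>p::real \<times> 'a. (\<bar>fst p\<bar>, snd p))"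
    "(\<lambda>p::real \<times> 'a. (\<bar>fst p\<bar>, snd p)) ` (UNIV \<times> U) \<subseteq> {0..} \<times> U"
    by (auto intro!: continuous_on_Pair continuous_on_rabs continuous_on_fst continuous_on_snd continuous_on_id)
  have "local_lipschitz UNIV U (\<lambda>t. f \<bar>t\<bar>)"
    by (rule c1_implies_local_lipschitz[where f' = "\<lambda>p. f' \<bar>fst p\<bar> (snd p)"])
      (use deriv_f open_U continuous_on_compose2[OF cont_f' *] in auto)
  then have l: "local_lipschitz {0..T} K (\<lambda>t. f \<bar>t\<bar>)"
    by (rule local_lipschitz_subset) (use assms in auto)
  obtain L where L: "\<And>t. t \<in> {0..T} \<Longrightarrow> L-lipschitz_on K (f \<bar>t\<bar>)"
  proof (rule local_lipschitz_compact_implies_lipschitz[OF l assms(1)])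
    fix x assume "x \<in> K"
    then show "continuous_on {0..T} (\<lambda>t. f \<bar>t\<bar> x)"
      using continuous_on_compose2[OF cont_f, of "{0..T}" "\<lambda>t. (\<bar>t\<bar>, x)"] assms
      by (force intro!: continuous_intros)
  qed auto
  show thesis
    by (rule that[of L]) (use L in \<open>force simp: lipschitz_on_def dist_norm\<close>)
qed

lemma solves_unique:
  assumes y: "solves y T" and z: "solves z T" and "y 0 = z 0" and t: "t \<in> {0..T}"
  shows "y t = z t"
proof -
  let ?K = "y ` {0..T} \<union> z ` {0..T}"
  have "compact ?K" "?K \<subseteq> U"
    using y z by (auto intro!: compact_Un compact_continuous_image solves_continuous simp: solves_def)
  then obtain L where L: "\<And>t x y. t \<in> {0..T} \<Longrightarrow> x \<in> ?K \<Longrightarrow> y \<in> ?K \<Longrightarrow> norm (f t x - f t y) \<le> L * norm (x - y)"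
    by (rule lipschitz_on_compact[of _ T]) auto
  have "y t - z t = 0"
  proof (rule gronwall_zero[where s = 0 and T = T and L = L and e' = "\<lambda>t. f t (y t) - f t (z t)"])
    show "continuous_on {0..T} (\<lambda>t. y t - z t)"
      by (intro continuous_intros solves_continuous y z)
    show "((\<lambda>t. y t - z t) has_vector_derivative f t (y t) - f t (z t)) (at t)" if "0 < t" "t < T" for t
      by (intro has_vector_derivative_diff solves_at[of _ T] y z that)
  qed (use assms L in auto)
  then show ?thesis by simp
qed

text \<open>Outside a tube around the given solution the right-hand side is replaced by its value at the
  nearest point of the tube. The modified equation is globally Lipschitz, and solutions starting close to
  the given one stay inside the tube.\<close>

lemma tube:
  assumes ys: "solves ys T" and "0 \<le> T"
  obtains \<tau> r C Y where "0 < \<tau>" "0 < r" "0 < C"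
    "\<And>\<eta>. \<eta> \<in> ball (ys 0) r \<Longrightarrow> Y \<eta> 0 = \<eta> \<and> solves (Y \<eta>) (T + \<tau>)"
    "\<And>\<eta> \<eta>' t. \<eta> \<in> ball (ys 0) r \<Longrightarrow> \<eta>' \<in> ball (ys 0) r \<Longrightarrow> t \<in> {0..T + \<tau>} \<Longrightarrow>
      norm (Y \<eta> t - Y \<eta>' t) \<le> C * norm (\<eta> - \<eta>')"
proof -
  let ?K = "ys ` {0..T}"
  have cys: "continuous_on {0..T} ys" using solves_continuous[OF ys] .
  have K: "compact ?K" "?K \<subseteq> U"
    using ys cys by (auto intro!: compact_continuous_image simp: solves_def)
  obtain \<delta> TK where \<delta>: "0 < \<delta>" and TK: "compact TK" and TKU: "TK \<subseteq> U"
    and cb: "\<And>x. x \<in> ?K \<Longrightarrow> cball x \<delta> \<subseteq> TK"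
    using compact_thickening[OF K(1) open_U K(2)] by blast
  have "compact ((\<lambda>(t, y). f' t y) ` ({0..T+1} \<times> TK))"
    by (intro compact_continuous_image continuous_on_subset[OF cont_f'] compact_Times TK) (use TKU in auto)
  then obtain B where B: "B > 0" "\<And>t y. t \<in> {0..T+1} \<Longrightarrow> y \<in> TK \<Longrightarrow> norm (f' t y) \<le> B"
    by (force dest!: compact_imp_bounded simp: bounded_pos)
  \<comment> \<open>The centre of the tube is frozen after time \<open>T\<close>. The modified
    equation is thereby defined up to \<open>T + 1\<close>, which is how solutions are continued
    past \<open>T\<close>.\<close>
  define Ys where "Ys t = ys (min t T)" for t
  \<comment> \<open>The nearest-point map onto a ball is 1-Lipschitz, so the bound \<open>B\<close>
    of \<open>f'\<close> on the tube becomes a Lipschitz constant of \<open>g\<close>.\<close>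
  define \<pi> where "\<pi> = closest_point (cball (0::'a) \<delta>)"
  have \<pi>: "\<pi> d \<in> cball 0 \<delta>" "d \<in> cball 0 \<delta> \<Longrightarrow> \<pi> d = d" "norm (\<pi> x - \<pi> y) \<le> norm (x - y)" for d x y
    using \<delta> closest_point_in_set[of "cball (0::'a) \<delta>"] closest_point_lipschitz[of "cball (0::'a) \<delta>" x y]
    by (auto simp: \<pi>_def closest_point_self dist_norm)
  define g where "g t y = f t (Ys t + \<pi> (y - Ys t))" for t y
  have YsK: "Ys t \<in> ?K" if "0 \<le> t" for t using that \<open>0 \<le> T\<close> by (auto simp: Ys_def)
  have cYs: "continuous_on {0..} Ys"
    unfolding Ys_def by (rule continuous_on_compose2[OF cys]) (use \<open>0 \<le> T\<close> in \<open>auto intro!: continuous_intros\<close>)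
  have in_cb: "Ys t + \<pi> d \<in> cball (Ys t) \<delta>" for t d
    using \<pi>(1)[of d] by (simp add: dist_norm)
  have contg: "continuous_on ({0..T+1} \<times> UNIV) (\<lambda>(t, y). g t y)"
  proof -
    have 1: "continuous_on ({0..T+1} \<times> UNIV) (\<lambda>p. Ys (fst p))"
      by (rule continuous_on_compose2[OF cYs]) (auto intro!: continuous_intros)
    have 2: "continuous_on ({0..T+1} \<times> UNIV) (\<lambda>p. \<pi> (snd p - Ys (fst p)))"
      unfolding \<pi>_def
      by (rule continuous_on_compose2[OF continuous_on_closest_point[of _ UNIV]])
        (use \<delta> in \<open>auto intro!: continuous_intros 1\<close>)
    have "continuous_on ({0..T+1} \<times> UNIV) (\<lambda>p. (\<lambda>(t, y). f t y) (fst p, Ys (fst p) + \<pi> (snd p - Ys (fst p))))"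
    proof (rule continuous_on_compose2[OF cont_f])
      show "continuous_on ({0..T+1} \<times> UNIV) (\<lambda>p. (fst p, Ys (fst p) + \<pi> (snd p - Ys (fst p))))"
        by (intro continuous_on_Pair continuous_on_add 1 2 continuous_on_fst continuous_on_id)
      have "Ys t + \<pi> d \<in> U" if "0 \<le> t" for t d
        using cb[OF YsK[OF that]] in_cb[of t d] TKU by blast
      then show "(\<lambda>p. (fst p, Ys (fst p) + \<pi> (snd p - Ys (fst p)))) ` ({0..T+1} \<times> UNIV) \<subseteq> {0..} \<times> U"
        by auto
    qed
    then show ?thesis by (simp add: g_def split_beta)
  qed
  have lipg: "norm (g t x - g t y) \<le> B * norm (x - y)" if t: "t \<in> {0..T+1}" for t x y
  proof -
    have sub: "cball (Ys t) \<delta> \<subseteq> TK" using cb YsK t by auto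
    have d: "(f t has_derivative f' t z) (at z within cball (Ys t) \<delta>)" "onorm (f' t z) \<le> B"
      if "z \<in> cball (Ys t) \<delta>" for z
    proof -
      have z: "z \<in> TK" "z \<in> U" "0 \<le> t" using that sub TKU t by auto
      show "(f t has_derivative f' t z) (at z within cball (Ys t) \<delta>)"
        by (rule has_derivative_at_withinI[OF deriv_f[OF z(3,2)]])
      show "onorm (f' t z) \<le> B" using B(2)[OF t z(1)] by (simp add: norm_blinfun.rep_eq)
    qed
    have "norm (g t x - g t y) \<le> B * norm ((Ys t + \<pi> (x - Ys t)) - (Ys t + \<pi> (y - Ys t)))"
      unfolding g_def by (rule differentiable_bound[OF convex_cball d in_cb in_cb])
    also have "\<dots> \<le> B * norm (x - y)"
      using B(1) \<pi>(3)[of "x - Ys t" "y - Ys t"] by (intro mult_left_mono) auto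
    finally show ?thesis .
  qed
  have "\<exists>y. y 0 = \<eta> \<and> continuous_on {0..T+1} y \<and>
      (\<forall>t\<in>{0..T+1}. (y has_vector_derivative g t (y t)) (at t within {0..T+1}))" for \<eta>
    using lipschitz_ode_exists[OF _ contg lipg] \<open>0 \<le> T\<close> by (metis add_nonneg_nonneg zero_le_one)
  then obtain Y where Y: "\<And>\<eta>. Y \<eta> 0 = \<eta>" "\<And>\<eta>. continuous_on {0..T+1} (Y \<eta>)"
      "\<And>\<eta> t. t \<in> {0..T+1} \<Longrightarrow> (Y \<eta> has_vector_derivative g t (Y \<eta> t)) (at t within {0..T+1})"
    by metis
  have Yat: "(Y \<eta> has_vector_derivative g t (Y \<eta> t)) (at t)" if "0 < t" "t < T + 1" for \<eta> t
    using Y(3)[of t \<eta>] that by (simp add: at_within_Icc_at)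
  define C where "C = exp (B * (T + 1))"
  have C: "0 < C" by (simp add: C_def)
  have lipY: "norm (Y \<eta> t - Y \<eta>' t) \<le> C * norm (\<eta> - \<eta>')" if t: "t \<in> {0..T+1}" for \<eta> \<eta>' t
  proof -
    have "norm (Y \<eta> t - Y \<eta>' t) \<le> (norm (Y \<eta> 0 - Y \<eta>' 0) + 0 * t) * exp (B * t)"
      by (rule gronwall[where T = "T + 1" and e' = "\<lambda>t. g t (Y \<eta> t) - g t (Y \<eta>' t)"])
        (use lipg B(1) t in \<open>auto intro!: continuous_intros Y has_vector_derivative_diff Yat\<close>)
    also have "\<dots> \<le> C * norm (\<eta> - \<eta>')"
      using t B(1) by (auto simp: Y C_def mult.commute intro!: mult_mono)
    finally show ?thesis .
  qed
  have Yys: "Y (ys 0) t = ys t" if t: "t \<in> {0..T}" for t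
  proof -
    have "Y (ys 0) t - ys t = 0"
    proof (rule gronwall_zero[where s = 0 and T = T and L = B and e' = "\<lambda>t. g t (Y (ys 0) t) - f t (ys t)"])
      show "continuous_on {0..T} (\<lambda>t. Y (ys 0) t - ys t)"
        by (intro continuous_intros cys continuous_on_subset[OF Y(2)]) auto
      fix s assume s: "0 < s" "s < T"
      show "((\<lambda>t. Y (ys 0) t - ys t) has_vector_derivative g s (Y (ys 0) s) - f s (ys s)) (at s)"
        using s by (intro has_vector_derivative_diff Yat solves_at[OF ys]) auto
      have "f s (ys s) = g s (ys s)" using s \<pi>(2)[of 0] \<delta> by (simp add: g_def Ys_def)
      then show "norm (g s (Y (ys 0) s) - f s (ys s)) \<le> B * norm (Y (ys 0) s - ys s)"
        using lipg[of s] s by auto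
    qed (use t Y in auto)
    then show ?thesis by simp
  qed
  have "continuous (at T within {0..T+1}) (Y (ys 0))"
    using Y(2) \<open>0 \<le> T\<close> by (simp add: continuous_on_eq_continuous_within)
  then obtain d where d: "d > 0" "\<And>t. t \<in> {0..T+1} \<Longrightarrow> dist t T < d \<Longrightarrow> dist (Y (ys 0) t) (Y (ys 0) T) < \<delta>/2"
    unfolding continuous_within_eps_delta using \<delta> by (meson half_gt_zero)
  define \<tau> where "\<tau> = min 1 (d/2)"
  have \<tau>: "0 < \<tau>" "\<tau> \<le> 1" "\<tau> < d" using d by (auto simp: \<tau>_def)
  have near0: "dist (Y (ys 0) t) (Ys t) < \<delta>/2" if "t \<in> {0..T+\<tau>}" for t
  proof (cases "t \<le> T")
    case True then show ?thesis using Yys[of t] that \<delta> by (simp add: Ys_def)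
  next
    case False
    then show ?thesis using d(2)[of t] that \<tau> \<open>0 \<le> T\<close> Yys[of T] by (simp add: Ys_def dist_real_def)
  qed
  \<comment> \<open>One half of the width \<open>\<delta>\<close> is spent on the drift of
    \<open>Y (ys 0)\<close> after \<open>T\<close>, which fixes \<open>\<tau>\<close>; the other
    half on the perturbation of the initial value, amplified at most by \<open>C\<close>.\<close>
  define r where "r = \<delta> / (2 * C)"
  have r: "0 < r" using \<delta> C by (simp add: r_def)
  have near: "dist (Y \<eta> t) (Ys t) < \<delta>" if "t \<in> {0..T+\<tau>}" "\<eta> \<in> ball (ys 0) r" for t \<eta>
  proof -
    have "norm (Y \<eta> t - Y (ys 0) t) \<le> C * norm (\<eta> - ys 0)"
      using that \<tau> by (intro lipY) auto
    also have "\<dots> < C * r" using that C by (simp add: dist_norm norm_minus_commute)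
    also have "\<dots> = \<delta>/2" using C by (simp add: r_def)
    finally show ?thesis using near0[OF that(1)] by (smt (verit) dist_norm dist_triangle field_sum_of_halves)
  qed
  show thesis
  proof (rule that[of \<tau> r C Y])
    fix \<eta> assume \<eta>: "\<eta> \<in> ball (ys 0) r"
    have "solves (Y \<eta>) (T + \<tau>)" unfolding solves_def
    proof (intro ballI conjI)
      fix t assume t: "t \<in> {0..T+\<tau>}"
      have "Y \<eta> t \<in> cball (Ys t) \<delta>" using near[OF t \<eta>] by (simp add: dist_commute)
      then show "Y \<eta> t \<in> U" using cb[OF YsK, of t] t TKU by auto
      have "g t (Y \<eta> t) = f t (Y \<eta> t)"
        using near[OF t \<eta>] \<pi>(2)[of "Y \<eta> t - Ys t"] by (simp add: g_def dist_norm norm_minus_commute)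
      then show "(Y \<eta> has_vector_derivative f t (Y \<eta> t)) (at t within {0..T+\<tau>})"
        using has_vector_derivative_within_subset[OF Y(3)[of t \<eta>], of "{0..T+\<tau>}"] t \<tau> by auto
    qed
    then show "Y \<eta> 0 = \<eta> \<and> solves (Y \<eta>) (T + \<tau>)" using Y by simp
  next
    show "norm (Y \<eta> t - Y \<eta>' t) \<le> C * norm (\<eta> - \<eta>')" if "t \<in> {0..T + \<tau>}" for \<eta> \<eta>' t
      using that \<tau> by (intro lipY) auto
  qed (use \<tau> r C in auto)
qed

definition dom :: "(real \<times> 'a) set" where
  "dom = {(t, \<eta>). 0 \<le> t \<and> (\<exists>y. y 0 = \<eta> \<and> solves y t)}"

text \<open>The chosen solution may vary with \<open>t\<close>; by uniqueness all choices agree, and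
  no maximal solution has to be glued together.\<close>

definition flow :: "real \<Rightarrow> 'a \<Rightarrow> 'a" where
  "flow t \<eta> = (SOME y. y 0 = \<eta> \<and> solves y t) t"

lemma flow_eq:
  assumes "solves y T" "t \<in> {0..T}"
  shows "(t, y 0) \<in> dom" "flow t (y 0) = y t"
proof -
  have y: "solves y t" using assms solves_mono by auto
  then show "(t, y 0) \<in> dom" using assms by (auto simp: dom_def)
  have "\<exists>z. z 0 = y 0 \<and> solves z t" using y by blast
  from someI_ex[OF this] have "(SOME z. z 0 = y 0 \<and> solves z t) 0 = y 0" "solves (SOME z. z 0 = y 0 \<and> solves z t) t"
    by auto
  from solves_unique[OF this(2) y this(1), of t] show "flow t (y 0) = y t"
    using assms by (auto simp: flow_def)
qed

lemma dom_nonneg: "(t, \<eta>) \<in> dom \<Longrightarrow> 0 \<le> t"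
  by (simp add: dom_def)

lemma flow_local:
  assumes "(T, \<eta>0) \<in> dom"
  obtains \<tau> r C where "0 < \<tau>" "0 < r" "0 < C" "{0..T + \<tau>} \<times> ball \<eta>0 r \<subseteq> dom"
    "\<And>\<eta>. \<eta> \<in> ball \<eta>0 r \<Longrightarrow> solves (\<lambda>t. flow t \<eta>) (T + \<tau>)"
    "\<And>\<eta> t. \<eta> \<in> ball \<eta>0 r \<Longrightarrow> t \<in> {0..T + \<tau>} \<Longrightarrow> norm (flow t \<eta> - flow t \<eta>0) \<le> C * norm (\<eta> - \<eta>0)"
proof -
  from assms obtain ys where ys: "ys 0 = \<eta>0" "solves ys T" "0 \<le> T" by (auto simp: dom_def)
  obtain \<tau> r C Y where *: "0 < \<tau>" "0 < r" "0 < C"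
    "\<And>\<eta>. \<eta> \<in> ball \<eta>0 r \<Longrightarrow> Y \<eta> 0 = \<eta> \<and> solves (Y \<eta>) (T + \<tau>)"
    "\<And>\<eta> \<eta>' t. \<eta> \<in> ball \<eta>0 r \<Longrightarrow> \<eta>' \<in> ball \<eta>0 r \<Longrightarrow> t \<in> {0..T + \<tau>} \<Longrightarrow>
      norm (Y \<eta> t - Y \<eta>' t) \<le> C * norm (\<eta> - \<eta>')"
    using tube[OF ys(2,3)] unfolding ys(1) by metis
  have Y: "(t, \<eta>) \<in> dom" "flow t \<eta> = Y \<eta> t" if "\<eta> \<in> ball \<eta>0 r" "t \<in> {0..T + \<tau>}" for \<eta> t
    using flow_eq[of "Y \<eta>" "T + \<tau>" t] *(4)[of \<eta>] that by auto
  show thesis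
  proof (rule that[of \<tau> r C])
    show "solves (\<lambda>t. flow t \<eta>) (T + \<tau>)" if "\<eta> \<in> ball \<eta>0 r" for \<eta>
      by (rule solves_cong[of "Y \<eta>"]) (use * Y that in auto)
  qed (use * Y in auto)
qed

lemma
  assumes "(t, \<eta>) \<in> dom"
  shows flow_in: "flow t \<eta> \<in> U" and flow_0: "flow 0 \<eta> = \<eta>"
    and dom_down: "\<And>s. 0 \<le> s \<Longrightarrow> s \<le> t \<Longrightarrow> (s, \<eta>) \<in> dom"
proof -
  obtain y where y: "0 \<le> t" "y 0 = \<eta>" "solves y t" using assms by (auto simp: dom_def)
  then show "flow t \<eta> \<in> U" "flow 0 \<eta> = \<eta>" "\<And>s. 0 \<le> s \<Longrightarrow> s \<le> t \<Longrightarrow> (s, \<eta>) \<in> dom"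
    using flow_eq[of y t t] flow_eq[of y t 0] flow_eq(1)[of y t] by (auto simp: solves_def)
qed

lemma at_within_extend: "0 \<le> t \<Longrightarrow> t < S \<Longrightarrow> at t within {0..S} = at t within {0::real..}"
  by (rule at_within_nhd[of _ "{..<S}"]) auto

lemma flow_deriv:
  assumes "(t, \<eta>) \<in> dom"
  shows "((\<lambda>s. flow s \<eta>) has_vector_derivative f t (flow t \<eta>)) (at t within {0..})"
proof -
  obtain \<tau> r where *: "0 < \<tau>" "0 < r" "\<And>\<eta>'. \<eta>' \<in> ball \<eta> r \<Longrightarrow> solves (\<lambda>t. flow t \<eta>') (t + \<tau>)"
    using flow_local[OF assms] by metis
  have "((\<lambda>s. flow s \<eta>) has_vector_derivative f t (flow t \<eta>)) (at t within {0..t + \<tau>})"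
    using * dom_nonneg[OF assms] by (simp add: solves_def)
  then show ?thesis
    using *(1) dom_nonneg[OF assms] at_within_extend[of t "t + \<tau>"] by simp
qed

text \<open>Continuity in \<open>t\<close> for fixed \<open>\<eta>\<close> and continuity in
  \<open>\<eta>\<close> uniformly on a time interval reaching past \<open>T\<close> combine to joint
  continuity. The same scheme serves \<open>flow\<close> and \<open>Dflow\<close>.\<close>

lemma joint_continuity:
  fixes h :: "real \<Rightarrow> 'a \<Rightarrow> 'b::real_normed_vector"
  assumes 1: "\<And>t \<eta>. (t, \<eta>) \<in> dom \<Longrightarrow> continuous (at t within {0..}) (\<lambda>s. h s \<eta>)"
    and 2: "\<And>T \<eta>0 e. (T, \<eta>0) \<in> dom \<Longrightarrow> 0 < e \<Longrightarrow>
      \<exists>\<tau>>0. \<exists>r>0. \<forall>t\<in>{0..T + \<tau>}. \<forall>\<eta>\<in>ball \<eta>0 r. norm (h t \<eta> - h t \<eta>0) \<le> e"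
  shows "continuous_on dom (\<lambda>(t, \<eta>). h t \<eta>)"
  unfolding continuous_on_iff
proof (intro ballI allI impI)
  fix p e assume "p \<in> dom" and e: "(0::real) < e"
  then obtain T \<eta>0 where p: "p = (T, \<eta>0)" "(T, \<eta>0) \<in> dom" by (cases p) auto
  obtain \<tau> r where tr: "\<tau> > 0" "r > 0" "\<And>t \<eta>. t \<in> {0..T + \<tau>} \<Longrightarrow> \<eta> \<in> ball \<eta>0 r \<Longrightarrow> norm (h t \<eta> - h t \<eta>0) \<le> e/2"
    using 2[OF p(2), of "e/2"] e by auto
  obtain d where d: "d > 0" "\<And>t. 0 \<le> t \<Longrightarrow> dist t T < d \<Longrightarrow> dist (h t \<eta>0) (h T \<eta>0) < e/2"
    using 1[OF p(2)] e unfolding continuous_within_eps_delta by (metis atLeast_iff half_gt_zero)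
  show "\<exists>d>0. \<forall>x'\<in>dom. dist x' p < d \<longrightarrow> dist (case x' of (t, \<eta>) \<Rightarrow> h t \<eta>) (case p of (t, \<eta>) \<Rightarrow> h t \<eta>) < e"
  proof (intro exI[of _ "min d (min \<tau> r)"] conjI ballI impI)
    fix q assume q: "q \<in> dom" "dist q p < min d (min \<tau> r)"
    obtain t \<eta> where [simp]: "q = (t, \<eta>)" by (cases q)
    have 0: "dist t T < min d \<tau>" "dist \<eta> \<eta>0 < r" "0 \<le> t"
      using q dist_fst_le[of q p] dist_snd_le[of q p] dom_nonneg by (auto simp: p)
    then have "norm (h t \<eta> - h t \<eta>0) \<le> e/2"
      by (intro tr(3)) (auto simp: dist_commute dist_real_def)
    moreover have "dist (h t \<eta>0) (h T \<eta>0) < e/2" using 0 by (intro d(2)) auto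
    ultimately show "dist (case q of (t, \<eta>) \<Rightarrow> h t \<eta>) (case p of (t, \<eta>) \<Rightarrow> h t \<eta>) < e"
      using dist_triangle[of "h t \<eta>" "h T \<eta>0" "h t \<eta>0"] by (simp add: p dist_norm)
  qed (use d tr in auto)
qed

lemma flow_continuous: "continuous_on dom (\<lambda>(t, \<eta>). flow t \<eta>)"
proof (rule joint_continuity[of flow])
  fix T \<eta>0 and e :: real assume dom: "(T, \<eta>0) \<in> dom" and e: "0 < e"
  obtain \<tau> r C where *: "0 < \<tau>" "0 < r" "0 < C"
    "\<And>\<eta> t. \<eta> \<in> ball \<eta>0 r \<Longrightarrow> t \<in> {0..T + \<tau>} \<Longrightarrow> norm (flow t \<eta> - flow t \<eta>0) \<le> C * norm (\<eta> - \<eta>0)"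
    using flow_local[OF dom] by metis
  show "\<exists>\<tau>>0. \<exists>r>0. \<forall>t\<in>{0..T + \<tau>}. \<forall>\<eta>\<in>ball \<eta>0 r. norm (flow t \<eta> - flow t \<eta>0) \<le> e"
  proof (rule exI[of _ \<tau>], intro exI[of _ "min r (e / C)"] conjI ballI)
    fix t \<eta> assume "t \<in> {0..T + \<tau>}" "\<eta> \<in> ball \<eta>0 (min r (e / C))"
    then have "norm (flow t \<eta> - flow t \<eta>0) \<le> C * norm (\<eta> - \<eta>0)" "norm (\<eta> - \<eta>0) < e / C"
      using *(4)[of \<eta> t] by (auto simp: dist_norm norm_minus_commute)
    then show "norm (flow t \<eta> - flow t \<eta>0) \<le> e" using *(3) by (simp add: field_simps)
  qed (use * e in auto)
qed (rule has_vector_derivative_continuous[OF flow_deriv])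

end

section \<open>Differentiability of the flow in the initial value\<close>

lemma has_derivative_at_altI:
  assumes "bounded_linear F"
    and "\<And>e. 0 < e \<Longrightarrow> \<exists>d>0. \<forall>y. norm (y - x) < d \<longrightarrow> norm (f y - f x - F (y - x)) \<le> e * norm (y - x)"
  shows "(f has_derivative F) (at x)"
  using assms unfolding has_derivative_at_alt by auto

context c1_ode
begin

text \<open>Uniform continuity on a compact tube makes the radius \<open>\<rho>\<close> independent
  of the time.\<close>

lemma f'_near:
  assumes y: "solves y S" and "0 < e"
  obtains \<rho> where "0 < \<rho>"
    "\<And>t z. t \<in> {0..S} \<Longrightarrow> z \<in> cball (y t) \<rho> \<Longrightarrow> z \<in> U \<and> norm (f' t z - f' t (y t)) \<le> e"
proof -
  let ?K = "y ` {0..S}"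
  have K: "compact ?K" "?K \<subseteq> U"
    using y by (auto intro!: compact_continuous_image solves_continuous simp: solves_def)
  obtain \<delta> TK where \<delta>: "0 < \<delta>" and TK: "compact TK" and TKU: "TK \<subseteq> U"
    and cb: "\<And>x. x \<in> ?K \<Longrightarrow> cball x \<delta> \<subseteq> TK"
    using compact_thickening[OF K(1) open_U K(2)] by blast
  have "uniformly_continuous_on ({0..S} \<times> TK) (\<lambda>(t, y). f' t y)"
    by (intro compact_uniformly_continuous continuous_on_subset[OF cont_f'] compact_Times TK) (use TKU in auto)
  then obtain d where d: "d > 0" "\<And>p q. p \<in> {0..S} \<times> TK \<Longrightarrow> q \<in> {0..S} \<times> TK \<Longrightarrow> dist q p < d \<Longrightarrow>
      dist (case q of (t, y) \<Rightarrow> f' t y) (case p of (t, y) \<Rightarrow> f' t y) < e"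
    unfolding uniformly_continuous_on_def using \<open>0 < e\<close> by metis
  show thesis
  proof (rule that[of "min \<delta> (d/2)"])
    fix t z assume t: "t \<in> {0..S}" and z: "z \<in> cball (y t) (min \<delta> (d / 2))"
    have "y t \<in> cball (y t) \<delta>" "z \<in> cball (y t) \<delta>" "dist z (y t) < d"
      using z \<delta> d(1) by (auto simp: dist_commute)
    then have "z \<in> TK" "y t \<in> TK" using cb[of "y t"] t by auto
    then show "z \<in> U \<and> norm (f' t z - f' t (y t)) \<le> e"
      using d(2)[of "(t, y t)" "(t, z)"] t TKU \<open>dist z (y t) < d\<close> by (auto simp: dist_Pair_Pair dist_norm)
  qed (use \<delta> d in auto)
qed

lemma f'_bound:
  assumes y: "solves y S"
  obtains M where "0 < M" "\<And>t. t \<in> {0..S} \<Longrightarrow> norm (f' t (y t)) \<le> M"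
proof -
  have "continuous_on {0..S} (\<lambda>t. (\<lambda>(t, y). f' t y) (t, y t))"
    by (rule continuous_on_compose2[OF cont_f'])
      (use y in \<open>auto intro!: continuous_on_Pair continuous_on_id solves_continuous simp: solves_def\<close>)
  then have "compact ((\<lambda>t. f' t (y t)) ` {0..S})" by (intro compact_continuous_image) auto
  then show thesis using that by (force dest!: compact_imp_bounded simp: bounded_pos)
qed

lemma variational_ode:
  assumes y: "solves y S" and "0 \<le> S"
  obtains W where "W 0 = id_blinfun" "continuous_on {0..S} W"
    "\<And>t. t \<in> {0..S} \<Longrightarrow> (W has_vector_derivative f' t (y t) o\<^sub>L W t) (at t within {0..S})"
proof -
  obtain M where M: "\<And>t. t \<in> {0..S} \<Longrightarrow> norm (f' t (y t)) \<le> M" using f'_bound[OF y] by metis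
  have "continuous_on {0..S} (\<lambda>t. (\<lambda>(t, y). f' t y) (t, y t))"
    by (rule continuous_on_compose2[OF cont_f'])
      (use y in \<open>auto intro!: continuous_on_Pair continuous_on_id solves_continuous simp: solves_def\<close>)
  then have 1: "continuous_on ({0..S} \<times> UNIV) (\<lambda>p. f' (fst p) (y (fst p)))"
    by (auto intro!: continuous_on_compose2[where g = "\<lambda>t. f' t (y t)" and f = fst] continuous_intros)
  show thesis
  proof (rule lipschitz_ode_exists[of S "\<lambda>t W. f' t (y t) o\<^sub>L W" M id_blinfun])
    show "continuous_on ({0..S} \<times> UNIV) (\<lambda>(t, W). f' t (y t) o\<^sub>L W)"
      unfolding split_beta
      by (intro bounded_bilinear.continuous_on[OF bounded_bilinear_blinfun_compose] 1 continuous_intros)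
    fix t and V W :: "'a \<Rightarrow>\<^sub>L 'a" assume t: "t \<in> {0..S}"
    have "(f' t (y t) o\<^sub>L V) - (f' t (y t) o\<^sub>L W) = f' t (y t) o\<^sub>L (V - W)"
      by (rule bounded_bilinear.diff_right[OF bounded_bilinear_blinfun_compose, symmetric])
    also have "norm \<dots> \<le> norm (f' t (y t)) * norm (V - W)" by (rule norm_blinfun_compose)
    also have "\<dots> \<le> M * norm (V - W)" using M[OF t] by (intro mult_right_mono) auto
    finally show "norm ((f' t (y t) o\<^sub>L V) - (f' t (y t) o\<^sub>L W)) \<le> M * norm (V - W)" .
  qed (use assms that in auto)
qed

text \<open>Mean value inequality for \<open>z \<mapsto> f t z - f' t a z\<close>, whose derivative
  on the ball is \<open>f' t z - f' t a\<close>.\<close>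

lemma linearization_error:
  assumes "0 \<le> t" and \<rho>: "\<And>z. z \<in> cball a \<rho> \<Longrightarrow> z \<in> U \<and> norm (f' t z - f' t a) \<le> e" and b: "b \<in> cball a \<rho>"
  shows "norm (f t b - f t a - f' t a (b - a)) \<le> e * norm (b - a)"
proof -
  define k where "k z = f t z - f' t a z" for z
  have dk: "(k has_derivative (\<lambda>h. (f' t z - f' t a) h)) (at z within cball a \<rho>)"
      "onorm (\<lambda>h. (f' t z - f' t a) h) \<le> e" if "z \<in> cball a \<rho>" for z
  proof -
    have "z \<in> U" using \<rho>[OF that] by simp
    from has_derivative_diff[OF deriv_f[OF assms(1) this]
        bounded_linear.has_derivative[OF blinfun.bounded_linear_right[of "f' t a"] has_derivative_ident]]
    have "(k has_derivative (\<lambda>h. (f' t z - f' t a) h)) (at z)"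
      by (simp add: k_def[abs_def] blinfun.diff_left)
    then show "(k has_derivative (\<lambda>h. (f' t z - f' t a) h)) (at z within cball a \<rho>)"
      by (rule has_derivative_at_withinI)
    show "onorm (\<lambda>h. (f' t z - f' t a) h) \<le> e"
      using \<rho>[OF that] by (simp add: norm_blinfun.rep_eq)
  qed
  have "0 \<le> \<rho>" using b zero_le_dist[of a b] by (auto simp del: zero_le_dist)
  then have a: "a \<in> cball a \<rho>" by simp
  have "norm (k b - k a) \<le> e * norm (b - a)"
    by (rule differentiable_bound[OF convex_cball dk b a])
  then show ?thesis by (simp add: k_def blinfun.diff_right algebra_simps)
qed

text \<open>The candidate derivative is the fundamental solution \<open>W\<close> of the linearised
  equation. The defect \<open>flow s \<eta> - flow s \<eta>0 - W s h\<close>, with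
  \<open>h = \<eta> - \<eta>0\<close>, starts at zero and satisfies the linearised equation up to
  the linearisation error, which is \<open>o(norm h)\<close> uniformly in time.\<close>

lemma flow_has_derivative:
  assumes dom: "(T, \<eta>0) \<in> dom"
  obtains \<tau> W where "0 < \<tau>" "W 0 = id_blinfun"
    "\<And>t. t \<in> {0..T + \<tau>} \<Longrightarrow> (W has_vector_derivative f' t (flow t \<eta>0) o\<^sub>L W t) (at t within {0..T + \<tau>})"
    "\<And>t. t \<in> {0..T + \<tau>} \<Longrightarrow> (flow t has_derivative blinfun_apply (W t)) (at \<eta>0)"
proof -
  obtain \<tau> r C where loc: "0 < \<tau>" "0 < r" "0 < C" "{0..T + \<tau>} \<times> ball \<eta>0 r \<subseteq> dom"
    "\<And>\<eta>. \<eta> \<in> ball \<eta>0 r \<Longrightarrow> solves (\<lambda>t. flow t \<eta>) (T + \<tau>)"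
    "\<And>\<eta> t. \<eta> \<in> ball \<eta>0 r \<Longrightarrow> t \<in> {0..T + \<tau>} \<Longrightarrow> norm (flow t \<eta> - flow t \<eta>0) \<le> C * norm (\<eta> - \<eta>0)"
    using flow_local[OF dom] by metis
  define S where "S = T + \<tau>"
  have S: "0 < S" using dom_nonneg[OF dom] loc by (simp add: S_def)
  have y: "solves (\<lambda>t. flow t \<eta>0) S" using loc(5)[of \<eta>0] loc(2) by (simp add: S_def)
  obtain W where W: "W 0 = id_blinfun" "continuous_on {0..S} W"
    "\<And>t. t \<in> {0..S} \<Longrightarrow> (W has_vector_derivative f' t (flow t \<eta>0) o\<^sub>L W t) (at t within {0..S})"
    using variational_ode[OF y] S by (metis less_imp_le)
  obtain M where M: "0 < M" "\<And>t. t \<in> {0..S} \<Longrightarrow> norm (f' t (flow t \<eta>0)) \<le> M"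
    using f'_bound[OF y] by metis
  have "(flow t has_derivative W t) (at \<eta>0)" if t: "t \<in> {0..S}" for t
  proof (rule has_derivative_at_altI)
    fix e :: real assume e: "0 < e"
    \<comment> \<open>\<open>E\<close> collects the factors by which Gronwall and the Lipschitz
      constant \<open>C\<close> enlarge the linearisation error; \<open>e1 = e / E\<close> makes the
      final bound exactly \<open>e * norm h\<close>.\<close>
    define E where "E = C * S * exp (M * S)"
    have E: "0 < E" using loc S by (simp add: E_def)
    define e1 where "e1 = e / E"
    have e1: "0 < e1" using e E by (simp add: e1_def)
    obtain \<rho> where \<rho>: "0 < \<rho>" "\<And>t z. t \<in> {0..S} \<Longrightarrow> z \<in> cball (flow t \<eta>0) \<rho> \<Longrightarrow>
        z \<in> U \<and> norm (f' t z - f' t (flow t \<eta>0)) \<le> e1"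
      using f'_near[OF y e1] by metis
    show "\<exists>d>0. \<forall>\<eta>. norm (\<eta> - \<eta>0) < d \<longrightarrow> norm (flow t \<eta> - flow t \<eta>0 - W t (\<eta> - \<eta>0)) \<le> e * norm (\<eta> - \<eta>0)"
    proof (intro exI[of _ "min r (\<rho> / C)"] conjI allI impI)
      fix \<eta> assume \<eta>: "norm (\<eta> - \<eta>0) < min r (\<rho> / C)"
      let ?h = "\<eta> - \<eta>0"
      have \<eta>r: "\<eta> \<in> ball \<eta>0 r" using \<eta> by (simp add: dist_norm norm_minus_commute)
      have z: "solves (\<lambda>t. flow t \<eta>) S" using loc(5)[OF \<eta>r] by (simp add: S_def)
      have close: "norm (flow s \<eta> - flow s \<eta>0) \<le> C * norm ?h" if "s \<in> {0..S}" for s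
        using loc(6)[OF \<eta>r] that by (simp add: S_def)
      have in_cb: "flow s \<eta> \<in> cball (flow s \<eta>0) \<rho>" if "s \<in> {0..S}" for s
      proof -
        have "C * norm ?h \<le> \<rho>" using \<eta> loc(3) by (simp add: field_simps)
        then show ?thesis using close[OF that] by (simp add: dist_norm norm_minus_commute)
      qed
      define D where "D s = flow s \<eta> - flow s \<eta>0 - W s ?h" for s
      define D' where "D' s = f s (flow s \<eta>) - f s (flow s \<eta>0) - (f' s (flow s \<eta>0) o\<^sub>L W s) ?h" for s
      have "norm (D t) \<le> (norm (D 0) + e1 * (C * norm ?h) * t) * exp (M * t)"
      proof (rule gronwall[where e = D and T = S and e' = D'])
        show "continuous_on {0..S} D" unfolding D_def
          by (intro continuous_intros solves_continuous y z W(2))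
        fix s assume s: "0 < s" "s < S"
        then have sS: "s \<in> {0..S}" by simp
        have "(W has_vector_derivative f' s (flow s \<eta>0) o\<^sub>L W s) (at s)"
          using W(3)[OF sS] s by (simp add: at_within_Icc_at)
        then have "((\<lambda>s. W s ?h) has_vector_derivative (f' s (flow s \<eta>0) o\<^sub>L W s) ?h) (at s)"
          by (rule bounded_linear.has_vector_derivative[OF blinfun.bounded_linear_left])
        then show "(D has_vector_derivative D' s) (at s)" unfolding D_def D'_def
          by (intro has_vector_derivative_diff solves_at[OF y s] solves_at[OF z s])
        have "D' s = (f s (flow s \<eta>) - f s (flow s \<eta>0) - f' s (flow s \<eta>0) (flow s \<eta> - flow s \<eta>0)) + f' s (flow s \<eta>0) (D s)"
          by (simp add: D'_def D_def blinfun.diff_right)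
        also have "norm \<dots> \<le> e1 * norm (flow s \<eta> - flow s \<eta>0) + norm (f' s (flow s \<eta>0)) * norm (D s)"
          by (intro norm_triangle_mono linearization_error[where \<rho> = \<rho>] norm_blinfun in_cb[OF sS] \<rho>(2)[OF sS])
            (use s in auto)
        also have "\<dots> \<le> e1 * (C * norm ?h) + M * norm (D s)"
          using e1 close[OF sS] M(2)[OF sS] by (intro add_mono mult_left_mono mult_right_mono) auto
        finally show "norm (D' s) \<le> M * norm (D s) + e1 * (C * norm ?h)" by simp
      qed (use M(1) e1 loc(3) t in auto)
      also have "D 0 = 0"
      proof -
        have "(S, \<eta>) \<in> dom" using loc(4) \<eta>r S by (auto simp: S_def)
        then show ?thesis using flow_0[OF dom] flow_0[of S \<eta>] by (simp add: D_def W(1))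
      qed
      also have "(norm (0::'a) + e1 * (C * norm ?h) * t) * exp (M * t) \<le> (e1 * (C * norm ?h) * S) * exp (M * S)"
        using t M(1) e1 loc(3) by (auto intro!: mult_mono)
      also have "\<dots> = e1 * E * norm ?h" by (simp add: E_def)
      also have "e1 * E = e" using E by (simp add: e1_def)
      finally show "norm (flow t \<eta> - flow t \<eta>0 - W t ?h) \<le> e * norm ?h" by (simp add: D_def)
    qed (use loc \<rho> in auto)
  qed (rule blinfun.bounded_linear_right)
  then show thesis using that[of \<tau> W] loc(1) W unfolding S_def by blast
qed

definition Dflow :: "real \<Rightarrow> 'a \<Rightarrow> 'a \<Rightarrow>\<^sub>L 'a" where
  "Dflow t \<eta> = (SOME D. (flow t has_derivative blinfun_apply D) (at \<eta>))"

lemma Dflow_eq: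
  assumes "(flow t has_derivative blinfun_apply D) (at \<eta>)"
  shows "Dflow t \<eta> = D"
proof -
  have "(flow t has_derivative blinfun_apply (Dflow t \<eta>)) (at \<eta>)"
    unfolding Dflow_def by (rule someI[of _ D]) (rule assms)
  from has_derivative_unique[OF this assms] show ?thesis by (simp add: blinfun_apply_inject)
qed

lemma
  assumes dom: "(t, \<eta>) \<in> dom"
  shows has_derivative_Dflow: "(flow t has_derivative blinfun_apply (Dflow t \<eta>)) (at \<eta>)"
    and Dflow_0: "Dflow 0 \<eta> = id_blinfun"
    and Dflow_deriv: "((\<lambda>s. Dflow s \<eta>) has_vector_derivative f' t (flow t \<eta>) o\<^sub>L Dflow t \<eta>) (at t within {0..})"
proof -
  obtain \<tau> W where W: "0 < \<tau>" "W 0 = id_blinfun"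
    "\<And>s. s \<in> {0..t + \<tau>} \<Longrightarrow> (W has_vector_derivative f' s (flow s \<eta>) o\<^sub>L W s) (at s within {0..t + \<tau>})"
    "\<And>s. s \<in> {0..t + \<tau>} \<Longrightarrow> (flow s has_derivative blinfun_apply (W s)) (at \<eta>)"
    using flow_has_derivative[OF dom] by metis
  have t: "0 \<le> t" "t \<in> {0..t + \<tau>}" "0 \<in> {0..t + \<tau>}" using dom_nonneg[OF dom] W(1) by auto
  have eq: "Dflow s \<eta> = W s" if "s \<in> {0..t + \<tau>}" for s
    using Dflow_eq[OF W(4)[OF that]] .
  show "(flow t has_derivative blinfun_apply (Dflow t \<eta>)) (at \<eta>)" using W(4) eq t by simp
  show "Dflow 0 \<eta> = id_blinfun" using W(2) eq t by simp
  show "((\<lambda>s. Dflow s \<eta>) has_vector_derivative f' t (flow t \<eta>) o\<^sub>L Dflow t \<eta>) (at t within {0..})"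
    using has_vector_derivative_transform[OF t(2) eq W(3)[OF t(2)]] eq[OF t(2)]
      at_within_extend[of t "t + \<tau>"] t(1) W(1) by simp
qed

lemma Dflow_at:
  assumes "(t, \<eta>) \<in> dom" "0 < s" "s < t"
  shows "((\<lambda>s. Dflow s \<eta>) has_vector_derivative f' s (flow s \<eta>) o\<^sub>L Dflow s \<eta>) (at s)"
proof -
  have "at s within {0..} = at s" by (rule at_within_interior) (use assms in \<open>simp add: interior_real_atLeast\<close>)
  then show ?thesis using Dflow_deriv[OF dom_down[OF assms(1), of s]] assms by simp
qed

lemma Dflow_continuous_time:
  assumes "(t, \<eta>) \<in> dom"
  shows "continuous_on {0..t} (\<lambda>s. Dflow s \<eta>)"
  unfolding continuous_on_eq_continuous_within
proof
  fix s assume s: "s \<in> {0..t}"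
  have "continuous (at s within {0..}) (\<lambda>s. Dflow s \<eta>)"
    using has_vector_derivative_continuous[OF Dflow_deriv[OF dom_down[OF assms]]] s by auto
  then show "continuous (at s within {0..t}) (\<lambda>s. Dflow s \<eta>)"
    by (rule continuous_within_subset) auto
qed

text \<open>\<open>Dflow\<close> at \<open>\<eta>\<close> and at \<open>\<eta>0\<close> solve linear
  equations with nearby coefficients. Their difference is split so that the small difference of the
  coefficients multiplies \<open>Dflow s \<eta>0\<close>, for which a bound is already
  known.\<close>

lemma Dflow_continuous: "continuous_on dom (\<lambda>(t, \<eta>). Dflow t \<eta>)"
proof (rule joint_continuity[of Dflow])
  fix T \<eta>0 and e :: real assume dom: "(T, \<eta>0) \<in> dom" and e: "0 < e"
  obtain \<tau> r C where loc: "0 < \<tau>" "0 < r" "0 < C" "{0..T + \<tau>} \<times> ball \<eta>0 r \<subseteq> dom"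
    "\<And>\<eta>. \<eta> \<in> ball \<eta>0 r \<Longrightarrow> solves (\<lambda>t. flow t \<eta>) (T + \<tau>)"
    "\<And>\<eta> t. \<eta> \<in> ball \<eta>0 r \<Longrightarrow> t \<in> {0..T + \<tau>} \<Longrightarrow> norm (flow t \<eta> - flow t \<eta>0) \<le> C * norm (\<eta> - \<eta>0)"
    using flow_local[OF dom] by metis
  define S where "S = T + \<tau>"
  have S: "0 < S" using dom_nonneg[OF dom] loc by (simp add: S_def)
  have y: "solves (\<lambda>t. flow t \<eta>0) S" using loc(5)[of \<eta>0] loc(2) by (simp add: S_def)
  have Sdom: "(S, \<eta>) \<in> dom" if "\<eta> \<in> ball \<eta>0 r" for \<eta> using loc(4) that S by (auto simp: S_def)
  have S0: "(S, \<eta>0) \<in> dom" using Sdom loc(2) by simp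
  obtain M where M: "0 < M" "\<And>t. t \<in> {0..S} \<Longrightarrow> norm (f' t (flow t \<eta>0)) \<le> M"
    using f'_bound[OF y] by metis
  have "compact ((\<lambda>t. Dflow t \<eta>0) ` {0..S})"
    by (intro compact_continuous_image Dflow_continuous_time S0) simp
  then obtain N where N: "0 < N" "\<And>t. t \<in> {0..S} \<Longrightarrow> norm (Dflow t \<eta>0) \<le> N"
    by (force dest!: compact_imp_bounded simp: bounded_pos)
  define E where "E = N * S * exp ((M + 1) * S)"
  have E: "0 < E" using N S by (simp add: E_def)
  \<comment> \<open>The bound \<open>e1 \<le> 1\<close> limits the coefficient along the nearby
    solution to \<open>M + 1\<close>, the Gronwall constant in \<open>E\<close>.\<close>
  define e1 where "e1 = min 1 (e / E)"
  have e1: "0 < e1" "e1 \<le> 1" "e1 * E \<le> e" using e E by (auto simp: e1_def min_def field_simps)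
  obtain \<rho> where \<rho>: "0 < \<rho>" "\<And>t z. t \<in> {0..S} \<Longrightarrow> z \<in> cball (flow t \<eta>0) \<rho> \<Longrightarrow>
      z \<in> U \<and> norm (f' t z - f' t (flow t \<eta>0)) \<le> e1"
    using f'_near[OF y e1(1)] by metis
  show "\<exists>\<tau>>0. \<exists>r>0. \<forall>t\<in>{0..T + \<tau>}. \<forall>\<eta>\<in>ball \<eta>0 r. norm (Dflow t \<eta> - Dflow t \<eta>0) \<le> e"
  proof (rule exI[of _ \<tau>], intro exI[of _ "min r (\<rho> / C)"] conjI ballI)
    fix t \<eta> assume "t \<in> {0..T + \<tau>}" and \<eta>: "\<eta> \<in> ball \<eta>0 (min r (\<rho> / C))"
    then have t: "t \<in> {0..S}" and \<eta>r: "\<eta> \<in> ball \<eta>0 r" by (auto simp: S_def)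
    have in_cb: "flow s \<eta> \<in> cball (flow s \<eta>0) \<rho>" if "s \<in> {0..S}" for s
    proof -
      have "C * norm (\<eta> - \<eta>0) \<le> \<rho>" using \<eta> loc(3) by (simp add: field_simps dist_norm norm_minus_commute)
      then show ?thesis using loc(6)[OF \<eta>r, of s] that by (simp add: dist_norm norm_minus_commute S_def)
    qed
    let ?D = "\<lambda>s. Dflow s \<eta> - Dflow s \<eta>0"
    have "norm (?D t) \<le> (norm (?D 0) + e1 * N * t) * exp ((M + 1) * t)"
    proof (rule gronwall[where e = ?D and T = S
          and e' = "\<lambda>s. (f' s (flow s \<eta>) o\<^sub>L Dflow s \<eta>) - (f' s (flow s \<eta>0) o\<^sub>L Dflow s \<eta>0)"])
      show "continuous_on {0..S} ?D"
        by (intro continuous_intros Dflow_continuous_time Sdom \<eta>r S0)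
      fix s assume s: "0 < s" "s < S"
      then have sS: "s \<in> {0..S}" by simp
      show "(?D has_vector_derivative (f' s (flow s \<eta>) o\<^sub>L Dflow s \<eta>) - (f' s (flow s \<eta>0) o\<^sub>L Dflow s \<eta>0)) (at s)"
        by (intro has_vector_derivative_diff Dflow_at[OF Sdom[OF \<eta>r] s] Dflow_at[OF S0 s])
      let ?a = "f' s (flow s \<eta>)" and ?b = "f' s (flow s \<eta>0)"
      have ab: "norm (?a - ?b) \<le> e1" using \<rho>(2)[OF sS in_cb[OF sS]] by simp
      then have a: "norm ?a \<le> M + 1"
        using norm_triangle_ineq2[of ?a ?b] M(2)[OF sS] e1(2) by linarith
      have "(?a o\<^sub>L Dflow s \<eta>) - (?b o\<^sub>L Dflow s \<eta>0) = (?a o\<^sub>L ?D s) + ((?a - ?b) o\<^sub>L Dflow s \<eta>0)"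
        by (rule blinfun_eqI) (simp add: blinfun.diff_left blinfun.add_left blinfun.diff_right)
      also have "norm \<dots> \<le> norm ?a * norm (?D s) + norm (?a - ?b) * norm (Dflow s \<eta>0)"
        by (intro norm_triangle_mono norm_blinfun_compose)
      also have "\<dots> \<le> (M + 1) * norm (?D s) + e1 * N"
        using a ab N(2)[OF sS] e1(1) by (intro add_mono mult_mono mult_right_mono) auto
      finally show "norm ((?a o\<^sub>L Dflow s \<eta>) - (?b o\<^sub>L Dflow s \<eta>0)) \<le> (M + 1) * norm (?D s) + e1 * N" .
    qed (use M N e1 t in auto)
    also have "?D 0 = 0" using Dflow_0[OF S0] Dflow_0[OF Sdom[OF \<eta>r]] by simp
    also have "(norm (0::'a \<Rightarrow>\<^sub>L 'a) + e1 * N * t) * exp ((M + 1) * t) \<le> (e1 * N * S) * exp ((M + 1) * S)"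
      using t M(1) N(1) e1(1) by (auto intro!: mult_mono)
    also have "\<dots> = e1 * E" by (simp add: E_def)
    finally show "norm (Dflow t \<eta> - Dflow t \<eta>0) \<le> e" using e1(3) by simp
  qed (use loc \<rho> in auto)
qed (rule has_vector_derivative_continuous[OF Dflow_deriv])

end

section \<open>Reflection at time zero, and C1 families\<close>

text \<open>For negative times the function is \<open>- h (- s)\<close>, whose derivative is
  \<open>h'(- s)\<close>: the derivative is reflected evenly, so the one-sided derivatives at
  \<open>0\<close> agree.\<close>

lemma odd_reflection_derivative:
  fixes h :: "real \<Rightarrow> 'a::real_normed_vector"
  assumes h0: "h 0 = 0" and d: "(h has_vector_derivative d) (at \<bar>t\<bar> within {0..})"
  shows "((\<lambda>s. sgn s *\<^sub>R h \<bar>s\<bar>) has_vector_derivative d) (at t)"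
proof -
  have pos: "((\<lambda>s. sgn s *\<^sub>R h \<bar>s\<bar>) has_vector_derivative d) (at t within {0..})" if "0 \<le> t"
    using has_vector_derivative_transform[of t "{0..}" "\<lambda>s. sgn s *\<^sub>R h \<bar>s\<bar>" h d] d that
    by (auto simp: sgn_if h0)
  have neg: "((\<lambda>s. sgn s *\<^sub>R h \<bar>s\<bar>) has_vector_derivative d) (at t within {..0})" if "t \<le> 0"
  proof -
    have m: "((\<lambda>s. - s) has_vector_derivative - 1) (at t within {..0})"
      by (auto intro!: derivative_eq_intros simp: has_real_derivative_iff_has_vector_derivative[symmetric])
    have "uminus ` {..0} = {0::real..}" by (simp add: image_uminus_atMost)
    then have "(h has_vector_derivative d) (at (- t) within (\<lambda>s. - s) ` {..0})"
      using d that by simp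
    from vector_diff_chain_within[OF m this]
    have "((\<lambda>s. h (- s)) has_vector_derivative - d) (at t within {..0})" by (simp add: o_def)
    from has_vector_derivative_minus[OF this]
    have "((\<lambda>s. - h (- s)) has_vector_derivative d) (at t within {..0})" by simp
    then show ?thesis
      using has_vector_derivative_transform[of t "{..0}" "\<lambda>s. sgn s *\<^sub>R h \<bar>s\<bar>" "\<lambda>s. - h (- s)" d] that
      by (auto simp: sgn_if h0)
  qed
  consider "t > 0" | "t < 0" | "t = 0" by linarith
  then show ?thesis
  proof cases
    case 1
    have "at t within {0..} = at t" by (rule at_within_interior) (use 1 in \<open>simp add: interior_real_atLeast\<close>)
    then show ?thesis using pos 1 by simp
  next
    case 2
    have "at t within {..0} = at t" by (rule at_within_interior) (use 2 in \<open>simp add: interior_real_atMost\<close>)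
    then show ?thesis using neg 2 by simp
  next
    case 3
    have "{0..} \<union> {..0::real} = UNIV" by auto
    moreover have "((\<lambda>s. sgn s *\<^sub>R h \<bar>s\<bar>) has_vector_derivative d) (at t within {0..} \<union> {..0})"
      using pos neg 3 unfolding has_vector_derivative_def has_derivative_within
      unfolding at_within_union by (auto intro: filterlim_sup)
    ultimately show ?thesis by simp
  qed
qed

text \<open>The zeros of \<open>g\<close> at time \<open>0\<close> compensate the jump of
  \<open>sgn\<close>, so the two closed halves can be pasted.\<close>

lemma continuous_on_sgn_scaleR:
  fixes g :: "real \<times> 'a::metric_space \<Rightarrow> 'b::real_normed_vector"
  assumes g: "continuous_on S g" and zero: "\<And>p. p \<in> S \<Longrightarrow> fst p = 0 \<Longrightarrow> g p = 0"
  shows "continuous_on S (\<lambda>p. sgn (fst p) *\<^sub>R g p)"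
proof -
  let ?h = "\<lambda>p. sgn (fst p) *\<^sub>R g p"
  have eq: "(S \<inter> {p. 0 \<le> fst p}) \<union> (S \<inter> {p. fst p \<le> 0}) = S" by auto
  have 1: "continuous_on (S \<inter> {p. 0 \<le> fst p}) ?h"
    by (rule continuous_on_eq[OF continuous_on_subset[OF g]]) (use zero in \<open>auto simp: sgn_if\<close>)
  have 2: "continuous_on (S \<inter> {p. fst p \<le> 0}) ?h"
    by (rule continuous_on_eq[OF continuous_on_minus[OF continuous_on_subset[OF g]]]) (use zero in \<open>auto simp: sgn_if\<close>)
  have "closedin (top_of_set S) (S \<inter> {p. 0 \<le> fst p})" "closedin (top_of_set S) (S \<inter> {p. fst p \<le> 0})"
    by (auto intro!: closedin_closed_Int closed_Collect_le continuous_intros)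
  then show ?thesis
    using continuous_on_Un_local[of "S \<inter> {p. 0 \<le> fst p}" "S \<inter> {p. fst p \<le> 0}" ?h] 1 2 unfolding eq by auto
qed

text \<open>The derivative is taken in the second argument only; the time is a parameter. A constant family
  expresses that a single function is continuously differentiable.\<close>

definition C1_family :: "'a set \<Rightarrow> (real \<Rightarrow> 'a::euclidean_space \<Rightarrow> 'b::real_normed_vector) \<Rightarrow> bool" where
  "C1_family U f \<longleftrightarrow> continuous_on ({0..} \<times> U) (\<lambda>(t, y). f t y) \<and>
     (\<exists>f'. (\<forall>t\<ge>0. \<forall>y\<in>U. (f t has_derivative blinfun_apply (f' t y)) (at y)) \<and>
        continuous_on ({0..} \<times> U) (\<lambda>(t, y). f' t y))"

text \<open>In finite dimensions continuity of \<open>F t y w\<close> for each fixed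
  \<open>w\<close> implies continuity of the derivative in the operator norm, so most of the rules
  below can be checked direction by direction.\<close>

lemma C1_familyI:
  assumes "continuous_on ({0..} \<times> U) (\<lambda>(t, y). f t y)"
    and d: "\<And>t y. 0 \<le> t \<Longrightarrow> y \<in> U \<Longrightarrow> (f t has_derivative F t y) (at y)"
    and c: "\<And>w. continuous_on ({0..} \<times> U) (\<lambda>(t, y). F t y w)"
  shows "C1_family U f"
proof -
  have ap: "blinfun_apply (Blinfun (F t y)) = F t y" if "0 \<le> t" "y \<in> U" for t y
    using d[OF that] by (intro bounded_linear_Blinfun_apply) (rule has_derivative_bounded_linear)
  have "continuous_on ({0..} \<times> U) (\<lambda>p. Blinfun (F (fst p) (snd p)))"
  proof (rule continuous_on_blinfun_componentwise)
    fix i :: 'a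
    show "continuous_on ({0..} \<times> U) (\<lambda>p. blinfun_apply (Blinfun (F (fst p) (snd p))) i)"
      by (rule continuous_on_eq[OF c[of i]]) (auto simp: ap)
  qed
  then show ?thesis
    unfolding C1_family_def using assms(1) d ap
    by (intro conjI exI[of _ "\<lambda>t y. Blinfun (F t y)"]) (auto simp: split_beta)
qed

lemma C1_familyE:
  assumes "C1_family U f"
  obtains F where "continuous_on ({0..} \<times> U) (\<lambda>(t, y). f t y)"
    "\<And>t y. 0 \<le> t \<Longrightarrow> y \<in> U \<Longrightarrow> (f t has_derivative F t y) (at y)"
    "\<And>w. continuous_on ({0..} \<times> U) (\<lambda>(t, y). F t y w)"
proof -
  obtain f' where *: "\<And>t y. 0 \<le> t \<Longrightarrow> y \<in> U \<Longrightarrow> (f t has_derivative blinfun_apply (f' t y)) (at y)"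
    "continuous_on ({0..} \<times> U) (\<lambda>(t, y). f' t y)"
    using assms unfolding C1_family_def by metis
  show thesis
  proof (rule that[of "\<lambda>t y. blinfun_apply (f' t y)"])
    show "continuous_on ({0..} \<times> U) (\<lambda>(t, y). blinfun_apply (f' t y) w)" for w
      using *(2) unfolding split_beta by (intro continuous_intros)
  qed (use assms * in \<open>auto simp: C1_family_def\<close>)
qed

lemma C1_family_continuous: "C1_family U f \<Longrightarrow> continuous_on ({0..} \<times> U) (\<lambda>(t, y). f t y)"
  by (simp add: C1_family_def)

lemma C1_family_linear:
  assumes "bounded_linear L"
  shows "C1_family U (\<lambda>t. L)"
  by (rule C1_familyI[where F = "\<lambda>t y. L"])
    (auto simp: split_beta intro!: bounded_linear.continuous_on[OF assms] continuous_intros bounded_linear_imp_has_derivative assms)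

lemma C1_family_const: "C1_family U (\<lambda>t y. c)"
  by (rule C1_familyI[where F = "\<lambda>t y w. 0"]) (auto simp: split_beta)

lemma C1_family_cong:
  assumes f: "C1_family U f" and U: "open U" and eq: "\<And>t y. 0 \<le> t \<Longrightarrow> y \<in> U \<Longrightarrow> f t y = g t y"
  shows "C1_family U g"
proof -
  obtain F where F: "continuous_on ({0..} \<times> U) (\<lambda>(t, y). f t y)"
    "\<And>t y. 0 \<le> t \<Longrightarrow> y \<in> U \<Longrightarrow> (f t has_derivative F t y) (at y)"
    "\<And>w. continuous_on ({0..} \<times> U) (\<lambda>(t, y). F t y w)"
    using C1_familyE[OF f] by metis
  show ?thesis
  proof (rule C1_familyI[OF _ _ F(3)])
    show "continuous_on ({0..} \<times> U) (\<lambda>(t, y). g t y)"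
      by (rule continuous_on_eq[OF F(1)]) (use eq in auto)
    show "(g t has_derivative F t y) (at y)" if "0 \<le> t" "y \<in> U" for t y
      by (rule has_derivative_transform_within_open[OF F(2)[OF that] U that(2)]) (use eq that in auto)
  qed
qed

lemma C1_family_subset: "C1_family U f \<Longrightarrow> V \<subseteq> U \<Longrightarrow> C1_family V f"
  unfolding C1_family_def
  by (elim conjE exE, intro conjI exI) (auto intro: continuous_on_subset elim!: continuous_on_subset[where s = "{0..} \<times> U"])

lemma C1_family_compose:
  assumes f: "C1_family V f" and g: "C1_family U g" and sub: "\<And>t y. 0 \<le> t \<Longrightarrow> y \<in> U \<Longrightarrow> g t y \<in> V"
  shows "C1_family U (\<lambda>t y. f t (g t y))"
proof -
  obtain f' where f': "\<And>t y. 0 \<le> t \<Longrightarrow> y \<in> V \<Longrightarrow> (f t has_derivative blinfun_apply (f' t y)) (at y)"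
    "continuous_on ({0..} \<times> V) (\<lambda>(t, y). f' t y)"
    using f unfolding C1_family_def by metis
  obtain g' where g': "\<And>t y. 0 \<le> t \<Longrightarrow> y \<in> U \<Longrightarrow> (g t has_derivative blinfun_apply (g' t y)) (at y)"
    "continuous_on ({0..} \<times> U) (\<lambda>(t, y). g' t y)"
    using g unfolding C1_family_def by metis
  have cg: "continuous_on ({0..} \<times> U) (\<lambda>p. (fst p, g (fst p) (snd p)))"
    using C1_family_continuous[OF g] by (auto intro!: continuous_intros simp: split_beta)
  have im: "(\<lambda>p. (fst p, g (fst p) (snd p))) ` ({0..} \<times> U) \<subseteq> {0..} \<times> V" using sub by auto
  show ?thesis unfolding C1_family_def
  proof (intro conjI exI[of _ "\<lambda>t y. f' t (g t y) o\<^sub>L g' t y"] allI impI ballI)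
    show "continuous_on ({0..} \<times> U) (\<lambda>(t, y). f t (g t y))"
      using continuous_on_compose2[OF C1_family_continuous[OF f] cg im] by (simp add: split_beta)
    have "continuous_on ({0..} \<times> U) (\<lambda>p. f' (fst p) (g (fst p) (snd p)))"
      using continuous_on_compose2[OF f'(2) cg im] by (simp add: split_beta)
    then show "continuous_on ({0..} \<times> U) (\<lambda>(t, y). f' t (g t y) o\<^sub>L g' t y)"
      using g'(2) unfolding split_beta
      by (intro bounded_bilinear.continuous_on[OF bounded_bilinear_blinfun_compose])
    fix t y assume *: "(0::real) \<le> t" "y \<in> U"
    show "((\<lambda>y. f t (g t y)) has_derivative blinfun_apply (f' t (g t y) o\<^sub>L g' t y)) (at y)"
      using has_derivative_compose[OF g'(1)[OF *] f'(1)[OF *(1) sub[OF *]]]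
      by (simp add: o_def blinfun_compose.rep_eq)
  qed
qed

lemma C1_family_bilinear:
  assumes B: "bounded_bilinear B" and f: "C1_family U f" and g: "C1_family U g"
  shows "C1_family U (\<lambda>t y. B (f t y) (g t y))"
proof -
  interpret bounded_bilinear B by fact
  obtain F where F: "continuous_on ({0..} \<times> U) (\<lambda>(t, y). f t y)"
    "\<And>t y. 0 \<le> t \<Longrightarrow> y \<in> U \<Longrightarrow> (f t has_derivative F t y) (at y)"
    "\<And>w. continuous_on ({0..} \<times> U) (\<lambda>(t, y). F t y w)"
    using C1_familyE[OF f] by metis
  obtain G where G: "continuous_on ({0..} \<times> U) (\<lambda>(t, y). g t y)"
    "\<And>t y. 0 \<le> t \<Longrightarrow> y \<in> U \<Longrightarrow> (g t has_derivative G t y) (at y)"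
    "\<And>w. continuous_on ({0..} \<times> U) (\<lambda>(t, y). G t y w)"
    using C1_familyE[OF g] by metis
  show ?thesis
  proof (rule C1_familyI[where F = "\<lambda>t y w. B (f t y) (G t y w) + B (F t y w) (g t y)"])
    show "((\<lambda>y. B (f t y) (g t y)) has_derivative (\<lambda>w. B (f t y) (G t y w) + B (F t y w) (g t y))) (at y)"
      if "0 \<le> t" "y \<in> U" for t y
      by (rule FDERIV[OF F(2)[OF that] G(2)[OF that]])
  qed (use F G in \<open>auto simp: split_beta intro!: continuous_on continuous_intros\<close>)
qed

lemma C1_family_add:
  assumes f: "C1_family U f" and g: "C1_family U g"
  shows "C1_family U (\<lambda>t y. f t y + g t y)"
proof -
  obtain F where F: "continuous_on ({0..} \<times> U) (\<lambda>(t, y). f t y)"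
    "\<And>t y. 0 \<le> t \<Longrightarrow> y \<in> U \<Longrightarrow> (f t has_derivative F t y) (at y)"
    "\<And>w. continuous_on ({0..} \<times> U) (\<lambda>(t, y). F t y w)"
    using C1_familyE[OF f] by metis
  obtain G where G: "continuous_on ({0..} \<times> U) (\<lambda>(t, y). g t y)"
    "\<And>t y. 0 \<le> t \<Longrightarrow> y \<in> U \<Longrightarrow> (g t has_derivative G t y) (at y)"
    "\<And>w. continuous_on ({0..} \<times> U) (\<lambda>(t, y). G t y w)"
    using C1_familyE[OF g] by metis
  show ?thesis
    by (rule C1_familyI[where F = "\<lambda>t y w. F t y w + G t y w"])
      (use F G in \<open>auto simp: split_beta intro!: continuous_on_add has_derivative_add\<close>)
qed

lemma C1_family_linear_compose: "bounded_linear L \<Longrightarrow> C1_family U f \<Longrightarrow> C1_family U (\<lambda>t y. L (f t y))"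
  for L :: "'b::euclidean_space \<Rightarrow> 'c::real_normed_vector"
  by (rule C1_family_compose[OF C1_family_linear[of L UNIV]]) auto

lemma C1_family_minus: "C1_family U f \<Longrightarrow> C1_family U (\<lambda>t y. - f t y)"
  for f :: "real \<Rightarrow> 'a::euclidean_space \<Rightarrow> 'b::euclidean_space"
  by (rule C1_family_linear_compose) (auto intro: bounded_linear_minus bounded_linear_ident)

lemma C1_family_diff: "C1_family U f \<Longrightarrow> C1_family U g \<Longrightarrow> C1_family U (\<lambda>t y. f t y - g t y)"
  for f :: "real \<Rightarrow> 'a::euclidean_space \<Rightarrow> 'b::euclidean_space"
  using C1_family_add[OF _ C1_family_minus, of U f g] by simp

lemma C1_family_sum:
  "(\<And>i. i \<in> I \<Longrightarrow> C1_family U (f i)) \<Longrightarrow> C1_family U (\<lambda>t y. \<Sum>i\<in>I. f i t y)"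
  by (induction I rule: infinite_finite_induct) (auto intro: C1_family_add C1_family_const)

lemma C1_family_inverse:
  fixes f :: "real \<Rightarrow> 'a::euclidean_space \<Rightarrow> real"
  assumes f: "C1_family U f" and nz: "\<And>t y. 0 \<le> t \<Longrightarrow> y \<in> U \<Longrightarrow> f t y \<noteq> 0"
  shows "C1_family U (\<lambda>t y. inverse (f t y))"
proof (rule C1_family_compose[OF _ f])
  show "C1_family (- {0}) (\<lambda>t. inverse :: real \<Rightarrow> real)"
  proof (rule C1_familyI[where F = "\<lambda>t y w. - (inverse y * w * inverse y)"])
    show "(inverse has_derivative (\<lambda>w. - (inverse y * w * inverse y))) (at y)" if "y \<in> - {0}" for y :: real
      using that by (intro has_derivative_inverse') auto
  qed (auto simp: split_beta intro!: continuous_intros)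
qed (use nz in auto)

lemma C1_family_Pair:
  assumes f: "C1_family U f" and g: "C1_family U g"
  shows "C1_family U (\<lambda>t y. (f t y, g t y))"
proof -
  obtain F where F: "continuous_on ({0..} \<times> U) (\<lambda>(t, y). f t y)"
    "\<And>t y. 0 \<le> t \<Longrightarrow> y \<in> U \<Longrightarrow> (f t has_derivative F t y) (at y)"
    "\<And>w. continuous_on ({0..} \<times> U) (\<lambda>(t, y). F t y w)"
    using C1_familyE[OF f] by metis
  obtain G where G: "continuous_on ({0..} \<times> U) (\<lambda>(t, y). g t y)"
    "\<And>t y. 0 \<le> t \<Longrightarrow> y \<in> U \<Longrightarrow> (g t has_derivative G t y) (at y)"
    "\<And>w. continuous_on ({0..} \<times> U) (\<lambda>(t, y). G t y w)"
    using C1_familyE[OF g] by metis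
  show ?thesis
    by (rule C1_familyI[where F = "\<lambda>t y w. (F t y w, G t y w)"])
      (use F G in \<open>auto simp: split_beta intro!: continuous_on_Pair has_derivative_Pair\<close>)
qed

section \<open>The flow continued to negative times\<close>

context c1_ode
begin

text \<open>The flow is extended to negative times by odd reflection about its initial value. This keeps it
  continuously differentiable, and \<open>t = 0\<close> becomes an interior time.\<close>

definition rdom :: "(real \<times> 'a) set" where "rdom = {p. (\<bar>fst p\<bar>, snd p) \<in> dom}"

definition rflow :: "real \<times> 'a \<Rightarrow> 'a" where
  "rflow p = snd p + sgn (fst p) *\<^sub>R (flow \<bar>fst p\<bar> (snd p) - snd p)"

definition rDflow :: "real \<Rightarrow> 'a \<Rightarrow> 'a \<Rightarrow>\<^sub>L 'a" where
  "rDflow t \<eta> = id_blinfun + sgn t *\<^sub>R (Dflow \<bar>t\<bar> \<eta> - id_blinfun)"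

lemma rflow_eq: "(t, \<eta>) \<in> dom \<Longrightarrow> rflow (t, \<eta>) = flow t \<eta>"
  using dom_nonneg[of t \<eta>] flow_0[of t \<eta>] by (auto simp: rflow_def sgn_if)

lemma rDflow_eq: "(t, \<eta>) \<in> dom \<Longrightarrow> rDflow t \<eta> = Dflow t \<eta>"
  using dom_nonneg[of t \<eta>] Dflow_0[of t \<eta>] by (auto simp: rDflow_def sgn_if)

lemma open_rdom: "open rdom"
  unfolding open_dist
proof
  fix p assume "p \<in> rdom"
  then have "(\<bar>fst p\<bar>, snd p) \<in> dom" by (simp add: rdom_def)
  from flow_local[OF this] obtain \<tau> r where *: "0 < \<tau>" "0 < r" "{0..\<bar>fst p\<bar> + \<tau>} \<times> ball (snd p) r \<subseteq> dom" by metis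
  show "\<exists>e>0. \<forall>q. dist q p < e \<longrightarrow> q \<in> rdom"
  proof (intro exI[of _ "min \<tau> r"] conjI allI impI)
    fix q assume "dist q p < min \<tau> r"
    then have "dist (fst q) (fst p) < \<tau>" "dist (snd q) (snd p) < r"
      using dist_fst_le[of q p] dist_snd_le[of q p] by auto
    then have "(\<bar>fst q\<bar>, snd q) \<in> {0..\<bar>fst p\<bar> + \<tau>} \<times> ball (snd p) r"
      by (auto simp: dist_commute dist_real_def)
    then show "q \<in> rdom" using * by (auto simp: rdom_def)
  qed (use * in auto)
qed

lemma rdom_0: "(t, \<eta>) \<in> rdom \<Longrightarrow> (0, \<eta>) \<in> dom"
  unfolding rdom_def using dom_down[of "\<bar>t\<bar>" \<eta> 0] by auto

lemma continuous_on_abs_Pair: "continuous_on S (\<lambda>p::real \<times> 'a. (\<bar>fst p\<bar>, snd p))"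
  by (intro continuous_intros)

lemma rflow_continuous: "continuous_on rdom rflow"
proof -
  have "continuous_on rdom (\<lambda>p. flow \<bar>fst p\<bar> (snd p))"
    using continuous_on_compose2[OF flow_continuous continuous_on_abs_Pair, of rdom] by (auto simp: rdom_def)
  then have "continuous_on rdom (\<lambda>p. sgn (fst p) *\<^sub>R (flow \<bar>fst p\<bar> (snd p) - snd p))"
    by (intro continuous_on_sgn_scaleR continuous_intros) (auto simp: rdom_def flow_0)
  from continuous_on_add[OF continuous_on_snd[OF continuous_on_id] this]
  show ?thesis by (simp add: rflow_def[abs_def])
qed

lemma rDflow_continuous: "continuous_on rdom (\<lambda>(t, \<eta>). rDflow t \<eta>)"
proof -
  have "continuous_on rdom (\<lambda>p. Dflow \<bar>fst p\<bar> (snd p))"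
    using continuous_on_compose2[OF Dflow_continuous continuous_on_abs_Pair, of rdom] by (auto simp: rdom_def)
  then have "continuous_on rdom (\<lambda>p. sgn (fst p) *\<^sub>R (Dflow \<bar>fst p\<bar> (snd p) - id_blinfun))"
    by (intro continuous_on_sgn_scaleR continuous_intros) (auto simp: rdom_def Dflow_0)
  from continuous_on_add[OF continuous_on_const this]
  show ?thesis by (simp add: rDflow_def[abs_def] split_beta)
qed

text \<open>Total differentiability follows from the two partial derivatives and the joint
  continuity of the spatial one. The second factor is shrunk to a ball because it has to be
  convex.\<close>

lemma rflow_has_derivative:
  assumes p: "(t, \<eta>) \<in> rdom"
  shows "(rflow has_derivative (\<lambda>(s, w). s *\<^sub>R f \<bar>t\<bar> (flow \<bar>t\<bar> \<eta>) + rDflow t \<eta> w)) (at (t, \<eta>))"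
proof -
  obtain A B where AB: "open A" "open B" "(t, \<eta>) \<in> A \<times> B" "A \<times> B \<subseteq> rdom"
    using open_rdom p unfolding open_prod_def by metis
  then obtain r where r: "0 < r" "ball \<eta> r \<subseteq> B" by (metis mem_Sigma_iff open_contains_ball)
  have sub: "A \<times> ball \<eta> r \<subseteq> rdom" using AB r by auto
  have "((\<lambda>(t, \<eta>). rflow (t, \<eta>)) has_derivative (\<lambda>(s, w). s *\<^sub>R f \<bar>t\<bar> (flow \<bar>t\<bar> \<eta>) + rDflow t \<eta> w))
      (at (t, \<eta>) within A \<times> ball \<eta> r)"
  proof (rule has_derivative_partialsI[of "\<lambda>t \<eta>. rflow (t, \<eta>)"])
    have "((\<lambda>s. flow s \<eta> - \<eta>) has_vector_derivative f \<bar>t\<bar> (flow \<bar>t\<bar> \<eta>) - 0) (at \<bar>t\<bar> within {0..})"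
      using p by (intro has_vector_derivative_diff flow_deriv has_vector_derivative_const) (simp add: rdom_def)
    from odd_reflection_derivative[OF _ this] flow_0[OF rdom_0[OF p]]
    have "((\<lambda>s. \<eta> + sgn s *\<^sub>R (flow \<bar>s\<bar> \<eta> - \<eta>)) has_vector_derivative 0 + f \<bar>t\<bar> (flow \<bar>t\<bar> \<eta>)) (at t)"
      by (intro has_vector_derivative_add has_vector_derivative_const) simp
    then show "((\<lambda>t. rflow (t, \<eta>)) has_derivative (\<lambda>s. s *\<^sub>R f \<bar>t\<bar> (flow \<bar>t\<bar> \<eta>))) (at t within A)"
      by (simp add: rflow_def has_vector_derivative_def has_derivative_at_withinI)
    fix s \<zeta> assume "s \<in> A" "\<zeta> \<in> ball \<eta> r"
    then have "(s, \<zeta>) \<in> rdom" using sub by blast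
    then have "(\<bar>s\<bar>, \<zeta>) \<in> dom" by (simp add: rdom_def)
    then have "((\<lambda>\<zeta>. \<zeta> + sgn s *\<^sub>R (flow \<bar>s\<bar> \<zeta> - \<zeta>)) has_derivative
        (\<lambda>w. w + sgn s *\<^sub>R (Dflow \<bar>s\<bar> \<zeta> w - w))) (at \<zeta>)"
      by (intro has_derivative_add has_derivative_ident has_derivative_scaleR_right has_derivative_diff has_derivative_Dflow)
    moreover have "blinfun_apply (rDflow s \<zeta>) = (\<lambda>w. w + sgn s *\<^sub>R (Dflow \<bar>s\<bar> \<zeta> w - w))"
      by (rule ext) (simp add: rDflow_def blinfun.add_left blinfun.scaleR_left blinfun.diff_left)
    ultimately show "((\<lambda>\<zeta>. rflow (s, \<zeta>)) has_derivative blinfun_apply (rDflow s \<zeta>)) (at \<zeta> within ball \<eta> r)"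
      by (simp add: rflow_def has_derivative_at_withinI)
  next
    have "continuous (at (t, \<eta>) within rdom) (\<lambda>(t, \<eta>). rDflow t \<eta>)"
      using rDflow_continuous p by (simp add: continuous_on_eq_continuous_within)
    then show "continuous (at (t, \<eta>) within A \<times> ball \<eta> r) (\<lambda>(t, \<eta>). rDflow t \<eta>)"
      by (rule continuous_within_subset[OF _ sub])
  qed (use r in auto)
  moreover have "at (t, \<eta>) within A \<times> ball \<eta> r = at (t, \<eta>)"
    by (rule at_within_open) (use AB r in \<open>auto intro: open_Times\<close>)
  ultimately show ?thesis by simp
qed

lemma C1_rflow: "C1_family rdom (\<lambda>_. rflow)"
proof (rule C1_familyI[where F = "\<lambda>_ p q. fst q *\<^sub>R f \<bar>fst p\<bar> (flow \<bar>fst p\<bar> (snd p)) + rDflow (fst p) (snd p) (snd q)"])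
  have snd: "continuous_on ({0::real..} \<times> rdom) (\<lambda>x. g (snd x))" if "continuous_on rdom g"
    for g :: "_ \<Rightarrow> 'a"
    by (rule continuous_on_compose2[OF that]) (auto intro!: continuous_intros)
  show "continuous_on ({0::real..} \<times> rdom) (\<lambda>(t, y). rflow y)"
    using snd[OF rflow_continuous] by (simp add: split_beta)
  fix w :: "real \<times> 'a"
  have "continuous_on rdom (\<lambda>p. flow \<bar>fst p\<bar> (snd p))"
    using continuous_on_compose2[OF flow_continuous continuous_on_abs_Pair, of rdom] by (auto simp: rdom_def)
  then have 1: "continuous_on rdom (\<lambda>p. (\<bar>fst p\<bar>, flow \<bar>fst p\<bar> (snd p)))"
    by (intro continuous_on_Pair continuous_on_rabs continuous_on_fst continuous_on_id)
  have 2: "(\<lambda>p. (\<bar>fst p\<bar>, flow \<bar>fst p\<bar> (snd p))) ` rdom \<subseteq> {0..} \<times> U"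
    using flow_in by (auto simp: rdom_def)
  have "continuous_on rdom (\<lambda>p. f \<bar>fst p\<bar> (flow \<bar>fst p\<bar> (snd p)))"
    using continuous_on_compose2[OF cont_f 1 2] by simp
  then have "continuous_on rdom (\<lambda>p. fst w *\<^sub>R f \<bar>fst p\<bar> (flow \<bar>fst p\<bar> (snd p)) + rDflow (fst p) (snd p) (snd w))"
    using rDflow_continuous unfolding split_beta by (intro continuous_intros)
  from snd[OF this] show "continuous_on ({0::real..} \<times> rdom)
      (\<lambda>(t, p). fst w *\<^sub>R f \<bar>fst p\<bar> (flow \<bar>fst p\<bar> (snd p)) + rDflow (fst p) (snd p) (snd w))"
    by (simp add: split_beta)
qed (use rflow_has_derivative in \<open>auto simp: case_prod_unfold\<close>)

end

section \<open>Continuous partial derivatives\<close>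

text \<open>\<open>x\<close> and \<open>y\<close> are joined by changing one coordinate at a time;
  \<open>P A\<close> is the displacement after the coordinates in \<open>A\<close>. On each of the
  \<open>N\<close> legs the derivative differs from that at \<open>x\<close> by at most
  \<open>e / N\<close>, and all legs stay within \<open>N * norm h < \<delta>\<close> of
  \<open>x\<close>.\<close>

lemma has_derivative_continuous_partials:
  fixes f :: "'a::euclidean_space \<Rightarrow> 'b::real_normed_vector"
  assumes "open U" "x \<in> U"
    and d: "\<And>b z. b \<in> Basis \<Longrightarrow> z \<in> U \<Longrightarrow> ((\<lambda>s. f (z + s *\<^sub>R b)) has_vector_derivative d b z) (at 0)"
    and cont: "\<And>b. b \<in> Basis \<Longrightarrow> continuous_on U (d b)"
  shows "(f has_derivative (\<lambda>h. \<Sum>b\<in>Basis. (h \<bullet> b) *\<^sub>R d b x)) (at x)"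
proof (rule has_derivative_at_altI)
  show "bounded_linear (\<lambda>h. \<Sum>b\<in>Basis. (h \<bullet> b) *\<^sub>R d b x)"
    by (intro bounded_linear_sum bounded_linear_scaleR_const bounded_linear_inner_left)
  fix e :: real assume e: "0 < e"
  define N where "N = real DIM('a)"
  have N: "0 < N" by (simp add: N_def)
  have "\<exists>\<delta>>0. \<forall>z. dist z x < \<delta> \<longrightarrow> z \<in> U \<and> (\<forall>b\<in>B. norm (d b z - d b x) \<le> e / N)"
    if "finite B" "B \<subseteq> Basis" for B
    using that
  proof (induction B rule: finite_induct)
    case empty
    then show ?case using \<open>open U\<close> \<open>x \<in> U\<close> by (auto simp: open_dist)
  next
    case (insert b B)
    then obtain \<delta> where \<delta>: "\<delta> > 0" "\<forall>z. dist z x < \<delta> \<longrightarrow> z \<in> U \<and> (\<forall>b\<in>B. norm (d b z - d b x) \<le> e / N)" by auto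
    have "continuous (at x) (d b)"
      using cont[of b] insert.prems assms(1,2) by (simp add: continuous_on_eq_continuous_at)
    then obtain \<delta>' where "\<delta>' > 0" "\<And>z. dist z x < \<delta>' \<Longrightarrow> dist (d b z) (d b x) < e / N"
      unfolding continuous_at_eps_delta using e N by (metis divide_pos_pos)
    with \<delta> show ?case
      by (intro exI[of _ "min \<delta> \<delta>'"]) (force simp: dist_norm intro: less_imp_le)
  qed
  from this[of Basis] obtain \<delta> where \<delta>: "\<delta> > 0"
    "\<And>z. dist z x < \<delta> \<Longrightarrow> z \<in> U" "\<And>z b. dist z x < \<delta> \<Longrightarrow> b \<in> Basis \<Longrightarrow> norm (d b z - d b x) \<le> e / N" by auto
  show "\<exists>r>0. \<forall>y. norm (y - x) < r \<longrightarrow>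
      norm (f y - f x - (\<Sum>b\<in>Basis. ((y - x) \<bullet> b) *\<^sub>R d b x)) \<le> e * norm (y - x)"
  proof (intro exI[of _ "\<delta> / N"] conjI allI impI)
    fix y assume y: "norm (y - x) < \<delta> / N"
    define h where "h = y - x"
    define P where "P A = (\<Sum>b\<in>A. (h \<bullet> b) *\<^sub>R b)" for A
    have Pn: "norm (P A) \<le> card A * norm h" if "A \<subseteq> Basis" for A
    proof -
      have "norm (P A) \<le> (\<Sum>b\<in>A. norm h)" unfolding P_def
        by (intro sum_norm_le) (use that in \<open>auto simp: Basis_le_norm subset_iff\<close>)
      then show ?thesis by simp
    qed
    have "norm (f (x + P A) - f x - (\<Sum>b\<in>A. (h \<bullet> b) *\<^sub>R d b x)) \<le> card A * (e / N * norm h)"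
      if "finite A" "A \<subseteq> Basis" for A
      using that
    proof (induction A rule: finite_induct)
      case empty
      then show ?case by (simp add: P_def)
    next
      case (insert b A)
      let ?I = "closed_segment 0 (h \<bullet> b)"
      have bB: "b \<in> Basis" and AB: "A \<subseteq> Basis" using insert.prems by auto
      have near: "dist (x + P A + s *\<^sub>R b) x < \<delta>" if "s \<in> ?I" for s
      proof -
        have "\<bar>s\<bar> \<le> \<bar>h \<bullet> b\<bar>" using that by (auto simp: closed_segment_eq_real_ivl split: if_splits)
        then have s: "\<bar>s\<bar> \<le> norm h" using Basis_le_norm[OF bB, of h] by linarith
        have "card (insert b A) \<le> DIM('a)" using insert.prems by (intro card_mono) auto
        then have c: "real (card A) + 1 \<le> N" using insert.hyps by (simp add: N_def)
        have "dist (x + P A + s *\<^sub>R b) x = norm (P A + s *\<^sub>R b)" by (simp add: dist_norm add.assoc)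
        also have "\<dots> \<le> norm (P A) + \<bar>s\<bar>" using norm_triangle_ineq[of "P A" "s *\<^sub>R b"] bB by simp
        also have "\<dots> \<le> (real (card A) + 1) * norm h" using Pn[OF AB] s by (simp add: algebra_simps)
        also have "\<dots> \<le> N * norm h" using c by (intro mult_right_mono) auto
        also have "\<dots> < \<delta>" using y N by (simp add: h_def field_simps)
        finally show ?thesis .
      qed
      let ?k = "\<lambda>s. f (x + P A + s *\<^sub>R b) - s *\<^sub>R d b x"
      have "norm (?k (h \<bullet> b) - ?k 0) \<le> (e / N) * norm (h \<bullet> b - 0)"
      proof (rule differentiable_bound[where S = ?I and f = ?k
            and f' = "\<lambda>s u. u *\<^sub>R (d b (x + P A + s *\<^sub>R b) - d b x)"])
        fix s assume s: "s \<in> ?I"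
        have "((\<lambda>u. f (x + P A + s *\<^sub>R b + u *\<^sub>R b)) has_vector_derivative d b (x + P A + s *\<^sub>R b)) (at 0)"
          using d[OF bB \<delta>(2)[OF near[OF s]]] .
        moreover have "((\<lambda>r. r - s) has_vector_derivative 1) (at s)"
          by (auto intro!: derivative_eq_intros simp: has_real_derivative_iff_has_vector_derivative[symmetric])
        ultimately have "((\<lambda>u. f (x + P A + s *\<^sub>R b + (u - s) *\<^sub>R b)) has_vector_derivative d b (x + P A + s *\<^sub>R b)) (at s)"
          using vector_diff_chain_at[of "\<lambda>r. r - s" 1 s "\<lambda>u. f (x + P A + s *\<^sub>R b + u *\<^sub>R b)"]
          by (simp add: o_def)
        then have "((\<lambda>u. f (x + P A + u *\<^sub>R b)) has_vector_derivative d b (x + P A + s *\<^sub>R b)) (at s)"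
          by (simp add: algebra_simps)
        moreover have "((\<lambda>u. u *\<^sub>R d b x) has_vector_derivative d b x) (at s)"
          by (auto intro!: derivative_eq_intros simp: has_vector_derivative_def)
        ultimately have "(?k has_vector_derivative (d b (x + P A + s *\<^sub>R b) - d b x)) (at s)"
          by (rule has_vector_derivative_diff)
        then show "(?k has_derivative (\<lambda>u. u *\<^sub>R (d b (x + P A + s *\<^sub>R b) - d b x))) (at s within ?I)"
          by (simp add: has_vector_derivative_def has_derivative_at_withinI)
        show "onorm (\<lambda>u. u *\<^sub>R (d b (x + P A + s *\<^sub>R b) - d b x)) \<le> e / N"
          using mult_left_mono[OF \<delta>(3)[OF near[OF s] bB] abs_ge_zero]
          by (intro onorm_le) (simp add: mult.commute)
      qed auto
      also have "\<dots> \<le> e / N * norm h"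
        using e N Basis_le_norm[OF bB, of h] by (intro mult_left_mono) auto
      finally have 1: "norm (?k (h \<bullet> b) - ?k 0) \<le> e / N * norm h" .
      have P: "P (insert b A) = P A + (h \<bullet> b) *\<^sub>R b" using insert.hyps by (simp add: P_def)
      have "f (x + P (insert b A)) - f x - (\<Sum>b\<in>insert b A. (h \<bullet> b) *\<^sub>R d b x)
          = (?k (h \<bullet> b) - ?k 0) + (f (x + P A) - f x - (\<Sum>b\<in>A. (h \<bullet> b) *\<^sub>R d b x))"
        using insert.hyps by (simp add: P algebra_simps)
      also have "norm \<dots> \<le> e / N * norm h + card A * (e / N * norm h)"
        using 1 insert.IH[OF AB] by (intro norm_triangle_mono)
      also have "\<dots> = card (insert b A) * (e / N * norm h)"
        using insert.hyps by (simp add: distrib_right add_divide_distrib)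
      finally show ?case .
    qed
    from this[of Basis] have "norm (f (x + P Basis) - f x - (\<Sum>b\<in>Basis. (h \<bullet> b) *\<^sub>R d b x)) \<le> e * norm h"
      using N by (simp add: N_def)
    then show "norm (f y - f x - (\<Sum>b\<in>Basis. ((y - x) \<bullet> b) *\<^sub>R d b x)) \<le> e * norm (y - x)"
      by (simp add: P_def euclidean_representation h_def)
  qed (use \<delta> N in auto)
qed

text \<open>The second difference of \<open>f\<close> over a small parallelogram is symmetric in the
  two directions, and two mean value steps in either order express it as \<open>h * h\<close> times
  a mixed derivative at a nearby point. Only directional derivatives are assumed, since nothing is
  known of the second time derivative of a solution.\<close>

lemma mixed_partials_commute:
  fixes f :: "'a::real_normed_vector \<Rightarrow> real"
  assumes "open U" "x \<in> U"
    and da: "\<And>z. z \<in> U \<Longrightarrow> ((\<lambda>s. f (z + s *\<^sub>R a)) has_real_derivative fa z) (at 0)"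
    and db: "\<And>z. z \<in> U \<Longrightarrow> ((\<lambda>s. f (z + s *\<^sub>R b)) has_real_derivative fb z) (at 0)"
    and dab: "\<And>z. z \<in> U \<Longrightarrow> ((\<lambda>s. fa (z + s *\<^sub>R b)) has_real_derivative fab z) (at 0)"
    and dba: "\<And>z. z \<in> U \<Longrightarrow> ((\<lambda>s. fb (z + s *\<^sub>R a)) has_real_derivative fba z) (at 0)"
    and cab: "continuous_on U fab" and cba: "continuous_on U fba"
  shows "fab x = fba x"
proof -
  have shift: "((\<lambda>s. g (z + s *\<^sub>R c)) has_real_derivative g' (z + r *\<^sub>R c)) (at r)"
    if "z + r *\<^sub>R c \<in> U" "\<And>z. z \<in> U \<Longrightarrow> ((\<lambda>s. g (z + s *\<^sub>R c)) has_real_derivative g' z) (at 0)"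
    for g g' :: "'a \<Rightarrow> real" and z c r
  proof -
    have "((\<lambda>s. g (z + r *\<^sub>R c + s *\<^sub>R c)) has_real_derivative g' (z + r *\<^sub>R c)) (at (r - r))"
      using that by simp
    moreover have "((\<lambda>s. s - r) has_real_derivative 1) (at r)"
      by (auto intro!: derivative_eq_intros)
    ultimately have "((\<lambda>s. g (z + r *\<^sub>R c + (s - r) *\<^sub>R c)) has_real_derivative g' (z + r *\<^sub>R c) * 1) (at r)"
      by (rule DERIV_chain2)
    then show ?thesis by (simp add: algebra_simps)
  qed
  \<comment> \<open>Stated for arbitrary directions and derivatives, so that it can be applied in
    both orders.\<close>
  have mvt: "\<exists>s r. 0 < s \<and> s < h \<and> 0 < r \<and> r < h \<and>
      f (x + h *\<^sub>R a + h *\<^sub>R b) - f (x + h *\<^sub>R a) - (f (x + h *\<^sub>R b) - f x) = h * h * gab (x + s *\<^sub>R a + r *\<^sub>R b)"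
    if h: "0 < h" "\<And>s r. 0 \<le> s \<Longrightarrow> s \<le> h \<Longrightarrow> 0 \<le> r \<Longrightarrow> r \<le> h \<Longrightarrow> x + s *\<^sub>R a + r *\<^sub>R b \<in> U"
      and da: "\<And>z. z \<in> U \<Longrightarrow> ((\<lambda>s. f (z + s *\<^sub>R a)) has_real_derivative ga z) (at 0)"
      and dab: "\<And>z. z \<in> U \<Longrightarrow> ((\<lambda>s. ga (z + s *\<^sub>R b)) has_real_derivative gab z) (at 0)"
    for h a b ga gab
  proof -
    define k where "k s = f (x + s *\<^sub>R a + h *\<^sub>R b) - f (x + s *\<^sub>R a)" for s
    have dk: "(k has_real_derivative (ga (x + s *\<^sub>R a + h *\<^sub>R b) - ga (x + s *\<^sub>R a))) (at s)" if "0 \<le> s" "s \<le> h" for s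
    proof -
      have 1: "((\<lambda>s. f ((x + h *\<^sub>R b) + s *\<^sub>R a)) has_real_derivative ga ((x + h *\<^sub>R b) + s *\<^sub>R a)) (at s)"
        by (rule shift[OF _ da]) (use h(2)[of s h] h(1) that in \<open>auto simp: algebra_simps\<close>)
      have 2: "((\<lambda>s. f (x + s *\<^sub>R a)) has_real_derivative ga (x + s *\<^sub>R a)) (at s)"
        by (rule shift[OF _ da]) (use h(2)[of s 0] h(1) that in \<open>auto simp: algebra_simps\<close>)
      show ?thesis using DERIV_diff[OF 1 2] by (simp add: k_def[abs_def] algebra_simps)
    qed
    obtain s where s: "0 < s" "s < h" "k h - k 0 = (h - 0) * (ga (x + s *\<^sub>R a + h *\<^sub>R b) - ga (x + s *\<^sub>R a))"
      using MVT2[OF h(1) dk] by blast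
    have dr: "((\<lambda>r. ga (x + s *\<^sub>R a + r *\<^sub>R b)) has_real_derivative gab (x + s *\<^sub>R a + r *\<^sub>R b)) (at r)" if "0 \<le> r" "r \<le> h" for r
      by (rule shift[OF _ dab]) (use h(2)[of s r] s that in auto)
    obtain r where r: "0 < r" "r < h"
      "ga (x + s *\<^sub>R a + h *\<^sub>R b) - ga (x + s *\<^sub>R a + 0 *\<^sub>R b) = (h - 0) * gab (x + s *\<^sub>R a + r *\<^sub>R b)"
      using MVT2[OF h(1) dr] by blast
    show ?thesis
      by (rule exI[of _ s], rule exI[of _ r]) (use s r in \<open>simp add: k_def\<close>)
  qed
  have "\<bar>fab x - fba x\<bar> \<le> e" if e: "0 < e" for e
  proof -
    have "\<exists>\<delta>>0. \<forall>z. dist z x < \<delta> \<longrightarrow> z \<in> U"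
      using assms(1,2) by (auto simp: open_dist)
    then obtain \<delta>0 where \<delta>0: "\<delta>0 > 0" "\<And>z. dist z x < \<delta>0 \<Longrightarrow> z \<in> U" by blast
    have "continuous (at x) fab" "continuous (at x) fba"
      using cab cba assms(1,2) by (auto simp: continuous_on_eq_continuous_at)
    then obtain \<delta>1 \<delta>2 where \<delta>1: "\<delta>1 > 0" "\<And>z. dist z x < \<delta>1 \<Longrightarrow> dist (fab z) (fab x) < e / 2"
      and \<delta>2: "\<delta>2 > 0" "\<And>z. dist z x < \<delta>2 \<Longrightarrow> dist (fba z) (fba x) < e / 2"
      unfolding continuous_at_eps_delta using e by (metis half_gt_zero)
    define \<delta> where "\<delta> = min \<delta>0 (min \<delta>1 \<delta>2)"
    define h where "h = \<delta> / (2 * (norm a + norm b + 1))"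
    have \<delta>: "0 < \<delta>" using \<delta>0 \<delta>1 \<delta>2 by (simp add: \<delta>_def)
    have nab: "0 < norm a + norm b + 1" by (smt (verit) norm_ge_zero)
    have h: "0 < h" using \<delta> nab by (simp add: h_def)
    have near: "dist (x + s *\<^sub>R a + r *\<^sub>R b) x < \<delta>" if "0 \<le> s" "s \<le> h" "0 \<le> r" "r \<le> h" for s r
    proof -
      have "dist (x + s *\<^sub>R a + r *\<^sub>R b) x \<le> s * norm a + r * norm b"
        using norm_triangle_ineq[of "s *\<^sub>R a" "r *\<^sub>R b"] that by (simp add: dist_norm add.assoc)
      also have "\<dots> \<le> h * norm a + h * norm b" using that by (intro add_mono mult_right_mono) auto
      also have "\<dots> \<le> h * (norm a + norm b + 1)" using h by (simp add: algebra_simps)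
      also have "\<dots> = \<delta> / 2" using nab by (simp add: h_def field_simps)
      also have "\<dots> < \<delta>" using \<delta> by simp
      finally show ?thesis .
    qed
    obtain s r where sr: "0 < s" "s < h" "0 < r" "r < h"
      "f (x + h *\<^sub>R a + h *\<^sub>R b) - f (x + h *\<^sub>R a) - (f (x + h *\<^sub>R b) - f x) = h * h * fab (x + s *\<^sub>R a + r *\<^sub>R b)"
      using mvt[OF h _ da dab] near \<delta>0(2) by (auto simp: \<delta>_def)
    have "x + s *\<^sub>R b + r *\<^sub>R a \<in> U" if "0 \<le> s" "s \<le> h" "0 \<le> r" "r \<le> h" for s r
      using near[of r s] \<delta>0(2) that by (simp add: \<delta>_def algebra_simps)
    then obtain s' r' where sr': "0 < s'" "s' < h" "0 < r'" "r' < h"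
      "f (x + h *\<^sub>R b + h *\<^sub>R a) - f (x + h *\<^sub>R b) - (f (x + h *\<^sub>R a) - f x) = h * h * fba (x + s' *\<^sub>R b + r' *\<^sub>R a)"
      using mvt[OF h _ db dba] by metis
    have "h * h * fab (x + s *\<^sub>R a + r *\<^sub>R b) = h * h * fba (x + s' *\<^sub>R b + r' *\<^sub>R a)"
      using sr(5) sr'(5) by (simp add: algebra_simps)
    then have "fab (x + s *\<^sub>R a + r *\<^sub>R b) = fba (x + r' *\<^sub>R a + s' *\<^sub>R b)" using h by (simp add: algebra_simps)
    moreover have "dist (fab (x + s *\<^sub>R a + r *\<^sub>R b)) (fab x) < e/2"
      using near[of s r] sr by (intro \<delta>1(2)) (simp add: \<delta>_def)
    moreover have "dist (fba (x + r' *\<^sub>R a + s' *\<^sub>R b)) (fba x) < e/2"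
      using near[of r' s'] sr' by (intro \<delta>2(2)) (simp add: \<delta>_def)
    ultimately show ?thesis by (simp add: dist_real_def abs_if split: if_splits)
  qed
  then have "\<bar>fab x - fba x\<bar> \<le> 0" by (rule field_le_epsilon[of _ 0, simplified])
  then show ?thesis by simp
qed

section \<open>Partial derivatives within half-open space-time sets\<close>

lemma pderiv_onI:
  assumes "at 0 within {s. p + s *\<^sub>R b \<in> D} \<noteq> bot"
    and "((\<lambda>s. f (p + s *\<^sub>R b)) has_vector_derivative d) (at 0 within {s. p + s *\<^sub>R b \<in> D})"
  shows "has_pderiv D b f p" "pderiv_on D b f p = d"
  using assms unfolding has_pderiv_def pderiv_on_def
  by (auto intro: differentiableI_vector vector_derivative_within)

lemma pderiv_onD:
  assumes "has_pderiv D b f p"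
  shows "((\<lambda>s. f (p + s *\<^sub>R b)) has_vector_derivative pderiv_on D b f p) (at 0 within {s. p + s *\<^sub>R b \<in> D})"
  using assms unfolding has_pderiv_def pderiv_on_def by (simp add: vector_derivative_works)

lemma at_within_line_open:
  fixes D :: "'a::real_normed_vector set"
  assumes "open D" "p \<in> D"
  shows "at 0 within {s. p + s *\<^sub>R b \<in> D} = at (0::real)"
proof (rule at_within_open)
  have "open ((\<lambda>s::real. p + s *\<^sub>R b) -` D)"
    by (rule open_vimage[OF assms(1)]) (intro continuous_intros)
  then show "open {s. p + s *\<^sub>R b \<in> D}" by (simp add: vimage_def)
qed (use assms in auto)

text \<open>The shape of the domain of a solution: relatively open in the half-space
  \<open>t \<ge> 0\<close>, so that the time derivative at \<open>t = 0\<close> is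
  one-sided.\<close>

definition half_open :: "(real \<times> 'a::real_normed_vector) set \<Rightarrow> bool" where
  "half_open \<Theta> \<longleftrightarrow> (\<exists>W. open W \<and> \<Theta> = W \<inter> ({0..} \<times> UNIV))"

lemma half_open_spacetime: "open \<Omega> \<Longrightarrow> half_open (spacetime \<Omega>)"
  unfolding half_open_def spacetime_def by (rule exI[of _ "UNIV \<times> \<Omega>"]) (auto intro: open_Times)

text \<open>Near \<open>p\<close> only the constraint \<open>t \<ge> 0\<close> restricts the line,
  so the filter, and with it every partial derivative, is the same for all half-open sets through
  \<open>p\<close>.\<close>

lemma at_within_line_half_open:
  assumes "half_open \<Theta>" "p \<in> \<Theta>"
  shows "at 0 within {s. p + s *\<^sub>R b \<in> \<Theta>} = at 0 within {s. 0 \<le> fst p + s * fst b}"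
proof -
  obtain W where W: "open W" "\<Theta> = W \<inter> ({0..} \<times> UNIV)" using assms by (auto simp: half_open_def)
  have "open ((\<lambda>s::real. p + s *\<^sub>R b) -` W)"
    by (rule open_vimage[OF W(1)]) (intro continuous_intros)
  then show ?thesis
    by (intro at_within_nhd[where S = "(\<lambda>s. p + s *\<^sub>R b) -` W"]) (use assms W in \<open>auto simp: mem_Times_iff\<close>)
qed

lemma at_within_halfline_nontrivial:
  assumes "0 \<le> a" "0 \<le> c"
  shows "at 0 within {s. 0 \<le> a + s * c} \<noteq> (bot :: real filter)"
proof -
  have "at_right (0::real) \<le> at 0 within {s. 0 \<le> a + s * c}"
    by (rule at_le) (use assms in auto)
  then show ?thesis using trivial_limit_at_right_real[of "0::real"] by (metis bot.extremum_uniqueI)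
qed

lemma half_open_line_nontrivial:
  assumes "half_open \<Theta>" "p \<in> \<Theta>" "0 \<le> fst b"
  shows "at 0 within {s. p + s *\<^sub>R b \<in> \<Theta>} \<noteq> bot"
proof -
  have "0 \<le> fst p" using assms by (auto simp: half_open_def mem_Times_iff)
  then show ?thesis
    unfolding at_within_line_half_open[OF assms(1,2)] using assms(3) by (rule at_within_halfline_nontrivial)
qed

lemma half_open_space_line:
  assumes "half_open \<Theta>" "p \<in> \<Theta>"
  shows "at 0 within {s. p + s *\<^sub>R (0, w) \<in> \<Theta>} = at 0"
proof -
  have "0 \<le> fst p" using assms by (auto simp: half_open_def mem_Times_iff)
  then show ?thesis unfolding at_within_line_half_open[OF assms] by simp
qed

lemma pderiv_on_local:
  assumes "half_open \<Theta>" "half_open \<Theta>'" "p \<in> \<Theta>" "p \<in> \<Theta>'"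
  shows "pderiv_on \<Theta> b f p = pderiv_on \<Theta>' b f p" "has_pderiv \<Theta> b f p = has_pderiv \<Theta>' b f p"
  using assms by (simp_all add: pderiv_on_def has_pderiv_def at_within_line_half_open)

lemma Basis_vec3: "Basis = range (\<lambda>j. axis j 1 :: real^3)"
  by (auto simp: Basis_vec_def)

lemma sum_Basis_axis:
  fixes g :: "real^3 \<Rightarrow> 'b::real_vector"
  shows "(\<Sum>b\<in>Basis. (h \<bullet> b) *\<^sub>R g b) = (\<Sum>j\<in>UNIV. h $ j *\<^sub>R g (axis j 1))"
proof -
  have "inj (\<lambda>j. axis j 1 :: real^3)" by (auto simp: inj_on_def axis_eq_axis)
  then show ?thesis by (simp add: Basis_vec3 sum.reindex inner_axis)
qed

lemma Basis_spacetime: "Basis = insert (1, 0) space_dirs"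
  by (auto simp: Basis_prod_def space_dirs_def Basis_vec3)

lemma fst_space_dirs: "b \<in> space_dirs \<Longrightarrow> fst b = 0"
  by (auto simp: space_dirs_def)

lemma fst_Basis_spacetime: "b \<in> Basis \<Longrightarrow> 0 \<le> fst b" for b :: "real \<times> (real^3)"
  by (auto simp: Basis_spacetime fst_space_dirs)

definition spd :: "(real^3) set \<Rightarrow> 3 \<Rightarrow> (real \<times> (real^3) \<Rightarrow> 'b::real_normed_vector) \<Rightarrow> real \<times> (real^3) \<Rightarrow> 'b" where
  "spd \<Omega> j g = pderiv_on (spacetime \<Omega>) (0, axis j 1) g"

lemma Ck_dirs_continuous: "Ck_dirs k B D f \<Longrightarrow> continuous_on D f"
  by (cases k) auto

lemma Ck_dirs_spd: "Ck_dirs (Suc k) space_dirs (spacetime \<Omega>) g \<Longrightarrow> Ck_dirs k space_dirs (spacetime \<Omega>) (spd \<Omega> j g)"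
  by (auto simp: spd_def space_dirs_def)

lemma
  fixes g :: "real \<times> (real^3) \<Rightarrow> 'b::real_normed_vector"
  assumes g: "Ck_dirs (Suc k) space_dirs (spacetime \<Omega>) g" and "open \<Omega>"
  shows spd_has_derivative: "\<And>t x. 0 \<le> t \<Longrightarrow> x \<in> \<Omega> \<Longrightarrow>
      ((\<lambda>x. g (t, x)) has_derivative (\<lambda>h. \<Sum>j\<in>UNIV. h $ j *\<^sub>R spd \<Omega> j g (t, x))) (at x)"
    and spd_C1: "C1_family \<Omega> (\<lambda>t x. g (t, x))"
proof -
  have c: "continuous_on (spacetime \<Omega>) (spd \<Omega> j g)" for j
    using Ck_dirs_continuous[OF Ck_dirs_spd[OF g]] .
  show d: "((\<lambda>x. g (t, x)) has_derivative (\<lambda>h. \<Sum>j\<in>UNIV. h $ j *\<^sub>R spd \<Omega> j g (t, x))) (at x)"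
    if t: "0 \<le> t" and x: "x \<in> \<Omega>" for t x
  proof -
    define d where "d b x = pderiv_on (spacetime \<Omega>) (0, b) g (t, x)" for b x
    have "((\<lambda>x. g (t, x)) has_derivative (\<lambda>h. \<Sum>b\<in>Basis. (h \<bullet> b) *\<^sub>R d b x)) (at x)"
    proof (rule has_derivative_continuous_partials[OF \<open>open \<Omega>\<close> x])
      fix b z :: "real^3" assume b: "b \<in> Basis" and z: "z \<in> \<Omega>"
      have p: "(t, z) \<in> spacetime \<Omega>" using t z by (simp add: spacetime_def)
      have "has_pderiv (spacetime \<Omega>) (0, b) g (t, z)" using g b p by (auto simp: space_dirs_def Basis_vec3)
      from pderiv_onD[OF this]
      show "((\<lambda>s. g (t, z + s *\<^sub>R b)) has_vector_derivative d b z) (at 0)"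
        unfolding half_open_space_line[OF half_open_spacetime[OF \<open>open \<Omega>\<close>] p] by (simp add: d_def)
    next
      fix b :: "real^3" assume "b \<in> Basis"
      then obtain j where j: "b = axis j 1" by (auto simp: Basis_vec3)
      have "continuous_on \<Omega> (\<lambda>x. spd \<Omega> j g (t, x))"
        by (rule continuous_on_compose2[OF c])
          (use t in \<open>auto simp: spacetime_def intro!: continuous_intros\<close>)
      then show "continuous_on \<Omega> (d b)" by (simp add: d_def[abs_def] spd_def j)
    qed
    then show ?thesis by (simp add: sum_Basis_axis d_def spd_def)
  qed
  have "continuous_on (spacetime \<Omega>) g" using Ck_dirs_continuous[OF g] .
  then show "C1_family \<Omega> (\<lambda>t x. g (t, x))"
  proof (intro C1_familyI[OF _ d])
    show "continuous_on ({0..} \<times> \<Omega>) (\<lambda>(t, x). \<Sum>j\<in>UNIV. h $ j *\<^sub>R spd \<Omega> j g (t, x))" for h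
      using c by (auto simp: spacetime_def split_beta intro!: continuous_intros)
  qed (auto simp: spacetime_def)
qed

lemma grad_vec_spd:
  assumes v: "Ck_dirs (Suc k) space_dirs (spacetime \<Omega>) v" and "open \<Omega>" "0 \<le> t" "x \<in> \<Omega>"
  shows "grad_vec \<Omega> (\<lambda>y. v (t, y)) x $ i $ j = spd \<Omega> j v (t, x) $ i"
proof -
  have p: "(t, x) \<in> spacetime \<Omega>" using assms by (simp add: spacetime_def)
  have "has_pderiv (spacetime \<Omega>) (0, axis j 1) v (t, x)" using v p by (auto simp: space_dirs_def)
  from pderiv_onD[OF this]
  have "((\<lambda>s. v (t, x + s *\<^sub>R axis j 1)) has_vector_derivative spd \<Omega> j v (t, x)) (at 0)"
    unfolding half_open_space_line[OF half_open_spacetime[OF \<open>open \<Omega>\<close>] p] by (simp add: spd_def)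
  from bounded_linear.has_vector_derivative[OF bounded_linear_vec_nth this]
  have "((\<lambda>s. v (t, x + s *\<^sub>R axis j 1) $ i) has_vector_derivative spd \<Omega> j v (t, x) $ i)
      (at 0 within {s. x + s *\<^sub>R axis j 1 \<in> \<Omega>})"
    by (rule has_vector_derivative_at_within)
  then have "pderiv_on \<Omega> (axis j 1) (\<lambda>y. v (t, y) $ i) x = spd \<Omega> j v (t, x) $ i"
    by (rule pderiv_onI(2)[rotated]) (use assms in \<open>simp add: at_within_line_open\<close>)
  then show ?thesis by (simp add: grad_vec_def)
qed

lemma grad_eqI:
  assumes "(f has_derivative (\<lambda>h. g \<bullet> h)) (at x)" and "open D" "x \<in> D"
  shows "grad D f x = g"
proof -
  have "pderiv_on D (axis j 1) f x = g $ j" for j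
  proof (rule pderiv_onI(2))
    have "((\<lambda>s::real. x + s *\<^sub>R axis j 1) has_derivative (\<lambda>s. s *\<^sub>R axis j 1)) (at 0)"
      by (auto intro!: derivative_eq_intros)
    from has_derivative_compose[OF this, of f "\<lambda>h. g \<bullet> h"] assms(1)
    have "((\<lambda>s. f (x + s *\<^sub>R axis j 1)) has_vector_derivative g $ j) (at 0)"
      by (simp add: has_vector_derivative_def inner_axis o_def mult.commute)
    then show "((\<lambda>s. f (x + s *\<^sub>R axis j 1)) has_vector_derivative g $ j) (at 0 within {s. x + s *\<^sub>R axis j 1 \<in> D})"
      by (rule has_vector_derivative_at_within)
  qed (use assms in \<open>simp add: at_within_line_open\<close>)
  then show ?thesis by (simp add: grad_def vec_eq_iff)
qed

lemma C1_family_constI: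
  fixes f :: "'a::euclidean_space \<Rightarrow> 'b::real_normed_vector"
  assumes "\<And>y. y \<in> U \<Longrightarrow> (f has_derivative F y) (at y)" and "\<And>w. continuous_on U (\<lambda>y. F y w)"
  shows "C1_family U (\<lambda>_. f)"
proof -
  have cf: "continuous_on U f"
    by (intro continuous_at_imp_continuous_on ballI has_derivative_continuous[OF assms(1)])
  have snd: "continuous_on ({0::real..} \<times> U) (\<lambda>p. g (snd p))" if "continuous_on U g" for g :: "'a \<Rightarrow> 'b"
    by (rule continuous_on_compose2[OF that continuous_on_snd[OF continuous_on_id]]) auto
  show ?thesis
  proof (rule C1_familyI[where F = "\<lambda>_. F"])
    show "continuous_on ({0::real..} \<times> U) (\<lambda>(t, y). f y)"
      using snd[OF cf] by (simp add: split_beta)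
    show "continuous_on ({0::real..} \<times> U) (\<lambda>(t, y). F y w)" for w
      using snd[OF assms(2)] by (simp add: split_beta)
  qed (rule assms(1))
qed

lemma C1_family_constE:
  assumes "C1_family U (\<lambda>_. f)"
  obtains F where "continuous_on U f" "\<And>y. y \<in> U \<Longrightarrow> (f has_derivative blinfun_apply (F y)) (at y)"
    "continuous_on U F"
proof -
  obtain f' where G: "continuous_on ({0::real..} \<times> U) (\<lambda>(t, y). f y)"
    "\<forall>t\<ge>0. \<forall>y\<in>U. (f has_derivative blinfun_apply (f' t y)) (at y)"
    "continuous_on ({0::real..} \<times> U) (\<lambda>(t, y). f' t y)"
    using assms unfolding C1_family_def by blast
  have c: "continuous_on U (\<lambda>y. (0::real, y))" "(\<lambda>y. (0::real, y)) ` U \<subseteq> {0..} \<times> U"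
    by (auto intro!: continuous_intros)
  show thesis
  proof (rule that[of "f' 0"])
    show "continuous_on U f" using continuous_on_compose2[OF G(1) c] by simp
    show "continuous_on U (f' 0)" using continuous_on_compose2[OF G(3) c] by simp
  qed (use G(2) in simp)
qed

lemma Ck_on_C1:
  fixes f :: "'a::euclidean_space \<Rightarrow> 'b::real_normed_vector"
  assumes f: "Ck_on (Suc k) D f" and "open D"
  shows "x \<in> D \<Longrightarrow> (f has_derivative (\<lambda>h. \<Sum>b\<in>Basis. (h \<bullet> b) *\<^sub>R pderiv_on D b f x)) (at x)"
    and "C1_family D (\<lambda>_. f)"
proof -
  have c: "continuous_on D (pderiv_on D b f)" if "b \<in> Basis" for b
    by (rule Ck_dirs_continuous[of k Basis]) (use f that in \<open>simp add: Ck_on_def\<close>)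
  show d: "(f has_derivative (\<lambda>h. \<Sum>b\<in>Basis. (h \<bullet> b) *\<^sub>R pderiv_on D b f x)) (at x)" if "x \<in> D" for x
  proof (rule has_derivative_continuous_partials[OF \<open>open D\<close> that])
    fix b z :: 'a assume "b \<in> Basis" "z \<in> D"
    then have "has_pderiv D b f z" using f by (auto simp: Ck_on_def)
    from pderiv_onD[OF this] show "((\<lambda>s. f (z + s *\<^sub>R b)) has_vector_derivative pderiv_on D b f z) (at 0)"
      by (simp add: at_within_line_open[OF \<open>open D\<close> \<open>z \<in> D\<close>])
  qed (rule c)
  show "C1_family D (\<lambda>_. f)"
    by (rule C1_family_constI[OF d]) (auto intro!: continuous_intros c)
qed

lemma
  fixes f :: "real^3 \<Rightarrow> real"
  assumes f: "Ck_on 2 D f" and "open D"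
  shows grad_has_derivative: "x \<in> D \<Longrightarrow> (f has_derivative (\<lambda>h. grad D f x \<bullet> h)) (at x)"
    and C1_grad: "C1_family D (\<lambda>_. grad D f)"
proof -
  have f': "Ck_on (Suc 1) D f" using f by (simp add: numeral_2_eq_2)
  show "(f has_derivative (\<lambda>h. grad D f x \<bullet> h)) (at x)" if "x \<in> D"
  proof -
    have "(\<lambda>h. \<Sum>b\<in>Basis. (h \<bullet> b) *\<^sub>R pderiv_on D b f x) = (\<lambda>h. grad D f x \<bullet> h)"
      by (rule ext) (subst sum_Basis_axis, simp add: grad_def inner_vec_def mult.commute)
    then show ?thesis using Ck_on_C1(1)[OF f' \<open>open D\<close> that] by simp
  qed
  have "C1_family D (\<lambda>_. pderiv_on D (axis j 1) f)" for j
    by (rule Ck_on_C1(2)[where k = 0]) (use f' \<open>open D\<close> in \<open>auto simp: Ck_on_def Basis_vec3\<close>)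
  then have "C1_family D (\<lambda>_ x. \<Sum>j\<in>UNIV. pderiv_on D (axis j 1) f x *\<^sub>R axis j 1)"
    by (intro C1_family_sum C1_family_linear_compose[OF bounded_linear_scaleR_left])
  then have "C1_family D (\<lambda>_ x. grad D f x)"
    by (rule C1_family_cong[OF _ \<open>open D\<close>])
      (simp add: grad_def vec_eq_iff axis_def if_distrib sum.delta cong: if_cong)
  then show "C1_family D (\<lambda>_. grad D f)" by simp
qed

text \<open>At \<open>t = 0\<close> the time derivative within \<open>\<Theta>\<close> is one-sided
  and agrees with the two-sided one supplied on \<open>W\<close>. Regularity up to the initial time
  is thus read off from the extension to negative times.\<close>

lemma Ck_on_1I:
  fixes f :: "real \<times> (real^3) \<Rightarrow> 'b::real_normed_vector"
  assumes "C1_family W (\<lambda>_. f)" and "half_open \<Theta>" "\<Theta> \<subseteq> W"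
  shows "Ck_on 1 \<Theta> f"
    and "b \<in> Basis \<Longrightarrow> p \<in> \<Theta> \<Longrightarrow> (f has_derivative F) (at p) \<Longrightarrow> pderiv_on \<Theta> b f p = F b"
proof -
  obtain G where G: "continuous_on W f" "\<And>y. y \<in> W \<Longrightarrow> (f has_derivative blinfun_apply (G y)) (at y)"
    "continuous_on W G"
    using C1_family_constE[OF assms(1)] by blast
  have G3: "continuous_on W (\<lambda>y. G y w)" for w by (intro continuous_intros G(3))
  have line: "has_pderiv \<Theta> b f p" "pderiv_on \<Theta> b f p = H b"
    if b: "b \<in> Basis" and p: "p \<in> \<Theta>" and H: "(f has_derivative H) (at p)" for b p H
  proof -
    have l: "((\<lambda>s::real. p + s *\<^sub>R b) has_derivative (\<lambda>s. s *\<^sub>R b)) (at 0)"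
      by (auto intro!: derivative_eq_intros)
    have "linear H" using has_derivative_linear[OF H] .
    then have "((\<lambda>s. f (p + s *\<^sub>R b)) has_vector_derivative H b) (at 0)"
      using has_derivative_compose[OF l, of f H] H
      by (simp add: has_vector_derivative_def o_def linear_scale)
    then have "((\<lambda>s. f (p + s *\<^sub>R b)) has_vector_derivative H b) (at 0 within {s. p + s *\<^sub>R b \<in> \<Theta>})"
      by (rule has_vector_derivative_at_within)
    from pderiv_onI[OF half_open_line_nontrivial[OF assms(2) p fst_Basis_spacetime[OF b]] this]
    show "has_pderiv \<Theta> b f p" "pderiv_on \<Theta> b f p = H b" by auto
  qed
  have eq: "pderiv_on \<Theta> b f p = G p b" if "b \<in> Basis" "p \<in> \<Theta>" for b p
    using line(2)[OF that G(2)[OF subsetD[OF assms(3) that(2)]]] .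
  have "continuous_on \<Theta> (pderiv_on \<Theta> b f)" if "b \<in> Basis" for b
    by (rule continuous_on_eq[OF continuous_on_subset[OF G3 assms(3)]]) (use eq that in auto)
  moreover have "has_pderiv \<Theta> b f p" if "b \<in> Basis" "p \<in> \<Theta>" for b p
    using line(1)[OF that G(2)[OF subsetD[OF assms(3) that(2)]]] .
  ultimately show "Ck_on 1 \<Theta> f"
    using continuous_on_subset[OF G(1) assms(3)] by (simp add: Ck_on_def)
  show "pderiv_on \<Theta> b f p = F b" if "b \<in> Basis" "p \<in> \<Theta>" "(f has_derivative F) (at p)"
    using line(2)[OF that] .
qed

section \<open>Invariance of the domain under the flow\<close>

text \<open>The barrier \<open>u t = e * exp ((L + 1) * t)\<close> cannot be crossed: at the last
  time with \<open>g \<le> u\<close> the Dini inequality yields a later one. At each time only some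
  arbitrarily small \<open>h\<close> is demanded, which is all that the lower limit in the
  contingent cone provides.\<close>

lemma dini_zero:
  fixes g :: "real \<Rightarrow> real"
  assumes cont: "continuous_on {0..a} g" and nonneg: "\<And>t. t \<in> {0..a} \<Longrightarrow> 0 \<le> g t" and "g 0 = 0" and "0 \<le> L"
    and dini: "\<And>t e d. 0 \<le> t \<Longrightarrow> t < a \<Longrightarrow> 0 < e \<Longrightarrow> 0 < d \<Longrightarrow>
      \<exists>h. 0 < h \<and> h < d \<and> g (t + h) \<le> g t + h * (L * g t + e)"
    and t1: "t1 \<in> {0..a}"
  shows "g t1 = 0"
proof -
  have "g t1 \<le> e * exp ((L + 1) * t1)" if e: "0 < e" for e
  proof (rule ccontr)
    define u where "u t = e * exp ((L + 1) * t)" for t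
    assume "\<not> g t1 \<le> e * exp ((L + 1) * t1)"
    then have gt: "u t1 < g t1" by (simp add: u_def)
    define S where "S = {t \<in> {0..t1}. g t \<le> u t}"
    have "closed S" unfolding S_def u_def
      by (intro continuous_on_closed_Collect_le continuous_intros continuous_on_subset[OF cont]) (use t1 in auto)
    moreover have "S \<subseteq> {0..t1}" by (auto simp: S_def)
    ultimately have S: "compact S" by (metis closed_Int_compact compact_Icc inf.absorb_iff1)
    have "0 \<in> S" using t1 e \<open>g 0 = 0\<close> by (simp add: S_def u_def)
    then obtain t0 where t0: "t0 \<in> S" "\<And>t. t \<in> S \<Longrightarrow> t \<le> t0" using compact_attains_sup[OF S] by blast
    have t0': "0 \<le> t0" "t0 \<le> t1" "g t0 \<le> u t0" using t0(1) by (auto simp: S_def)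
    with gt have "t0 < t1" by (metis leD le_less)
    have up: "0 < u t0" using e by (simp add: u_def)
    \<comment> \<open>The Dini inequality is applied with the barrier value \<open>u t0\<close> as
      error; this accounts for the \<open>+ 1\<close> in the exponent.\<close>
    obtain h where h: "0 < h" "h < t1 - t0" "g (t0 + h) \<le> g t0 + h * (L * g t0 + u t0)"
      using dini[of t0 "u t0" "t1 - t0"] t0' \<open>t0 < t1\<close> up t1 by auto
    have "g t0 + h * (L * g t0 + u t0) \<le> u t0 + h * (L * u t0 + u t0)"
      using t0'(3) h(1) \<open>0 \<le> L\<close> by (intro add_mono mult_left_mono) auto
    also have "\<dots> = u t0 * (1 + (L + 1) * h)" by (simp add: algebra_simps)
    also have "\<dots> \<le> u t0 * exp ((L + 1) * h)" using up by (intro mult_left_mono exp_ge_add_one_self) auto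
    also have "\<dots> = u (t0 + h)" by (simp add: u_def exp_add algebra_simps)
    finally have "t0 + h \<in> S" using h t0' by (simp add: S_def)
    with t0(2) h(1) show False by force
  qed
  then have "g t1 \<le> e" if "0 < e" for e
    using that by (metis divide_pos_pos exp_gt_zero nonzero_eq_divide_eq exp_not_eq_zero)
  then have "g t1 \<le> 0" by (rule field_le_epsilon[of _ 0, simplified])
  then show ?thesis using nonneg[OF t1] by simp
qed

lemma contingent_coneD:
  assumes "z \<in> contingent_cone K x" "0 < e" "0 < d"
  obtains h where "0 < h" "h < d" "infdist (x + h *\<^sub>R z) K < e * h"
proof (rule ccontr)
  assume nt: "\<not> thesis"
  have *: "e * h \<le> infdist (x + h *\<^sub>R z) K" if "0 < h" "h < d" for h
    using that nt assms(2) \<open>\<And>h. 0 < h \<Longrightarrow> h < d \<Longrightarrow> infdist (x + h *\<^sub>R z) K < e * h \<Longrightarrow> thesis\<close>[of h] by linarith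
  have "\<forall>\<^sub>F h in at_right 0. ereal e \<le> ereal (infdist (x + h *\<^sub>R z) K / h)"
    unfolding eventually_at_right_field using * \<open>0 < d\<close> by (auto simp: field_simps intro!: exI[of _ d])
  from Liminf_bounded[OF this] assms show False by (simp add: contingent_cone_def)
qed

text \<open>Followed backwards from the first time on the frontier, the distance to the frontier starts at
  \<open>0\<close> and satisfies a linear Dini inequality, by the tangency of \<open>- v\<close> and the Lipschitz condition.\<close>

lemma flow_stays_inside:
  assumes "open \<Omega>" and H1: "H1 \<Omega> v" and H2: "H2 \<Omega> v" and X: "is_flow \<Omega> v X"
    and \<xi>: "\<xi> \<in> \<Omega>" and s1: "0 \<le> s1"
  shows "X s1 0 \<xi> \<in> \<Omega>"
proof (rule ccontr)
  assume out: "X s1 0 \<xi> \<notin> \<Omega>"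
  define x where "x s = X s 0 \<xi>" for s
  have \<xi>c: "\<xi> \<in> closure \<Omega>" using \<xi> closure_subset by auto
  have x0: "x 0 = \<xi>" and xc: "\<And>s. 0 \<le> s \<Longrightarrow> x s \<in> closure \<Omega>"
    and dx: "\<And>s. 0 \<le> s \<Longrightarrow> (x has_vector_derivative v (s, x s)) (at s within {0..})"
    using X \<xi>c by (auto simp: is_flow_def x_def[abs_def])
  have cx: "continuous_on {0..} x"
    by (rule continuous_on_vector_derivative[of _ _ "\<lambda>s. v (s, x s)"]) (use dx in auto)
  define S where "S = {0..s1} \<inter> x -` (- \<Omega>)"
  have "closed S" unfolding S_def
    by (rule continuous_closed_preimage) (use \<open>open \<Omega>\<close> in \<open>auto intro: continuous_on_subset[OF cx]\<close>)
  moreover have "S \<subseteq> {0..s1}" by (auto simp: S_def)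
  ultimately have S: "compact S" by (metis closed_Int_compact compact_Icc inf.absorb_iff1)
  have "s1 \<in> S" using out s1 by (simp add: S_def x_def)
  then obtain s where s: "s \<in> S" "\<And>t. t \<in> S \<Longrightarrow> s \<le> t" using compact_attains_inf[OF S] by blast
  have s0: "0 < s" using s(1) x0 \<xi> by (cases "s = 0") (auto simp: S_def)
  let ?F = "frontier \<Omega>"
  have xs: "x s \<in> ?F" using s(1) xc[of s] \<open>open \<Omega>\<close> by (auto simp: frontier_def S_def interior_open)
  have inside: "x t \<in> \<Omega>" if "0 \<le> t" "t < s" for t
    using s that by (force simp: S_def)
  obtain \<delta> L where \<delta>: "\<delta> > 0" "L > 0" "\<And>t y z. 0 \<le> t \<Longrightarrow> \<bar>t - s\<bar> < \<delta> \<Longrightarrow> y \<in> closure \<Omega> \<Longrightarrow> z \<in> closure \<Omega> \<Longrightarrow>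
      dist y (x s) < \<delta> \<Longrightarrow> dist z (x s) < \<delta> \<Longrightarrow> norm (v (t, y) - v (t, z)) \<le> L * norm (y - z)"
    using H1 s0 xs unfolding H1_def frontier_def by (metis DiffD1 less_imp_le)
  have "continuous (at s within {0..}) x" using cx s0 by (simp add: continuous_on_eq_continuous_within)
  then obtain d where d: "d > 0" "\<And>t. 0 \<le> t \<Longrightarrow> dist t s < d \<Longrightarrow> dist (x t) (x s) < \<delta> / 2"
    unfolding continuous_within_eps_delta using \<delta>(1) by (metis atLeast_iff half_gt_zero)
  define a where "a = min s (min \<delta> d) / 2"
  have a: "0 < a" "a < s" "a < \<delta>" "a < d" using s0 \<delta>(1) d(1) by (auto simp: a_def)
  define g where "g t = infdist (x (s - t)) ?F" for t
  have "g a = 0"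
  proof (rule dini_zero[where a = a and L = L and g = g])
    show "continuous_on {0..a} g" unfolding g_def
      by (intro continuous_on_infdist continuous_on_compose2[OF cx] continuous_intros) (use a in auto)
    show "g 0 = 0" using xs by (simp add: g_def)
    fix t e d' :: real assume t: "0 \<le> t" "t < a" and e: "0 < e" and d': "0 < d'"
    define r where "r = s - t"
    have r: "0 < r" "\<bar>r - s\<bar> < \<delta>" "dist r s < d" using t a by (auto simp: r_def dist_real_def)
    \<comment> \<open>Tangency is available only on the frontier, so the velocity at
      \<open>x r\<close> is compared with that at a nearest frontier point \<open>y\<close>. Since
      \<open>y\<close> is at most twice as far from \<open>x s\<close> as \<open>x r\<close> is,
      closeness \<open>\<delta> / 2\<close> of \<open>x r\<close> keeps both in the range of the
      Lipschitz condition.\<close>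
    obtain y where y: "y \<in> ?F" "infdist (x r) ?F = dist (x r) y"
      using infdist_attains_inf[of ?F "x r"] xs by auto
    have "dist (x r) y \<le> dist (x r) (x s)" using y(2) infdist_le[OF xs, of "x r"] by simp
    then have "dist y (x s) \<le> 2 * dist (x r) (x s)"
      using dist_triangle[of y "x s" "x r"] by (simp add: dist_commute)
    moreover have xr: "dist (x r) (x s) < \<delta> / 2" using d(2)[of r] r by simp
    ultimately have ys: "dist y (x s) < \<delta>" by simp
    have yc: "y \<in> closure \<Omega>" using y(1) by (simp add: frontier_def)
    have lip: "norm (v (r, x r) - v (r, y)) \<le> L * norm (x r - y)"
      using \<delta>(3)[of r "x r" y] r xc[of r] yc xr ys \<delta>(1) by simp
    have "(x has_derivative (\<lambda>h. h *\<^sub>R v (r, x r))) (at r within {0..})"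
      using dx[of r] r by (simp add: has_vector_derivative_def)
    then have "\<exists>k>0. \<forall>q\<in>{0..}. norm (q - r) < k \<longrightarrow>
        norm (x q - x r - (q - r) *\<^sub>R v (r, x r)) \<le> (e / 2) * norm (q - r)"
      unfolding has_derivative_within_alt using e by (meson half_gt_zero)
    then obtain k where k: "k > 0" "\<And>q. 0 \<le> q \<Longrightarrow> norm (q - r) < k \<Longrightarrow>
        norm (x q - x r - (q - r) *\<^sub>R v (r, x r)) \<le> (e / 2) * norm (q - r)" by auto
    have "- v (r, y) \<in> contingent_cone ?F y" using H2 y(1) r by (simp add: H2_def)
    then obtain h where h: "0 < h" "h < min d' (min k r)" "infdist (y + h *\<^sub>R (- v (r, y))) ?F < e / 2 * h"
      using contingent_coneD[of "- v (r, y)" ?F y "e/2" "min d' (min k r)"] e d' k(1) r(1) by auto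
    \<comment> \<open>\<open>x (r - h)\<close> is compared with the step \<open>- h v\<close> from
      \<open>y\<close>. The errors are the differentiation error of \<open>x\<close> at
      \<open>r\<close>, which uses one half of \<open>e\<close>, the distance at time
      \<open>r\<close>, and \<open>h\<close> times the Lipschitz difference; the other half of
      \<open>e\<close> is for the distance of the step to the frontier.\<close>
    have "x (r - h) - (y + h *\<^sub>R (- v (r, y))) =
        (x (r - h) - x r - (r - h - r) *\<^sub>R v (r, x r)) + (x r - y) - h *\<^sub>R (v (r, x r) - v (r, y))"
      by (simp add: algebra_simps)
    also have "norm \<dots> \<le> e / 2 * h + norm (x r - y) + h * (L * norm (x r - y))"
    proof (rule order_trans[OF norm_triangle_ineq4 add_mono[OF order_trans[OF norm_triangle_ineq add_mono[OF _ order_refl]]]])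
      show "norm (x (r - h) - x r - (r - h - r) *\<^sub>R v (r, x r)) \<le> e / 2 * h"
        using k(2)[of "r - h"] h by simp
      show "norm (h *\<^sub>R (v (r, x r) - v (r, y))) \<le> h * (L * norm (x r - y))"
        using lip h(1) by (simp add: mult_left_mono)
    qed
    finally have n: "dist (x (r - h)) (y + h *\<^sub>R (- v (r, y))) \<le> e / 2 * h + norm (x r - y) + h * (L * norm (x r - y))"
      by (simp add: dist_norm)
    have "g (t + h) = infdist (x (r - h)) ?F" by (simp add: g_def r_def algebra_simps)
    also have "\<dots> \<le> infdist (y + h *\<^sub>R (- v (r, y))) ?F + dist (x (r - h)) (y + h *\<^sub>R (- v (r, y)))"
      by (rule infdist_triangle)
    also have "\<dots> \<le> e / 2 * h + (e / 2 * h + norm (x r - y) + h * (L * norm (x r - y)))"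
      using h(3) n by linarith
    also have "\<dots> = g t + h * (L * g t + e)" using y(2) by (simp add: g_def r_def[symmetric] dist_norm algebra_simps)
    finally show "\<exists>h. 0 < h \<and> h < d' \<and> g (t + h) \<le> g t + h * (L * g t + e)" using h by auto
  qed (use a \<delta> in \<open>auto simp: g_def infdist_nonneg\<close>)
  then have "x (s - a) \<in> ?F"
    using xs in_closed_iff_infdist_zero[of ?F "x (s - a)"] by (auto simp: g_def)
  then show False
    using inside[of "s - a"] a \<open>open \<Omega>\<close> by (auto simp: frontier_def interior_open)
qed

section \<open>Inverse of a space-time map over a compact set\<close>

text \<open>\<open>B p\<close> is bounded below by some \<open>c > 0\<close>, so the difference
  \<open>u\<close> of the two preimages is estimated by \<open>B p u\<close>; the part of this that
  contains \<open>u\<close> again is absorbed into the left-hand side.\<close>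

lemma continuous_on_inverse_blinfun:
  fixes B :: "'a::metric_space \<Rightarrow> 'b::euclidean_space \<Rightarrow>\<^sub>L 'b"
  assumes cont: "continuous_on S B" and bij: "\<And>p. p \<in> S \<Longrightarrow> bij (blinfun_apply (B p))"
  shows "continuous_on S (\<lambda>p. inv (blinfun_apply (B p)) w)"
  unfolding continuous_on_iff
proof (intro ballI allI impI)
  fix p e assume p: "p \<in> S" and e: "(0::real) < e"
  have inv: "B q (inv (B q) u) = u" "inv (B q) (B q u) = u" if "q \<in> S" for q u
    using bij[OF that] by (auto simp: bij_is_surj surj_f_inv_f bij_is_inj inv_f_f)
  obtain c where c: "c > 0" "\<And>u. c * norm u \<le> norm (B p u)"
    using linear_inj_bounded_below_pos[of "blinfun_apply (B p)"] bij[OF p]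
    by (metis bij_is_inj blinfun.bounded_linear_right bounded_linear.linear)
  define m where "m = norm (inv (B p) w)"
  \<comment> \<open>The first entry allows the absorption of half of \<open>c * norm u\<close>, the
    second makes the remainder smaller than \<open>c / 2 * e\<close>; \<open>m + 1\<close> keeps the
    denominator positive.\<close>
  define r where "r = min (c / 2) (e * c / (2 * (m + 1)))"
  have "0 \<le> m" by (simp add: m_def)
  then have r: "0 < r" using c e by (simp add: r_def)
  obtain d where d: "d > 0" "\<And>q. q \<in> S \<Longrightarrow> dist q p < d \<Longrightarrow> dist (B q) (B p) < r"
    using cont p r unfolding continuous_on_iff by metis
  show "\<exists>d>0. \<forall>q\<in>S. dist q p < d \<longrightarrow> dist (inv (B q) w) (inv (B p) w) < e"
  proof (intro exI[of _ d] conjI ballI impI)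
    fix q assume q: "q \<in> S" "dist q p < d"
    let ?u = "inv (B q) w - inv (B p) w"
    have n: "norm (B q - B p) < r" using d(2)[OF q] by (simp add: dist_norm)
    have "B q ?u = - (B q - B p) (inv (B p) w)"
      using inv(1)[OF q(1)] inv(1)[OF p] by (simp add: blinfun.diff_right blinfun.diff_left)
    then have 1: "norm (B q ?u) \<le> norm (B q - B p) * m"
      unfolding m_def by (metis norm_blinfun norm_minus_cancel)
    have "c * norm ?u \<le> norm (B p ?u)" by (rule c(2))
    also have "B p ?u = B q ?u - (B q - B p) ?u" by (simp add: blinfun.diff_left)
    also have "norm \<dots> \<le> norm (B q ?u) + norm ((B q - B p) ?u)" by (rule norm_triangle_ineq4)
    also have "\<dots> \<le> norm (B q - B p) * m + norm (B q - B p) * norm ?u"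
      using 1 by (intro add_mono norm_blinfun)
    also have "\<dots> \<le> r * m + c / 2 * norm ?u"
      using n \<open>0 \<le> m\<close> by (intro add_mono mult_right_mono) (auto simp: r_def)
    finally have "c / 2 * norm ?u \<le> r * m" by simp
    also have "r * m \<le> e * c / (2 * (m + 1)) * m" using \<open>0 \<le> m\<close> by (intro mult_right_mono) (auto simp: r_def)
    also have "\<dots> < c / 2 * e" using \<open>0 \<le> m\<close> c e by (simp add: field_simps)
    finally show "dist (inv (B q) w) (inv (B p) w) < e" using c(1) by (simp add: dist_norm)
  qed (rule d)
qed

text \<open>Injectivity on all of \<open>N\<close> gives a single inverse, without patching of local
  ones. Invariance of domain makes the image open, and the derivative of the inverse is continuous
  because inversion of linear maps is.\<close>

lemma C1_inverse:
  fixes G :: "'a::euclidean_space \<Rightarrow> 'a"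
  assumes "open N" and inj: "inj_on G N"
    and d: "\<And>p. p \<in> N \<Longrightarrow> (G has_derivative blinfun_apply (G' p)) (at p)" and c: "continuous_on N G'"
    and bij: "\<And>p. p \<in> N \<Longrightarrow> bij (blinfun_apply (G' p))"
  shows "open (G ` N)" "C1_family (G ` N) (\<lambda>_. inv_into N G)"
proof -
  have cG: "continuous_on N G"
    by (intro continuous_at_imp_continuous_on ballI has_derivative_continuous[OF d])
  show op: "open (G ` N)" by (rule invariance_of_domain[OF cG \<open>open N\<close> inj])
  let ?h = "inv_into N G"
  have hN: "?h q \<in> N" if "q \<in> G ` N" for q using that by (rule inv_into_into)
  have dh: "(?h has_derivative inv (G' (?h q))) (at q)" if q: "q \<in> G ` N" for q
  proof -
    have "(?h has_derivative inv (G' (?h q))) (at (G (?h q)))"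
    proof (rule has_derivative_inverse_on[OF \<open>open N\<close> d, where g' = "\<lambda>p. inv (G' p)"])
      show "blinfun_apply (G' (?h q)) \<circ> inv (G' (?h q)) = id"
        using bij[OF hN[OF q]] by (simp add: bij_is_surj surj_iff[symmetric])
    qed (use inj hN[OF q] in auto)
    then show ?thesis using q by (simp add: f_inv_into_f)
  qed
  have ch: "continuous_on (G ` N) ?h"
    by (intro continuous_at_imp_continuous_on ballI has_derivative_continuous[OF dh])
  show "C1_family (G ` N) (\<lambda>_. ?h)"
  proof (rule C1_family_constI[OF dh])
    have "continuous_on (G ` N) (\<lambda>q. G' (?h q))"
      by (rule continuous_on_compose2[OF c ch]) (use hN in auto)
    then show "continuous_on (G ` N) (\<lambda>q. inv (G' (?h q)) w)" for w
      by (rule continuous_on_inverse_blinfun) (use bij hN in auto)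
  qed
qed

text \<open>Pairs of points at which \<open>G\<close> is locally injective or takes different values form an open set. It
  contains \<open>K \<times> K\<close> for \<open>K = [0, n] \<times> S\<close>, hence a neighbourhood of it whose size \<open>\<delta> n\<close> can be
  taken decreasing in \<open>n\<close>.\<close>

lemma time_monotone_injective_neighbourhood:
  fixes G :: "real \<times> 'a::euclidean_space \<Rightarrow> real \<times> 'a" and S :: "'a set"
  assumes "open W" and d: "\<And>p. p \<in> W \<Longrightarrow> (G has_derivative blinfun_apply (G' p)) (at p)"
    and c: "continuous_on W G'" and time: "\<And>p. p \<in> W \<Longrightarrow> fst (G p) = fst p"
    and "compact S" and sub: "{0..} \<times> S \<subseteq> W" and inj: "inj_on G ({0..} \<times> S)"
    and inj': "\<And>p. p \<in> {0..} \<times> S \<Longrightarrow> inj (blinfun_apply (G' p))"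
  obtains N where "open N" "{0..} \<times> S \<subseteq> N" "N \<subseteq> W" "inj_on G N"
    "\<And>p. p \<in> N \<Longrightarrow> bij (blinfun_apply (G' p))"
    "\<And>s t \<xi>. (t, \<xi>) \<in> N \<Longrightarrow> 0 \<le> s \<Longrightarrow> s \<le> t \<Longrightarrow> (s, \<xi>) \<in> N"
proof -
  define good where "good A \<longleftrightarrow> open A \<and> A \<subseteq> W \<and> inj_on G A \<and> (\<forall>q\<in>A. bij (blinfun_apply (G' q)))" for A
  have loc: "\<exists>A. good A \<and> p \<in> A" if p: "p \<in> {0..} \<times> S" for p
  proof -
    have pW: "p \<in> W" using p sub by auto
    have lin: "linear (blinfun_apply (G' p))"
      by (rule bounded_linear.linear[OF blinfun.bounded_linear_right])
    obtain g where g: "linear g" "g \<circ> blinfun_apply (G' p) = id"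
      using linear_injective_left_inverse[OF lin inj'[OF p]] by auto
    have gi: "g (blinfun_apply (G' p) i) = i" for i using fun_cong[OF g(2), of i] by simp
    have "bounded_linear g" using g(1) by (simp add: linear_conv_bounded_linear)
    then have "Blinfun g o\<^sub>L G' p = id_blinfun"
      by (intro blinfun_eqI) (simp add: bounded_linear_Blinfun_apply gi)
    from inverse_function_theorem[OF \<open>open W\<close> d c pW this]
    obtain A V g g' where A: "open A" "A \<subseteq> W" "p \<in> A" "homeomorphism A V G g"
      "\<And>y. y \<in> V \<Longrightarrow> bij (blinfun_apply (G' (g y)))" by metis
    have "inj_on G A" using A(4) by (metis homeomorphism_apply1 inj_on_inverseI)
    moreover have "bij (blinfun_apply (G' q))" if "q \<in> A" for q
      using A(5)[of "G q"] A(4) that by (metis homeomorphism_apply1 homeomorphism_image1 imageI)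
    ultimately show ?thesis using A by (auto simp: good_def)
  qed
  have cG: "continuous_on W G"
    by (intro continuous_at_imp_continuous_on ballI has_derivative_continuous[OF d])
  define Q where "Q = {(a, b). a \<in> W \<and> b \<in> W \<and> G a \<noteq> G b} \<union> (\<Union>A\<in>Collect good. A \<times> A)"
  have "open Q" unfolding Q_def
  proof (intro open_Un open_UN ballI)
    have 1: "continuous_on (W \<times> W) (\<lambda>p. G (fst p))" "continuous_on (W \<times> W) (\<lambda>p. G (snd p))"
      by (rule continuous_on_compose2[OF cG continuous_on_fst[OF continuous_on_id]], force)
        (rule continuous_on_compose2[OF cG continuous_on_snd[OF continuous_on_id]], force)
    have "open ((W \<times> W) \<inter> (\<lambda>p. dist (G (fst p)) (G (snd p))) -` {0<..})"
      by (rule continuous_open_preimage[OF continuous_on_dist[OF 1] open_Times[OF \<open>open W\<close> \<open>open W\<close>]]) simp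
    also have "(W \<times> W) \<inter> (\<lambda>p. dist (G (fst p)) (G (snd p))) -` {0<..} = {(a, b). a \<in> W \<and> b \<in> W \<and> G a \<noteq> G b}"
      by auto
    finally show "open {(a, b). a \<in> W \<and> b \<in> W \<and> G a \<noteq> G b}" .
  qed (auto simp: good_def intro: open_Times)
  have "\<exists>\<epsilon>>0. (\<Union>x\<in>({0..real n} \<times> S) \<times> ({0..real n} \<times> S). ball x \<epsilon>) \<subseteq> Q" for n
  proof -
    let ?K = "{0..real n} \<times> S"
    have "?K \<times> ?K \<subseteq> Q"
    proof
      fix x assume x: "x \<in> ?K \<times> ?K"
      obtain a b where [simp]: "x = (a, b)" by (cases x)
      have ab: "a \<in> {0..} \<times> S" "b \<in> {0..} \<times> S" using x by auto
      show "x \<in> Q"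
      proof (cases "G a = G b")
        case True
        then have "a = b" using inj ab by (meson inj_onD)
        then show ?thesis using loc[OF ab(1)] by (auto simp: Q_def)
      next
        case False
        then show ?thesis using ab sub by (auto simp: Q_def)
      qed
    qed
    moreover have "compact (?K \<times> ?K)" by (intro compact_Times \<open>compact S\<close>) auto
    ultimately show ?thesis
      using compact_subset_open_imp_ball_epsilon_subset[of "?K \<times> ?K" Q] \<open>open Q\<close> by metis
  qed
  then obtain \<epsilon> where \<epsilon>: "\<And>n. 0 < \<epsilon> n"
    "\<And>n. (\<Union>x\<in>({0..real n} \<times> S) \<times> ({0..real n} \<times> S). ball x (\<epsilon> n)) \<subseteq> Q" by metis
  \<comment> \<open>The running minimum makes \<open>\<delta>\<close> decreasing. Points of
    \<open>E n\<close> lie within \<open>2 * \<delta> n\<close> of the compact set, hence pairs of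
    them within \<open>4 * \<delta> n \<le> \<epsilon> n\<close> of its square.\<close>
  define \<delta> where "\<delta> n = Min (\<epsilon> ` {..n}) / 4" for n
  have \<delta>: "0 < \<delta> n" "4 * \<delta> n \<le> \<epsilon> n" for n
    using \<epsilon>(1) by (auto simp: \<delta>_def)
  have anti: "\<delta> m \<le> \<delta> n" if "n \<le> m" for n m
    unfolding \<delta>_def using that by (intro divide_right_mono Min_antimono) auto
  \<comment> \<open>The slab starts at \<open>- \<delta> n\<close> so that it is open and still
    contains \<open>t = 0\<close>. Its spatial radius does not depend on time, which is why the
    earlier nonnegative times of a point belong to it as well.\<close>
  define E where "E n = {- \<delta> n<..<real n} \<times> (\<Union>\<sigma>\<in>S. ball \<sigma> (\<delta> n))" for n
  have pair: "(a, b) \<in> Q" if a: "a \<in> E n" and b: "b \<in> E n" for a b n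
  proof -
    have near: "\<exists>p\<in>{0..real n} \<times> S. dist p q < 2 * \<delta> n" if "q \<in> E n" for q
    proof -
      obtain t \<xi> where q0: "q = (t, \<xi>)" by (cases q)
      then obtain \<sigma> where q: "q = (t, \<xi>)" "- \<delta> n < t" "t < real n" "\<sigma> \<in> S" "dist \<sigma> \<xi> < \<delta> n"
        using \<open>q \<in> E n\<close> by (auto simp: E_def)
      have "dist (max 0 t, \<sigma>) q \<le> dist (max 0 t) t + dist \<sigma> \<xi>"
        unfolding q dist_Pair_Pair by (rule sqrt_sum_squares_le_sum) auto
      also have "\<dots> < 2 * \<delta> n" using q \<delta>(1)[of n] by (auto simp: dist_real_def)
      finally show ?thesis using q by (intro bexI[of _ "(max 0 t, \<sigma>)"]) auto
    qed
    obtain p where p: "p \<in> {0..real n} \<times> S" "dist p a < 2 * \<delta> n" using near[OF a] by blast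
    obtain q where q: "q \<in> {0..real n} \<times> S" "dist q b < 2 * \<delta> n" using near[OF b] by blast
    have "dist (p, q) (a, b) \<le> dist p a + dist q b"
      unfolding dist_Pair_Pair by (rule sqrt_sum_squares_le_sum) auto
    then have "(a, b) \<in> ball (p, q) (\<epsilon> n)" using p q \<delta>(2)[of n] by auto
    then show ?thesis using \<epsilon>(2)[of n] p(1) q(1) by blast
  qed
  have E_good: "\<exists>A. good A \<and> a \<in> A" if "a \<in> E n" for a n
    using pair[OF that that] by (auto simp: Q_def)
  have E_inj: "a = b" if "a \<in> E n" "b \<in> E n" "G a = G b" for a b n
    using pair[OF that(1,2)] that(3) by (auto simp: Q_def good_def dest: inj_onD)
  have E_W: "E n \<subseteq> W" for n using E_good by (fastforce simp: good_def)
  define N where "N = (\<Union>n. E n)"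
  show thesis
  proof (rule that[of N])
    show "open N" unfolding N_def E_def by (intro open_UN open_Times ballI) auto
    show "N \<subseteq> W" using E_W by (auto simp: N_def)
    show "bij (blinfun_apply (G' p))" if "p \<in> N" for p
      using that E_good by (fastforce simp: N_def good_def)
    show "{0..} \<times> S \<subseteq> N"
    proof safe
      fix t :: real and \<sigma> assume *: "0 \<le> t" "\<sigma> \<in> S"
      obtain n :: nat where n: "t < n" using reals_Archimedean2 by blast
      show "(t, \<sigma>) \<in> N" unfolding N_def E_def using n * \<delta>(1)[of n] by (auto intro!: exI[of _ n] bexI[of _ \<sigma>])
    qed
    show "(s, \<xi>) \<in> N" if *: "(t, \<xi>) \<in> N" "0 \<le> s" "s \<le> t" for s t \<xi>
    proof -
      obtain n where "(t, \<xi>) \<in> E n" using * by (auto simp: N_def)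
      then have "(s, \<xi>) \<in> E n" using * \<delta>(1)[of n] by (auto simp: E_def)
      then show ?thesis by (auto simp: N_def)
    qed
    \<comment> \<open>Points with equal image have equal time. At a common time the cross-sections
      shrink as the index grows, so both points lie in the slab of the smaller index, where
      injectivity is known.\<close>
    have le: "a = b" if a: "a \<in> E n" and b: "b \<in> E m" and eq: "G a = G b" and nm: "n \<le> m" for a b n m
    proof -
      have "fst a = fst b" using time[of a] time[of b] a b E_W eq by (metis subsetD)
      moreover have "(\<Union>\<sigma>\<in>S. ball \<sigma> (\<delta> m)) \<subseteq> (\<Union>\<sigma>\<in>S. ball \<sigma> (\<delta> n))"
        using anti[OF nm] by (intro UN_mono subset_ball) auto
      moreover have "snd b \<in> (\<Union>\<sigma>\<in>S. ball \<sigma> (\<delta> m))"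
        using b unfolding E_def mem_Times_iff by blast
      ultimately have "fst a = fst b" "snd b \<in> (\<Union>\<sigma>\<in>S. ball \<sigma> (\<delta> n))" by blast+
      then have "b \<in> E n" using a by (simp add: E_def mem_Times_iff)
      then show ?thesis using E_inj[OF a] eq by blast
    qed
    show "inj_on G N"
    proof (rule inj_onI)
      fix a b assume ab: "a \<in> N" "b \<in> N" "G a = G b"
      then obtain n m where "a \<in> E n" "b \<in> E m" by (auto simp: N_def)
      then show "a = b" using le[of a n b m] le[of b m a n] ab(3) by (metis nat_le_linear)
    qed
  qed
qed

section \<open>Characteristics\<close>

definition C1_deriv :: "'a set \<Rightarrow> (real \<Rightarrow> 'a::euclidean_space \<Rightarrow> 'b::real_normed_vector) \<Rightarrow> real \<Rightarrow> 'a \<Rightarrow> 'a \<Rightarrow>\<^sub>L 'b" where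
  "C1_deriv U f = (SOME f'. (\<forall>t\<ge>0. \<forall>y\<in>U. (f t has_derivative blinfun_apply (f' t y)) (at y)) \<and>
        continuous_on ({0..} \<times> U) (\<lambda>(t, y). f' t y))"

lemma C1_deriv:
  assumes "C1_family U f"
  shows "\<And>t y. 0 \<le> t \<Longrightarrow> y \<in> U \<Longrightarrow> (f t has_derivative blinfun_apply (C1_deriv U f t y)) (at y)"
    and "continuous_on ({0..} \<times> U) (\<lambda>(t, y). C1_deriv U f t y)"
proof -
  have "\<exists>f'. (\<forall>t\<ge>0. \<forall>y\<in>U. (f t has_derivative blinfun_apply (f' t y)) (at y)) \<and>
        continuous_on ({0..} \<times> U) (\<lambda>(t, y). f' t y)"
    using assms by (simp add: C1_family_def)
  from someI_ex[OF this]
  show "\<And>t y. 0 \<le> t \<Longrightarrow> y \<in> U \<Longrightarrow> (f t has_derivative blinfun_apply (C1_deriv U f t y)) (at y)"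
    "continuous_on ({0..} \<times> U) (\<lambda>(t, y). C1_deriv U f t y)"
    unfolding C1_deriv_def by auto
qed

lemma c1_ode_C1_family:
  assumes "open U" "C1_family U f"
  shows "c1_ode f (C1_deriv U f) U"
  using assms C1_deriv[OF assms(2)] C1_family_continuous[OF assms(2)] by unfold_locales

locale level_set_problem =
  fixes \<Omega> :: "(real^3) set"
    and v :: "real \<times> (real^3) \<Rightarrow> real^3"
    and X :: "real \<Rightarrow> real \<Rightarrow> real^3 \<Rightarrow> real^3"
    and \<Sigma>0 :: "(real^3) set"
    and \<phi>0 :: "real^3 \<Rightarrow> real"
  assumes open_Om: "open \<Omega>" and H1: "H1 \<Omega> v" and H2: "H2 \<Omega> v" and flow_X: "is_flow \<Omega> v X"
    and S0_sub: "\<Sigma>0 \<subseteq> \<Omega>" and compact_S0: "compact \<Sigma>0"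
    and C2_phi0: "Ck_on 2 \<Omega> \<phi>0"
    and zero_phi0: "{x \<in> \<Omega>. \<phi>0 x = 0} = \<Sigma>0"
    and grad_ne: "\<And>x. x \<in> \<Sigma>0 \<Longrightarrow> grad \<Omega> \<phi>0 x \<noteq> 0"
begin

abbreviation A :: "3 \<Rightarrow> real \<Rightarrow> real^3 \<Rightarrow> real^3" where
  "A j t x \<equiv> spd \<Omega> j v (t, x)"

abbreviation AA :: "3 \<Rightarrow> 3 \<Rightarrow> real \<Rightarrow> real^3 \<Rightarrow> real^3" where
  "AA k j t x \<equiv> spd \<Omega> k (spd \<Omega> j v) (t, x)"

definition Dv :: "real \<Rightarrow> real^3 \<Rightarrow> real^3 \<Rightarrow> real^3" where
  "Dv t x w = (\<Sum>j\<in>UNIV. w $ j *\<^sub>R A j t x)"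

definition DvT :: "real \<Rightarrow> real^3 \<Rightarrow> real^3 \<Rightarrow> real^3" where
  "DvT t x p = (\<Sum>k\<in>UNIV. (A k t x \<bullet> p) *\<^sub>R axis k 1)"

definition DDv :: "real \<Rightarrow> real^3 \<Rightarrow> real^3 \<Rightarrow> real^3 \<Rightarrow> real^3" where
  "DDv t x w p = (\<Sum>j\<in>UNIV. p $ j *\<^sub>R (\<Sum>k\<in>UNIV. w $ k *\<^sub>R AA k j t x))"

text \<open>The Rayleigh quotient of \<open>\<nabla>v\<close>; at \<open>p = \<nabla>\<phi>\<close>
  it is the factor of \<open>\<phi>\<close> on the right-hand side of the equation.\<close>

definition R :: "real \<Rightarrow> real^3 \<Rightarrow> real^3 \<Rightarrow> real" where
  "R t x p = (p \<bullet> Dv t x p) / (p \<bullet> p)"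

text \<open>The gradient of \<open>R\<close> in \<open>p\<close>, as \<open>R_has_derivative\<close>
  confirms; \<open>Rx\<close> below is that in \<open>x\<close>. \<open>Dv\<close> and
  \<open>DvT\<close> together are the gradient of the quadratic form, the last term comes from the
  quotient rule.\<close>

definition Rp :: "real \<Rightarrow> real^3 \<Rightarrow> real^3 \<Rightarrow> real^3" where
  "Rp t x p = inverse (p \<bullet> p) *\<^sub>R (Dv t x p + DvT t x p - (2 * R t x p) *\<^sub>R p)"

definition Rx :: "real \<Rightarrow> real^3 \<Rightarrow> real^3 \<Rightarrow> real^3" where
  "Rx t x p = inverse (p \<bullet> p) *\<^sub>R (\<Sum>k\<in>UNIV. (p \<bullet> DDv t x (axis k 1) p) *\<^sub>R axis k 1)"

text \<open>The phase space of triples \<open>(x, \<phi>, p)\<close>; \<open>R\<close> is singular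
  at \<open>p = 0\<close>.\<close>

definition U :: "((real^3) \<times> real \<times> (real^3)) set" where
  "U = \<Omega> \<times> UNIV \<times> (- {0})"

text \<open>The characteristic system of the equation \<open>\<phi>\<^sub>t + v \<bullet> p - \<phi> R(t, x, p) = 0\<close>, \<open>p = \<nabla>\<phi>\<close>, in the
  unknowns \<open>(x, \<phi>, p)\<close>. As \<open>R\<close> is homogeneous of degree \<open>0\<close> in \<open>p\<close>, the term \<open>- \<phi> p \<bullet> R\<^sub>p\<close> in the
  equation for \<open>\<phi>\<close> vanishes.\<close>

definition field :: "real \<Rightarrow> (real^3) \<times> real \<times> (real^3) \<Rightarrow> (real^3) \<times> real \<times> (real^3)" where
  "field t y = (let x = fst y; \<phi> = fst (snd y); p = snd (snd y) in
     (v (t, x) - \<phi> *\<^sub>R Rp t x p, \<phi> * R t x p, \<phi> *\<^sub>R Rx t x p + R t x p *\<^sub>R p - DvT t x p))"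

lemma open_U: "open U"
  unfolding U_def by (intro open_Times open_Om open_UNIV open_Compl closed_singleton)

lemma v3: "Ck_dirs (Suc (Suc (Suc 0))) space_dirs (spacetime \<Omega>) v"
  using H1 by (simp add: H1_def numeral_3_eq_3 del: Ck_dirs.simps)

lemmas v2 = Ck_dirs_spd[OF v3] and v1 = Ck_dirs_spd[OF Ck_dirs_spd[OF v3]]

lemma C1_fst_lift: "C1_family \<Omega> (\<lambda>t x. g (t, x)) \<Longrightarrow> C1_family U (\<lambda>t y. g (t, fst y))"
  by (rule C1_family_compose[of \<Omega> _ U "\<lambda>_. fst"])
    (auto simp: U_def intro: C1_family_linear bounded_linear_fst)

lemmas C1_v = spd_C1[OF v3 open_Om]
lemmas C1_vU = C1_fst_lift[OF C1_v]
lemmas C1_AU = C1_fst_lift[OF spd_C1[OF v2 open_Om]]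
lemmas C1_AAU = C1_fst_lift[OF spd_C1[OF v1 open_Om]]

lemma C1_proj: "C1_family U (\<lambda>t y. fst (snd y))" "C1_family U (\<lambda>t y. snd (snd y))" "C1_family U (\<lambda>t y. snd (snd y) $ j)"
  by (intro C1_family_linear bounded_linear_fst_comp bounded_linear_snd_comp bounded_linear_snd bounded_linear_compose[OF bounded_linear_vec_nth])+

lemmas C1_scaleR = C1_family_bilinear[OF bounded_bilinear_scaleR]
lemmas C1_mult = C1_family_bilinear[OF bounded_bilinear_mult]
lemmas C1_inner = C1_family_bilinear[OF bounded_bilinear_inner]

lemma C1_Dv: "C1_family U (\<lambda>t y. Dv t (fst y) (snd (snd y)))"
  unfolding Dv_def by (intro C1_family_sum C1_scaleR C1_proj C1_AU)

lemma C1_DvT: "C1_family U (\<lambda>t y. DvT t (fst y) (snd (snd y)))"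
  unfolding DvT_def by (intro C1_family_sum C1_scaleR C1_inner C1_proj C1_AU C1_family_const)

lemma C1_DDv: "C1_family U (\<lambda>t y. DDv t (fst y) w (snd (snd y)))"
  unfolding DDv_def by (intro C1_family_sum C1_scaleR C1_proj C1_AAU C1_family_const)

lemma C1_inv: "C1_family U (\<lambda>t y. inverse (snd (snd y) \<bullet> snd (snd y)))"
  by (intro C1_family_inverse C1_inner C1_proj) (auto simp: U_def)

lemma C1_R: "C1_family U (\<lambda>t y. R t (fst y) (snd (snd y)))"
  unfolding R_def divide_inverse by (intro C1_mult C1_inner C1_proj C1_Dv C1_inv)

lemma C1_Rp: "C1_family U (\<lambda>t y. Rp t (fst y) (snd (snd y)))"
  unfolding Rp_def
  by (intro C1_scaleR C1_family_diff C1_family_add C1_inv C1_Dv C1_DvT C1_mult C1_R C1_proj C1_family_const)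

lemma C1_Rx: "C1_family U (\<lambda>t y. Rx t (fst y) (snd (snd y)))"
  unfolding Rx_def
  by (intro C1_scaleR C1_family_sum C1_inv C1_DDv C1_inner C1_proj C1_family_const)

lemma C1_field: "C1_family U field"
  unfolding field_def[abs_def] Let_def
  by (intro C1_family_Pair C1_family_diff C1_family_add C1_scaleR C1_mult C1_vU C1_Rp C1_R C1_Rx C1_DvT C1_proj)

sublocale ch: c1_ode field "C1_deriv U field" U
  by (rule c1_ode_C1_family[OF open_U C1_field])

sublocale vo: c1_ode "\<lambda>t x. v (t, x)" "C1_deriv \<Omega> (\<lambda>t x. v (t, x))" \<Omega>
  by (rule c1_ode_C1_family[OF open_Om C1_v])

lemma DvT_inner: "DvT t x p \<bullet> w = p \<bullet> Dv t x w"
  by (simp add: DvT_def Dv_def inner_sum_left inner_sum_right inner_axis' inner_axis inner_commute mult.commute)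

lemma Dv_linear: "linear (Dv t x)"
  by (rule linearI) (simp_all add: Dv_def sum.distrib scaleR_add_left scaleR_sum_right)

text \<open>Euler's identity for a function homogeneous of degree \<open>0\<close>. It makes
  \<open>p \<bullet> x'\<close> equal to \<open>p \<bullet> v\<close> on every
  characteristic.\<close>

lemma Rp_inner:
  assumes "p \<noteq> 0"
  shows "p \<bullet> Rp t x p = 0"
  using assms DvT_inner[of t x p p] by (simp add: Rp_def R_def inner_add_right inner_diff_right inner_commute[of p "DvT t x p"])

lemma Rx_inner: "Rx t x p \<bullet> w = (p \<bullet> DDv t x w p) / (p \<bullet> p)"
proof -
  have 1: "p \<bullet> DDv t x w p = (\<Sum>j\<in>UNIV. \<Sum>k\<in>UNIV. p $ j * (w $ k * (p \<bullet> AA k j t x)))" for w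
    by (simp add: DDv_def inner_sum_right sum_distrib_left)
  have 2: "p \<bullet> DDv t x (axis k 1) p = (\<Sum>j\<in>UNIV. p $ j * (p \<bullet> AA k j t x))" for k
    unfolding 1 by (simp add: axis_def if_distrib if_distribR cong: if_cong)
  have "(\<Sum>k\<in>UNIV. (p \<bullet> DDv t x (axis k 1) p) * w $ k) = p \<bullet> DDv t x w p"
    unfolding 2 1[of w] by (subst sum.swap) (simp add: sum_distrib_right sum_distrib_left mult_ac)
  then show ?thesis
    by (simp add: Rx_def inner_sum_left inner_axis' divide_inverse mult.commute)
qed

lemma v_has_derivative: "0 \<le> t \<Longrightarrow> x \<in> \<Omega> \<Longrightarrow> ((\<lambda>x. v (t, x)) has_derivative Dv t x) (at x)"
  using spd_has_derivative[OF v3 open_Om, of t x] by (simp add: Dv_def[abs_def])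

lemma fst_chain:
  assumes "(f has_derivative F) (at (fst y))"
  shows "((\<lambda>y. f (fst y)) has_derivative (\<lambda>h. F (fst h))) (at y)"
  using has_derivative_compose[OF bounded_linear_imp_has_derivative[OF bounded_linear_fst] assms] by simp

lemma Dv_has_derivative:
  assumes "0 \<le> t" "y \<in> U"
  shows "((\<lambda>y. Dv t (fst y) (snd (snd y))) has_derivative
    (\<lambda>h. Dv t (fst y) (snd (snd h)) + DDv t (fst y) (fst h) (snd (snd y)))) (at y)"
proof -
  have x: "fst y \<in> \<Omega>" using assms by (auto simp: U_def)
  have "((\<lambda>y. Dv t (fst y) (snd (snd y))) has_derivative
    (\<lambda>h. \<Sum>j\<in>UNIV. snd (snd y) $ j *\<^sub>R (\<Sum>k\<in>UNIV. fst h $ k *\<^sub>R AA k j t (fst y)) + snd (snd h) $ j *\<^sub>R A j t (fst y))) (at y)"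
    unfolding Dv_def
    by (intro has_derivative_sum has_derivative_scaleR fst_chain[OF spd_has_derivative[OF v2 open_Om assms(1) x]]
        bounded_linear_imp_has_derivative bounded_linear_compose[OF bounded_linear_vec_nth]
        bounded_linear_snd_comp bounded_linear_snd)
  then show ?thesis by (simp add: Dv_def DDv_def sum.distrib add.commute)
qed

lemma R_has_derivative:
  assumes "0 \<le> t" "y \<in> U"
  shows "((\<lambda>y. R t (fst y) (snd (snd y))) has_derivative
    (\<lambda>h. Rx t (fst y) (snd (snd y)) \<bullet> fst h + Rp t (fst y) (snd (snd y)) \<bullet> snd (snd h))) (at y)"
proof -
  let ?x = "fst y" and ?p = "snd (snd y)"
  have p: "?p \<bullet> ?p \<noteq> 0" using assms by (auto simp: U_def)
  have dp: "((\<lambda>y. snd (snd y)) has_derivative (\<lambda>h. snd (snd h))) (at y)"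
    by (intro bounded_linear_imp_has_derivative bounded_linear_snd_comp bounded_linear_snd)
  have d: "((\<lambda>y. R t (fst y) (snd (snd y))) has_derivative
    (\<lambda>h. ((?p \<bullet> (Dv t ?x (snd (snd h)) + DDv t ?x (fst h) ?p) + snd (snd h) \<bullet> Dv t ?x ?p) * (?p \<bullet> ?p)
        - (?p \<bullet> Dv t ?x ?p) * (?p \<bullet> snd (snd h) + snd (snd h) \<bullet> ?p)) / ((?p \<bullet> ?p) * (?p \<bullet> ?p)))) (at y)"
    unfolding R_def
    by (rule has_derivative_divide'[OF has_derivative_inner[OF dp Dv_has_derivative[OF assms]] has_derivative_inner[OF dp dp] p])
  have eq: "((?p \<bullet> (Dv t ?x (snd (snd h)) + DDv t ?x (fst h) ?p) + snd (snd h) \<bullet> Dv t ?x ?p) * (?p \<bullet> ?p)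
        - (?p \<bullet> Dv t ?x ?p) * (?p \<bullet> snd (snd h) + snd (snd h) \<bullet> ?p)) / ((?p \<bullet> ?p) * (?p \<bullet> ?p))
      = Rx t ?x ?p \<bullet> fst h + Rp t ?x ?p \<bullet> snd (snd h)" for h
  proof -
    have "Rp t ?x ?p \<bullet> snd (snd h) = (Dv t ?x ?p \<bullet> snd (snd h) + ?p \<bullet> Dv t ?x (snd (snd h))
        - 2 * ((?p \<bullet> Dv t ?x ?p) / (?p \<bullet> ?p)) * (?p \<bullet> snd (snd h))) / (?p \<bullet> ?p)"
      by (simp add: Rp_def R_def inner_diff_left inner_add_left DvT_inner divide_inverse mult.commute)
    then show ?thesis
      using p by (simp add: Rx_inner inner_add_right inner_commute[of "snd (snd h)"] divide_simps) (simp add: algebra_simps)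
  qed
  show ?thesis by (rule has_derivative_eq_rhs[OF d]) (rule ext, rule eq)
qed

text \<open>None of these components of the linearised system contains a derivative of
  \<open>Rp\<close>. It drops out of the second because \<open>p \<bullet> Rp\<close> vanishes
  identically, so that the identity \<open>p \<bullet> x' = p \<bullet> v\<close> can be
  differentiated instead, and out of the third because it carries the factor
  \<open>\<phi> = 0\<close>.\<close>

lemma
  fixes x p dx dp :: "real^3" and \<phi> d\<phi> :: real
  assumes t: "0 \<le> t" and y: "(x, \<phi>, p) \<in> U"
  defines "D \<equiv> blinfun_apply (C1_deriv U field t (x, \<phi>, p)) (dx, d\<phi>, dp)"
  shows field_deriv_phi: "fst (snd D) = R t x p * d\<phi> + \<phi> * (Rx t x p \<bullet> dx + Rp t x p \<bullet> dp)"
    and field_deriv_px: "p \<bullet> fst D = p \<bullet> Dv t x dx + \<phi> * (Rp t x p \<bullet> dp)"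
    and field_deriv_x: "\<phi> = 0 \<Longrightarrow> fst D = Dv t x dx - d\<phi> *\<^sub>R Rp t x p"
proof -
  let ?y = "(x, \<phi>, p)" and ?D = "blinfun_apply (C1_deriv U field t (x, \<phi>, p))"
  have x: "x \<in> \<Omega>" and p: "p \<noteq> 0" using y by (auto simp: U_def)
  have dF: "(field t has_derivative ?D) (at ?y)" by (rule C1_deriv(1)[OF C1_field t y])
  have dx: "((\<lambda>y. fst (field t y)) has_derivative (\<lambda>h. fst (?D h))) (at ?y)"
    and d\<phi>: "((\<lambda>y. fst (snd (field t y))) has_derivative (\<lambda>h. fst (snd (?D h)))) (at ?y)"
    using has_derivative_compose[OF dF bounded_linear_imp_has_derivative[OF bounded_linear_fst]]
      has_derivative_compose[OF dF bounded_linear_imp_has_derivative[OF bounded_linear_fst_comp[OF bounded_linear_snd]]]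
    by auto
  have p\<phi>: "((\<lambda>y::(real^3) \<times> real \<times> (real^3). fst (snd y)) has_derivative (\<lambda>h. fst (snd h))) (at ?y)"
    and pp: "((\<lambda>y::(real^3) \<times> real \<times> (real^3). snd (snd y)) has_derivative (\<lambda>h. snd (snd h))) (at ?y)"
    by (intro bounded_linear_imp_has_derivative bounded_linear_snd_comp bounded_linear_fst_comp bounded_linear_snd)+
  have dv: "((\<lambda>y::(real^3) \<times> real \<times> (real^3). v (t, fst y)) has_derivative (\<lambda>h. Dv t x (fst h))) (at ?y)"
    using fst_chain[of "\<lambda>x. v (t, x)" "Dv t x" ?y] v_has_derivative[OF t x] by simp
  have "((\<lambda>y. fst (snd (field t y))) has_derivative
      (\<lambda>h. \<phi> * (Rx t x p \<bullet> fst h + Rp t x p \<bullet> snd (snd h)) + fst (snd h) * R t x p)) (at ?y)"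
    using has_derivative_mult[OF p\<phi> R_has_derivative[OF t y]] by (simp add: field_def Let_def)
  from fun_cong[OF has_derivative_unique[OF d\<phi> this], of "(dx, d\<phi>, dp)"]
  show "fst (snd D) = R t x p * d\<phi> + \<phi> * (Rx t x p \<bullet> dx + Rp t x p \<bullet> dp)"
    by (simp add: D_def)
  have m1: "((\<lambda>y. snd (snd y) \<bullet> fst (field t y)) has_derivative (\<lambda>h. p \<bullet> fst (?D h) + snd (snd h) \<bullet> fst (field t ?y))) (at ?y)"
    using has_derivative_inner[OF pp dx] by simp
  have m2: "((\<lambda>y. snd (snd y) \<bullet> fst (field t y)) has_derivative (\<lambda>h. p \<bullet> Dv t x (fst h) + snd (snd h) \<bullet> v (t, x))) (at ?y)"
  proof (rule has_derivative_transform_within_open[OF _ open_U y])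
    show "((\<lambda>y::(real^3) \<times> real \<times> (real^3). snd (snd y) \<bullet> v (t, fst y)) has_derivative
        (\<lambda>h. p \<bullet> Dv t x (fst h) + snd (snd h) \<bullet> v (t, x))) (at ?y)"
      using has_derivative_inner[OF pp dv] by simp
    show "snd (snd z) \<bullet> v (t, fst z) = snd (snd z) \<bullet> fst (field t z)" if "z \<in> U" for z
      using that Rp_inner[of "snd (snd z)"] by (auto simp: field_def Let_def U_def inner_diff_right)
  qed
  have "p \<bullet> fst (?D h) + snd (snd h) \<bullet> fst (field t ?y) = p \<bullet> Dv t x (fst h) + snd (snd h) \<bullet> v (t, x)" for h
    using fun_cong[OF has_derivative_unique[OF m1 m2], of h] .
  from this[of "(dx, d\<phi>, dp)"]
  show "p \<bullet> fst D = p \<bullet> Dv t x dx + \<phi> * (Rp t x p \<bullet> dp)"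
    by (simp add: D_def field_def inner_diff_right inner_commute)
  show "fst D = Dv t x dx - d\<phi> *\<^sub>R Rp t x p" if "\<phi> = 0"
  proof -
    have "((\<lambda>y. fst (field t y)) has_derivative (\<lambda>h. Dv t x (fst h) -
        (\<phi> *\<^sub>R C1_deriv U (\<lambda>t y. Rp t (fst y) (snd (snd y))) t ?y h + fst (snd h) *\<^sub>R Rp t x p))) (at ?y)"
      using has_derivative_diff[OF dv has_derivative_scaleR[OF p\<phi> C1_deriv(1)[OF C1_Rp t y]]]
      by (simp add: field_def Let_def)
    from fun_cong[OF has_derivative_unique[OF dx this], of "(dx, d\<phi>, dp)"] show ?thesis
      by (simp add: D_def that)
  qed
qed

end

context c1_ode
begin

lemma flow_continuous_time:
  assumes "(t, \<eta>) \<in> dom"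
  shows "continuous_on {0..t} (\<lambda>s. flow s \<eta>)"
proof (rule continuous_on_vector_derivative[of _ _ "\<lambda>s. f s (flow s \<eta>)"])
  fix s assume "s \<in> {0..t}"
  then have "(s, \<eta>) \<in> dom" using dom_down[OF assms] by simp
  from flow_deriv[OF this]
  show "((\<lambda>s. flow s \<eta>) has_vector_derivative f s (flow s \<eta>)) (at s within {0..t})"
    by (rule has_vector_derivative_within_subset) simp
qed

lemma flow_at:
  assumes "(t, \<eta>) \<in> dom" "0 < s" "s < t"
  shows "((\<lambda>s. flow s \<eta>) has_vector_derivative f s (flow s \<eta>)) (at s)"
proof -
  have "at s within {0..} = at s" by (rule at_within_interior) (use assms in \<open>simp add: interior_real_atLeast\<close>)
  then show ?thesis using flow_deriv[OF dom_down[OF assms(1), of s]] assms by simp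
qed

lemma along_flow_continuous:
  assumes "continuous_on ({0..} \<times> U) (\<lambda>(t, y). g t y)" and "(t, \<eta>) \<in> dom"
  shows "continuous_on {0..t} (\<lambda>s. g s (flow s \<eta>))"
proof -
  have "continuous_on {0..t} (\<lambda>s. (s, flow s \<eta>))"
    by (intro continuous_on_Pair continuous_on_id flow_continuous_time assms)
  from continuous_on_compose2[OF assms(1) this] show ?thesis
    using flow_in[OF dom_down[OF assms(2)]] by force
qed

end

lemma continuous_on_Icc_bounded:
  fixes g :: "real \<Rightarrow> 'a::real_normed_vector"
  assumes "continuous_on {a..b} g"
  obtains M where "0 < M" "\<And>s. s \<in> {a..b} \<Longrightarrow> norm (g s) \<le> M"
proof -
  have "compact (g ` {a..b})" by (intro compact_continuous_image assms) simp
  then show thesis using that by (force dest!: compact_imp_bounded simp: bounded_pos)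
qed

context level_set_problem
begin

lemma Dv_bound: "norm (Dv t x w) \<le> (\<Sum>j\<in>UNIV. norm (A j t x)) * norm w"
proof -
  have "norm (Dv t x w) \<le> (\<Sum>j\<in>UNIV. norm (A j t x) * norm w)" unfolding Dv_def
    by (intro sum_norm_le) (simp add: mult.commute mult_right_mono component_le_norm_cart)
  then show ?thesis by (simp add: sum_distrib_right)
qed

lemma DvT_bound: "norm (DvT t x w) \<le> (\<Sum>j\<in>UNIV. norm (A j t x)) * norm w"
proof -
  have "norm (DvT t x w) \<le> (\<Sum>j\<in>UNIV. norm (A j t x) * norm w)" unfolding DvT_def
    by (intro sum_norm_le) (simp add: Cauchy_Schwarz_ineq2)
  then show ?thesis by (simp add: sum_distrib_right)
qed

lemma variation_deriv:
  assumes dom: "(t, \<eta>) \<in> ch.dom" and s: "0 < s" "s < t"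
  shows "((\<lambda>s. blinfun_apply (ch.Dflow s \<eta>) d) has_vector_derivative
      blinfun_apply (C1_deriv U field s (ch.flow s \<eta>)) (blinfun_apply (ch.Dflow s \<eta>) d)) (at s)"
  using bounded_linear.has_vector_derivative[OF blinfun.bounded_linear_left ch.Dflow_at[OF dom s]] by simp

lemma variation_continuous:
  assumes dom: "(t, \<eta>) \<in> ch.dom"
  shows "continuous_on {0..t} (\<lambda>s. blinfun_apply (ch.Dflow s \<eta>) d)"
  by (intro continuous_intros ch.Dflow_continuous_time dom)

lemma R_bounded_along_flow:
  assumes dom: "(t, \<eta>) \<in> ch.dom"
  obtains M where "\<And>s. s \<in> {0..t} \<Longrightarrow> \<bar>R s (fst (ch.flow s \<eta>)) (snd (snd (ch.flow s \<eta>)))\<bar> \<le> M"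
  using continuous_on_Icc_bounded[OF ch.along_flow_continuous[OF C1_family_continuous[OF C1_R] dom]]
  by (metis real_norm_def)

text \<open>The differential of the \<open>\<phi>\<close>-component is the \<open>p\<close>-component applied to the differential of the
  \<open>x\<close>-component: the defect satisfies a homogeneous linear equation and vanishes initially.\<close>

lemma strip_condition:
  assumes dom: "(t, (x0, c0, p0)) \<in> ch.dom"
  shows "fst (snd (blinfun_apply (ch.Dflow t (x0, c0, p0)) (w, p0 \<bullet> w, c))) =
    snd (snd (ch.flow t (x0, c0, p0))) \<bullet> fst (blinfun_apply (ch.Dflow t (x0, c0, p0)) (w, p0 \<bullet> w, c))"
proof -
  let ?\<eta> = "(x0, c0, p0)"
  let ?y = "\<lambda>s. ch.flow s ?\<eta>" and ?Z = "\<lambda>s. blinfun_apply (ch.Dflow s ?\<eta>) (w, p0 \<bullet> w, c)"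
  let ?R = "\<lambda>s. R s (fst (?y s)) (snd (snd (?y s)))"
  let ?e = "\<lambda>s. fst (snd (?Z s)) - snd (snd (?y s)) \<bullet> fst (?Z s)"
  have t: "0 \<le> t" using ch.dom_nonneg[OF dom] .
  obtain M where M: "\<And>s. s \<in> {0..t} \<Longrightarrow> \<bar>?R s\<bar> \<le> M" using R_bounded_along_flow[OF dom] by blast
  have "?e t = 0"
  proof (rule gronwall_zero[where e = ?e and s = 0 and T = t and L = M and e' = "\<lambda>s. ?R s * ?e s"])
    show "continuous_on {0..t} ?e"
      by (intro continuous_intros variation_continuous[OF dom] ch.flow_continuous_time[OF dom])
    fix s assume s: "0 < s" "s < t"
    obtain x \<phi> p where y: "?y s = (x, \<phi>, p)" by (metis prod.collapse)
    obtain dx d\<phi> dp where Z: "?Z s = (dx, d\<phi>, dp)" by (metis prod.collapse)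
    have yU: "(x, \<phi>, p) \<in> U" using ch.flow_in[OF ch.dom_down[OF dom, of s]] s y by simp
    let ?D = "blinfun_apply (C1_deriv U field s (x, \<phi>, p)) (dx, d\<phi>, dp)"
    have dZ: "(?Z has_vector_derivative ?D) (at s)" using variation_deriv[OF dom s, of "(w, p0 \<bullet> w, c)"] unfolding y Z .
    have dy: "(?y has_vector_derivative field s (x, \<phi>, p)) (at s)" using ch.flow_at[OF dom s] unfolding y .
    have 1: "((\<lambda>s. fst (snd (?Z s))) has_vector_derivative fst (snd ?D)) (at s)"
      by (rule bounded_linear.has_vector_derivative[OF bounded_linear_fst_comp[OF bounded_linear_snd] dZ])
    have 2: "((\<lambda>s. fst (?Z s)) has_vector_derivative fst ?D) (at s)"
      by (rule bounded_linear.has_vector_derivative[OF bounded_linear_fst dZ])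
    have 3: "((\<lambda>s. snd (snd (?y s))) has_vector_derivative snd (snd (field s (x, \<phi>, p)))) (at s)"
      by (rule bounded_linear.has_vector_derivative[OF bounded_linear_snd_comp[OF bounded_linear_snd] dy])
    have "(?e has_vector_derivative fst (snd ?D) - (p \<bullet> fst ?D + snd (snd (field s (x, \<phi>, p))) \<bullet> dx)) (at s)"
      using has_vector_derivative_diff[OF 1 bounded_bilinear.has_vector_derivative[OF bounded_bilinear_inner 3 2]]
      by (simp add: y Z)
    moreover have "fst (snd ?D) - (p \<bullet> fst ?D + snd (snd (field s (x, \<phi>, p))) \<bullet> dx) = ?R s * ?e s"
      unfolding field_deriv_phi[OF less_imp_le[OF s(1)] yU] field_deriv_px[OF less_imp_le[OF s(1)] yU] y Z
      by (simp add: field_def inner_diff_left inner_add_left DvT_inner algebra_simps)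
    ultimately show "(?e has_vector_derivative ?R s * ?e s) (at s)" by simp
    show "norm (?R s * ?e s) \<le> M * norm (?e s)"
      using M[of s] s by (auto simp: abs_mult intro!: mult_right_mono)
  qed (use t ch.flow_0[OF dom] ch.Dflow_0[OF dom] in auto)
  then show ?thesis by simp
qed

text \<open>\<open>\<phi>\<close> solves the linear equation \<open>\<phi>' = R \<phi>\<close> along
  a characteristic. Both directions of time are used: the zero set at time \<open>t\<close> has to
  come exactly from \<open>\<Sigma>0\<close>.\<close>

lemma phi_zero_propagates:
  assumes dom: "(t, \<eta>) \<in> ch.dom" and s: "s \<in> {0..t}" "fst (snd (ch.flow s \<eta>)) = 0" and r: "r \<in> {0..t}"
  shows "fst (snd (ch.flow r \<eta>)) = 0"
proof -
  let ?y = "\<lambda>s. ch.flow s \<eta>"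
  let ?R = "\<lambda>s. R s (fst (?y s)) (snd (snd (?y s)))"
  obtain M where M: "\<And>s. s \<in> {0..t} \<Longrightarrow> \<bar>?R s\<bar> \<le> M" using R_bounded_along_flow[OF dom] by blast
  show ?thesis
  proof (rule gronwall_zero[where e = "\<lambda>s. fst (snd (?y s))" and s = s and T = t and L = M
        and e' = "\<lambda>s. fst (snd (?y s)) * ?R s"])
    show "continuous_on {0..t} (\<lambda>s. fst (snd (?y s)))"
      by (intro continuous_intros ch.flow_continuous_time[OF dom])
    fix s assume s: "0 < s" "s < t"
    show "((\<lambda>s. fst (snd (?y s))) has_vector_derivative fst (snd (?y s)) * ?R s) (at s)"
      using bounded_linear.has_vector_derivative[OF bounded_linear_fst_comp[OF bounded_linear_snd] ch.flow_at[OF dom s]]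
      unfolding field_def Let_def by simp
    show "norm (fst (snd (?y s)) * ?R s) \<le> M * norm (fst (snd (?y s)))"
      using M[of s] s by (auto simp: abs_mult mult.commute[of M] intro!: mult_left_mono)
  qed (use s r in auto)
qed

lemma A_along_flow_bounded:
  assumes dom: "(t, \<eta>) \<in> ch.dom"
  obtains M where "\<And>s. s \<in> {0..t} \<Longrightarrow> (\<Sum>j\<in>UNIV. norm (A j s (fst (ch.flow s \<eta>)))) \<le> M"
proof -
  have "continuous_on {0..t} (\<lambda>s. \<Sum>j\<in>UNIV. norm (A j s (fst (ch.flow s \<eta>))))"
    by (intro continuous_on_sum continuous_on_norm ch.along_flow_continuous[OF C1_family_continuous[OF C1_AU] dom])
  from continuous_on_Icc_bounded[OF this] obtain M
    where M: "\<And>s. s \<in> {0..t} \<Longrightarrow> norm (\<Sum>j\<in>UNIV. norm (A j s (fst (ch.flow s \<eta>)))) \<le> M" by blast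
  show thesis by (rule that[of M]) (use M in \<open>fastforce simp: abs_le_iff\<close>)
qed

lemma spatial_variation_injective:
  assumes dom: "(t, (x0, 0, p0)) \<in> ch.dom"
    and zero: "fst (blinfun_apply (ch.Dflow t (x0, 0, p0)) (w, p0 \<bullet> w, c)) = 0"
  shows "w = 0"
proof -
  let ?\<eta> = "(x0, 0 :: real, p0)"
  let ?y = "\<lambda>s. ch.flow s ?\<eta>" and ?Z = "\<lambda>s. blinfun_apply (ch.Dflow s ?\<eta>) (w, p0 \<bullet> w, c)"
  let ?R = "\<lambda>s. R s (fst (?y s)) (snd (snd (?y s)))"
  have t: "0 \<le> t" using ch.dom_nonneg[OF dom] .
  have \<phi>: "fst (snd (?y s)) = 0" if "s \<in> {0..t}" for s
    using phi_zero_propagates[OF dom, of 0 s] that ch.flow_0[OF dom] by simp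
  obtain M where M: "\<And>s. s \<in> {0..t} \<Longrightarrow> \<bar>?R s\<bar> \<le> M" using R_bounded_along_flow[OF dom] by blast
  \<comment> \<open>As \<open>\<phi> = 0\<close>, the variation of \<open>\<phi>\<close> decouples
    from those of \<open>x\<close> and \<open>p\<close>: its derivative is \<open>R\<close> times
    itself. It vanishes at time \<open>t\<close> by the strip condition.\<close>
  have b: "fst (snd (?Z r)) = 0" if r: "r \<in> {0..t}" for r
  proof (rule gronwall_zero[where e = "\<lambda>s. fst (snd (?Z s))" and s = t and T = t and L = M
        and e' = "\<lambda>s. ?R s * fst (snd (?Z s))"])
    show "continuous_on {0..t} (\<lambda>s. fst (snd (?Z s)))"
      by (intro continuous_intros variation_continuous[OF dom])
    show "fst (snd (?Z t)) = 0" using strip_condition[OF dom, of w c] zero by simp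
    fix s assume s: "0 < s" "s < t"
    obtain x p where y: "?y s = (x, 0, p)" using \<phi>[of s] s by (metis atLeastAtMost_iff less_imp_le prod.collapse)
    obtain dx d\<phi> dp where Z: "?Z s = (dx, d\<phi>, dp)" by (metis prod.collapse)
    have yU: "(x, 0, p) \<in> U" using ch.flow_in[OF ch.dom_down[OF dom, of s]] s y by simp
    have "((\<lambda>s. fst (snd (?Z s))) has_vector_derivative
        fst (snd (blinfun_apply (C1_deriv U field s (x, 0, p)) (dx, d\<phi>, dp)))) (at s)"
      using bounded_linear.has_vector_derivative[OF bounded_linear_fst_comp[OF bounded_linear_snd]
          variation_deriv[OF dom s, of "(w, p0 \<bullet> w, c)"]] unfolding y Z .
    then show "((\<lambda>s. fst (snd (?Z s))) has_vector_derivative ?R s * fst (snd (?Z s))) (at s)"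
      unfolding field_deriv_phi[OF less_imp_le[OF s(1)] yU] y Z by simp
    show "norm (?R s * fst (snd (?Z s))) \<le> M * norm (fst (snd (?Z s)))"
      using M[of s] s by (auto simp: abs_mult intro!: mult_right_mono)
  qed (use t r in auto)
  obtain L where L: "\<And>s. s \<in> {0..t} \<Longrightarrow> (\<Sum>j\<in>UNIV. norm (A j s (fst (?y s)))) \<le> L"
    using A_along_flow_bounded[OF dom] by blast
  have "fst (?Z 0) = 0"
  proof (rule gronwall_zero[where e = "\<lambda>s. fst (?Z s)" and s = t and T = t and L = L
        and e' = "\<lambda>s. Dv s (fst (?y s)) (fst (?Z s))"])
    show "continuous_on {0..t} (\<lambda>s. fst (?Z s))"
      by (intro continuous_intros variation_continuous[OF dom])
    fix s assume s: "0 < s" "s < t"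
    obtain x p where y: "?y s = (x, 0, p)" using \<phi>[of s] s by (metis atLeastAtMost_iff less_imp_le prod.collapse)
    obtain dx dp where Z: "?Z s = (dx, 0, dp)" using b[of s] s by (metis atLeastAtMost_iff less_imp_le prod.collapse)
    have yU: "(x, 0, p) \<in> U" using ch.flow_in[OF ch.dom_down[OF dom, of s]] s y by simp
    have "((\<lambda>s. fst (?Z s)) has_vector_derivative
        fst (blinfun_apply (C1_deriv U field s (x, 0, p)) (dx, 0, dp))) (at s)"
      using bounded_linear.has_vector_derivative[OF bounded_linear_fst
          variation_deriv[OF dom s, of "(w, p0 \<bullet> w, c)"]] unfolding y Z .
    then show "((\<lambda>s. fst (?Z s)) has_vector_derivative Dv s (fst (?y s)) (fst (?Z s))) (at s)"
      unfolding field_deriv_x[OF less_imp_le[OF s(1)] yU refl] y Z by simp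
    show "norm (Dv s (fst (?y s)) (fst (?Z s))) \<le> L * norm (fst (?Z s))"
      using L[of s] s by (intro order_trans[OF Dv_bound] mult_right_mono) auto
  qed (use t zero in auto)
  then show ?thesis using ch.Dflow_0[OF dom] by simp
qed

text \<open>The 1-jet of \<open>\<phi>0\<close>. Its tangent vectors have the form
  \<open>(w, p0 \<bullet> w, c)\<close> required by the strip condition.\<close>

definition eta :: "real^3 \<Rightarrow> (real^3) \<times> real \<times> (real^3)" where
  "eta \<xi> = (\<xi>, \<phi>0 \<xi>, grad \<Omega> \<phi>0 \<xi>)"

lemma C1_eta: "C1_family \<Omega> (\<lambda>_. eta)"
proof -
  have "C1_family \<Omega> (\<lambda>_. \<phi>0)"
    by (rule Ck_on_C1(2)[of 1]) (use C2_phi0 open_Om in \<open>simp_all add: numeral_2_eq_2\<close>)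
  then show ?thesis
    unfolding eta_def[abs_def]
    by (intro C1_family_Pair C1_grad C2_phi0 open_Om) (auto intro: C1_family_linear bounded_linear_ident)
qed

lemma X_solves:
  assumes "\<xi> \<in> \<Omega>"
  shows "X 0 0 \<xi> = \<xi>" "vo.solves (\<lambda>s. X s 0 \<xi>) T"
proof -
  have "\<xi> \<in> closure \<Omega>" using assms closure_subset by auto
  then have *: "X 0 0 \<xi> = \<xi>" "\<And>s. 0 \<le> s \<Longrightarrow> ((\<lambda>r. X r 0 \<xi>) has_vector_derivative v (s, X s 0 \<xi>)) (at s within {0..})"
    using flow_X by (auto simp: is_flow_def)
  show "X 0 0 \<xi> = \<xi>" by (rule *)
  show "vo.solves (\<lambda>s. X s 0 \<xi>) T" unfolding vo.solves_def
    using flow_stays_inside[OF open_Om H1 H2 flow_X assms]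
    by (auto intro: has_vector_derivative_within_subset[OF *(2)])
qed

text \<open>Uniqueness backwards in time, with a Lipschitz constant of \<open>v\<close> on the union
  of the two compact trajectories, which lie in the open set \<open>\<Omega>\<close>.\<close>

lemma X_injective:
  assumes \<xi>: "\<xi>1 \<in> \<Omega>" "\<xi>2 \<in> \<Omega>" and t: "0 \<le> t" and eq: "X t 0 \<xi>1 = X t 0 \<xi>2"
  shows "\<xi>1 = \<xi>2"
proof -
  let ?y = "\<lambda>s. X s 0 \<xi>1" and ?z = "\<lambda>s. X s 0 \<xi>2"
  have y: "vo.solves ?y t" and z: "vo.solves ?z t" using X_solves \<xi> by auto
  let ?K = "?y ` {0..t} \<union> ?z ` {0..t}"
  have "compact ?K" "?K \<subseteq> \<Omega>"
    using y z by (auto intro!: compact_Un compact_continuous_image vo.solves_continuous simp: vo.solves_def)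
  then obtain L where L: "\<And>s x y. s \<in> {0..t} \<Longrightarrow> x \<in> ?K \<Longrightarrow> y \<in> ?K \<Longrightarrow> norm (v (s, x) - v (s, y)) \<le> L * norm (x - y)"
    by (rule vo.lipschitz_on_compact[of _ t]) auto
  have "?y 0 - ?z 0 = 0"
  proof (rule gronwall_zero[where e = "\<lambda>s. ?y s - ?z s" and s = t and T = t and L = L
        and e' = "\<lambda>s. v (s, ?y s) - v (s, ?z s)"])
    show "continuous_on {0..t} (\<lambda>s. ?y s - ?z s)"
      by (intro continuous_intros vo.solves_continuous y z)
    show "((\<lambda>s. ?y s - ?z s) has_vector_derivative v (s, ?y s) - v (s, ?z s)) (at s)" if "0 < s" "s < t" for s
      by (intro has_vector_derivative_diff vo.solves_at[OF y that] vo.solves_at[OF z that])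
  qed (use eq t L in auto)
  then show ?thesis using X_solves(1) \<xi> by simp
qed

text \<open>Over \<open>\<Sigma>0\<close> the characteristics are explicit: \<open>\<phi> = 0\<close>, \<open>x\<close> follows the flow, and \<open>p\<close> is the solution
  \<open>q\<close> of the adjoint equation \<open>q' = - (\<nabla>v)\<^sup>T q\<close> rescaled to constant length. The solution \<open>r\<close> of
  \<open>r' = (\<nabla>v) r\<close> serves to show \<open>q \<noteq> 0\<close>, since \<open>q \<bullet> r\<close> is constant.\<close>

lemma characteristic_on_surface:
  assumes \<xi>: "\<xi> \<in> \<Sigma>0" and T: "0 \<le> T"
  obtains y where "y 0 = eta \<xi>" "ch.solves y T"
    "\<And>t. fst (y t) = X t 0 \<xi>" "\<And>t. t \<in> {0..T} \<Longrightarrow> norm (snd (snd (y t))) = norm (grad \<Omega> \<phi>0 \<xi>)"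
proof -
  have \<xi>O: "\<xi> \<in> \<Omega>" and \<phi>\<xi>: "\<phi>0 \<xi> = 0" using \<xi> zero_phi0 by auto
  define p0 where "p0 = grad \<Omega> \<phi>0 \<xi>"
  have p0: "p0 \<noteq> 0" using grad_ne[OF \<xi>] by (simp add: p0_def)
  define x where "x s = X s 0 \<xi>" for s
  have x: "vo.solves x T" using X_solves(2)[OF \<xi>O] by (simp add: x_def[abs_def])
  have x0: "x 0 = \<xi>" using X_solves(1)[OF \<xi>O] by (simp add: x_def)
  have xO: "x s \<in> \<Omega>" if "s \<in> {0..T}" for s using x that by (simp add: vo.solves_def)
  have "continuous_on {0..T} (\<lambda>s. (s, x s))"
    by (intro continuous_on_Pair continuous_on_id vo.solves_continuous x)
  from continuous_on_compose2[OF C1_family_continuous[OF spd_C1[OF v2 open_Om]] this]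
  have cA: "continuous_on {0..T} (\<lambda>s. A j s (x s))" for j using xO by force
  then have "continuous_on {0..T} (\<lambda>s. \<Sum>j\<in>UNIV. norm (A j s (x s)))" by (intro continuous_intros)
  from continuous_on_Icc_bounded[OF this]
  obtain M where "\<And>s. s \<in> {0..T} \<Longrightarrow> norm (\<Sum>j\<in>UNIV. norm (A j s (x s))) \<le> M" by blast
  then have M: "(\<Sum>j\<in>UNIV. norm (A j s (x s))) \<le> M" if "s \<in> {0..T}" for s
    using that by (fastforce simp: abs_le_iff)
  have cA2: "continuous_on ({0..T} \<times> UNIV) (\<lambda>p. A j (fst p) (x (fst p)))" for j
    by (rule continuous_on_compose2[OF cA]) (auto intro!: continuous_intros)
  have DvT_lin: "- DvT s z a - - DvT s z b = - DvT s z (a - b)" for s z a b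
    by (simp add: DvT_def inner_diff_right scaleR_diff_left sum_subtractf)
  obtain q where q: "q 0 = p0" "continuous_on {0..T} q"
    "\<And>s. s \<in> {0..T} \<Longrightarrow> (q has_vector_derivative - DvT s (x s) (q s)) (at s within {0..T})"
  proof (rule lipschitz_ode_exists[OF T, of "\<lambda>s q. - DvT s (x s) q" M p0])
    show "continuous_on ({0..T} \<times> UNIV) (\<lambda>(s, q). - DvT s (x s) q)"
      unfolding split_beta DvT_def by (intro continuous_intros cA2)
    show "norm (- DvT s (x s) a - - DvT s (x s) b) \<le> M * norm (a - b)" if "s \<in> {0..T}" for s a b
      unfolding DvT_lin norm_minus_cancel
      using M[OF that] by (intro order_trans[OF DvT_bound] mult_right_mono) auto
  qed blast
  obtain r where r: "r 0 = p0" "continuous_on {0..T} r"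
    "\<And>s. s \<in> {0..T} \<Longrightarrow> (r has_vector_derivative Dv s (x s) (r s)) (at s within {0..T})"
  proof (rule lipschitz_ode_exists[OF T, of "\<lambda>s r. Dv s (x s) r" M p0])
    show "continuous_on ({0..T} \<times> UNIV) (\<lambda>(s, q). Dv s (x s) q)"
      unfolding split_beta Dv_def by (intro continuous_intros cA2)
    show "norm (Dv s (x s) a - Dv s (x s) b) \<le> M * norm (a - b)" if "s \<in> {0..T}" for s a b
      unfolding linear_diff[OF Dv_linear, symmetric]
      using M[OF that] by (intro order_trans[OF Dv_bound] mult_right_mono) auto
  qed blast
  have qr: "((\<lambda>s. q s \<bullet> r s) has_vector_derivative 0) (at s within {0..T})" if "s \<in> {0..T}" for s
    using bounded_bilinear.has_vector_derivative[OF bounded_bilinear_inner q(3)[OF that] r(3)[OF that]]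
    by (simp add: DvT_inner)
  obtain c where c: "q s \<bullet> r s = c" if "s \<in> {0..T}" for s
    using has_vector_derivative_zero_constant[OF convex_closed_interval qr] by blast
  have "q s \<bullet> r s = p0 \<bullet> p0" if "s \<in> {0..T}" for s using c[OF that] c[of 0] T q(1) r(1) by simp
  then have q_ne: "q s \<noteq> 0" if "s \<in> {0..T}" for s using p0 that by force
  define p where "p s = (norm p0 / norm (q s)) *\<^sub>R q s" for s
  define y where "y s = (x s, 0 :: real, p s)" for s
  have norm_p: "norm (p s) = norm p0" if "s \<in> {0..T}" for s using q_ne[OF that] by (simp add: p_def)
  \<comment> \<open>The derivative of the scaling factor produces exactly the term
    \<open>R p\<close>: \<open>norm q\<close> has the derivative \<open>- R * norm q\<close>, and
    \<open>R\<close> takes the same value at \<open>q\<close> and at its multiple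
    \<open>p\<close>.\<close>
  have dp: "(p has_vector_derivative R s (x s) (p s) *\<^sub>R p s - DvT s (x s) (p s)) (at s within {0..T})"
    if s: "s \<in> {0..T}" for s
  proof -
    let ?q = "q s" and ?m = "norm (q s)"
    have m: "0 < ?m" using q_ne[OF s] by simp
    have dq: "(q has_derivative (\<lambda>h. h *\<^sub>R - DvT s (x s) ?q)) (at s within {0..T})"
      using q(3)[OF s] by (simp add: has_vector_derivative_def)
    have "((\<lambda>s. norm (q s)) has_derivative (\<lambda>h. (h *\<^sub>R - DvT s (x s) ?q) \<bullet> sgn ?q)) (at s within {0..T})"
      using has_derivative_compose[OF dq has_derivative_norm[OF q_ne[OF s]]] by (simp add: inner_commute)
    then have dm: "((\<lambda>s. norm (q s)) has_real_derivative - (?q \<bullet> Dv s (x s) ?q) / ?m) (at s within {0..T})"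
      unfolding has_field_derivative_def
      by (rule has_derivative_eq_rhs) (simp add: fun_eq_iff sgn_div_norm DvT_inner divide_inverse mult_ac)
    have "((\<lambda>s. norm p0 / norm (q s)) has_real_derivative norm p0 * (?q \<bullet> Dv s (x s) ?q) / ?m ^ 3) (at s within {0..T})"
      using m by (auto intro!: derivative_eq_intros dm simp: power3_eq_cube field_simps)
    from has_vector_derivative_scaleR[OF this q(3)[OF s]]
    have "(p has_vector_derivative (norm p0 / ?m) *\<^sub>R - DvT s (x s) ?q +
        (norm p0 * (?q \<bullet> Dv s (x s) ?q) / ?m ^ 3) *\<^sub>R ?q) (at s within {0..T})"
      by (simp add: p_def[abs_def])
    moreover have "DvT s (x s) (p s) = (norm p0 / ?m) *\<^sub>R DvT s (x s) ?q"
      by (simp add: p_def DvT_def scaleR_sum_right)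
    moreover have "R s (x s) (p s) = (?q \<bullet> Dv s (x s) ?q) / ?m ^ 2"
      using m p0 by (simp add: p_def R_def linear_scale[OF Dv_linear] dot_square_norm power2_eq_square)
    then have "R s (x s) (p s) *\<^sub>R p s = (norm p0 * (?q \<bullet> Dv s (x s) ?q) / ?m ^ 3) *\<^sub>R ?q"
      by (simp add: p_def power3_eq_cube power2_eq_square mult_ac)
    ultimately show ?thesis by (simp add: algebra_simps)
  qed
  show thesis
  proof (rule that[of y])
    show "y 0 = eta \<xi>"
      using p0 by (simp add: y_def x0 p_def q(1) eta_def \<phi>\<xi> p0_def[symmetric])
    show "ch.solves y T" unfolding ch.solves_def
    proof (intro ballI conjI)
      fix s assume s: "s \<in> {0..T}"
      have "p s \<noteq> 0" using norm_p[OF s] p0 by auto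
      then show "y s \<in> U" using xO[OF s] by (simp add: y_def U_def)
      have dx: "(x has_vector_derivative v (s, x s)) (at s within {0..T})" using x s by (simp add: vo.solves_def)
      have "(y has_vector_derivative (v (s, x s), 0, R s (x s) (p s) *\<^sub>R p s - DvT s (x s) (p s))) (at s within {0..T})"
        unfolding y_def
        by (intro has_vector_derivative_Pair dx dp[OF s] has_vector_derivative_const)
      then show "(y has_vector_derivative field s (y s)) (at s within {0..T})"
        by (simp add: field_def Let_def y_def)
    qed
    show "fst (y t) = X t 0 \<xi>" for t by (simp add: y_def x_def)
    show "norm (snd (snd (y t))) = norm (grad \<Omega> \<phi>0 \<xi>)" if "t \<in> {0..T}" for t
      using norm_p[OF that] by (simp add: y_def p0_def)
  qed
qed

lemma
  assumes "\<xi> \<in> \<Sigma>0" "0 \<le> t"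
  shows surface_dom: "(t, eta \<xi>) \<in> ch.dom"
    and surface_flow: "fst (ch.flow t (eta \<xi>)) = X t 0 \<xi>"
    and surface_norm: "norm (snd (snd (ch.flow t (eta \<xi>)))) = norm (grad \<Omega> \<phi>0 \<xi>)"
proof -
  obtain y where y: "y 0 = eta \<xi>" "ch.solves y t"
    "\<And>t. fst (y t) = X t 0 \<xi>" "\<And>s. s \<in> {0..t} \<Longrightarrow> norm (snd (snd (y s))) = norm (grad \<Omega> \<phi>0 \<xi>)"
    using characteristic_on_surface[OF assms] by blast
  show "(t, eta \<xi>) \<in> ch.dom" "fst (ch.flow t (eta \<xi>)) = X t 0 \<xi>"
    "norm (snd (snd (ch.flow t (eta \<xi>)))) = norm (grad \<Omega> \<phi>0 \<xi>)"
    using ch.flow_eq[OF y(2), of t] assms(2) y by auto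
qed

end

lemma pderiv_on_cong:
  fixes f g :: "'a::real_normed_vector \<Rightarrow> 'b::real_normed_vector"
  assumes "\<And>q. q \<in> D \<Longrightarrow> f q = g q" and "p \<in> D"
  shows "pderiv_on D b f p = pderiv_on D b g p" "has_pderiv D b f p = has_pderiv D b g p"
proof -
  let ?S = "{s. p + s *\<^sub>R b \<in> D}"
  have 0: "0 \<in> ?S" using assms(2) by simp
  have eq: "((\<lambda>s. f (p + s *\<^sub>R b)) has_vector_derivative d) (at 0 within ?S) \<longleftrightarrow>
      ((\<lambda>s. g (p + s *\<^sub>R b)) has_vector_derivative d) (at 0 within ?S)" for d
    by (intro iffI; rule has_vector_derivative_transform[OF 0, rotated], assumption) (use assms(1) in auto)
  then show "pderiv_on D b f p = pderiv_on D b g p"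
    by (simp add: pderiv_on_def vector_derivative_def)
  have "has_pderiv D b h p \<longleftrightarrow> (\<exists>d. ((\<lambda>s. h (p + s *\<^sub>R b)) has_vector_derivative d) (at 0 within ?S))" for h :: "'a \<Rightarrow> 'b"
    unfolding has_pderiv_def by (metis differentiableI_vector vector_derivative_works)
  with eq show "has_pderiv D b f p = has_pderiv D b g p" by simp
qed

lemma Ck_dirs_cong:
  "(\<And>q. q \<in> D \<Longrightarrow> f q = g q) \<Longrightarrow> Ck_dirs k B D f = Ck_dirs k B D g"
proof (induction k arbitrary: f g)
  case 0
  then show ?case by (simp cong: continuous_on_cong)
next
  case (Suc k)
  have "Ck_dirs k B D (pderiv_on D b f) = Ck_dirs k B D (pderiv_on D b g)" for b
    by (rule Suc.IH) (rule pderiv_on_cong[OF Suc.prems])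
  moreover have "has_pderiv D b f p = has_pderiv D b g p" if "p \<in> D" for b p
    by (rule pderiv_on_cong(2)[OF Suc.prems that])
  moreover have "continuous_on D f = continuous_on D g"
    by (rule continuous_on_cong[OF refl Suc.prems])
  ultimately show ?case by simp
qed

lemma C1_const_deriv:
  assumes "C1_family S (\<lambda>_. f)"
  shows "y \<in> S \<Longrightarrow> (f has_derivative blinfun_apply (C1_deriv S (\<lambda>_. f) 0 y)) (at y)"
    and "continuous_on S (C1_deriv S (\<lambda>_. f) 0)"
proof -
  show "y \<in> S \<Longrightarrow> (f has_derivative blinfun_apply (C1_deriv S (\<lambda>_. f) 0 y)) (at y)"
    using C1_deriv(1)[OF assms, of 0 y] by simp
  have c: "continuous_on S (\<lambda>y. (0::real, y))" "(\<lambda>y. (0::real, y)) ` S \<subseteq> {0..} \<times> S"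
    by (auto intro!: continuous_intros)
  show "continuous_on S (C1_deriv S (\<lambda>_. f) 0)"
    using continuous_on_compose2[OF C1_deriv(2)[OF assms] c] by simp
qed

lemma C1_const_continuous:
  assumes "C1_family S (\<lambda>_. f)"
  shows "continuous_on S f"
  using C1_family_constE[OF assms] by blast

section \<open>The space-time map of the characteristics\<close>

context level_set_problem
begin

text \<open>Through \<open>rdom\<close> the reflected negative times are included, so that
  \<open>t = 0\<close> is an interior time.\<close>

definition W :: "(real \<times> (real^3)) set" where
  "W = {p. snd p \<in> \<Omega> \<and> (fst p, eta (snd p)) \<in> ch.rdom}"

definition Y :: "real \<times> (real^3) \<Rightarrow> (real^3) \<times> real \<times> (real^3)" where
  "Y p = ch.rflow (fst p, eta (snd p))"

definition Y' :: "real \<times> (real^3) \<Rightarrow> (real \<times> (real^3)) \<Rightarrow>\<^sub>L ((real^3) \<times> real \<times> (real^3))" where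
  "Y' = C1_deriv W (\<lambda>_. Y) 0"

lemma C1_initial: "C1_family (UNIV \<times> \<Omega>) (\<lambda>_ p. (fst p :: real, eta (snd p)))"
proof (rule C1_family_Pair)
  show "C1_family (UNIV \<times> \<Omega>) (\<lambda>_ p. fst p :: real)"
    by (rule C1_family_linear[OF bounded_linear_fst])
  show "C1_family (UNIV \<times> \<Omega>) (\<lambda>_ p. eta (snd p))"
    by (rule C1_family_compose[OF C1_eta C1_family_linear[OF bounded_linear_snd]]) auto
qed

lemma open_W: "open W"
proof -
  have "continuous_on (UNIV \<times> \<Omega>) (\<lambda>p. (fst p :: real, eta (snd p)))"
    by (rule C1_const_continuous[OF C1_initial])
  from continuous_open_preimage[OF this open_Times[OF open_UNIV open_Om] ch.open_rdom]
  have "open ((UNIV \<times> \<Omega>) \<inter> (\<lambda>p. (fst p, eta (snd p))) -` ch.rdom)" .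
  also have "(UNIV \<times> \<Omega>) \<inter> (\<lambda>p. (fst p, eta (snd p))) -` ch.rdom = W" by (auto simp: W_def)
  finally show ?thesis .
qed

lemma C1_Y: "C1_family W (\<lambda>_. Y)"
proof -
  have "C1_family W (\<lambda>_ p. (fst p :: real, eta (snd p)))"
    by (rule C1_family_subset[OF C1_initial]) (auto simp: W_def)
  from C1_family_compose[OF ch.C1_rflow this] show ?thesis by (simp add: Y_def[abs_def] W_def)
qed

lemmas Y_has_derivative = C1_const_deriv(1)[OF C1_Y, folded Y'_def]

lemma
  assumes "(t, \<xi>) \<in> W" "0 \<le> t"
  shows W_dom: "(t, eta \<xi>) \<in> ch.dom" and Y_eq: "Y (t, \<xi>) = ch.flow t (eta \<xi>)" and W_Om: "\<xi> \<in> \<Omega>"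
proof -
  show d: "(t, eta \<xi>) \<in> ch.dom" and "\<xi> \<in> \<Omega>" using assms by (auto simp: W_def ch.rdom_def)
  show "Y (t, \<xi>) = ch.flow t (eta \<xi>)" using ch.rflow_eq[OF d] by (simp add: Y_def)
qed

lemma W_I: "\<xi> \<in> \<Omega> \<Longrightarrow> (t, eta \<xi>) \<in> ch.dom \<Longrightarrow> (t, \<xi>) \<in> W"
  using ch.dom_nonneg by (fastforce simp: W_def ch.rdom_def)

lemma Y_in_U: "(t, \<xi>) \<in> W \<Longrightarrow> 0 \<le> t \<Longrightarrow> Y (t, \<xi>) \<in> U"
  using ch.flow_in[OF W_dom] Y_eq by simp

lemma surface_W: "{0..} \<times> \<Sigma>0 \<subseteq> W"
  using S0_sub surface_dom by (auto intro!: W_I)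

text \<open>\<open>c\<close> is the initial variation of \<open>p\<close> and contains the second
  derivatives of \<open>\<phi>0\<close>. It is left unspecified because the strip condition and the
  injectivity of the spatial variation hold for every \<open>c\<close>.\<close>

lemma Y'_eq:
  assumes W: "(t, \<xi>) \<in> W" and t: "0 \<le> t"
  obtains c where "Y' (t, \<xi>) (s, w) = s *\<^sub>R field t (Y (t, \<xi>)) +
    blinfun_apply (ch.Dflow t (eta \<xi>)) (w, grad \<Omega> \<phi>0 \<xi> \<bullet> w, c)"
proof -
  let ?Dg = "blinfun_apply (C1_deriv \<Omega> (\<lambda>_. grad \<Omega> \<phi>0) 0 \<xi>)"
  note \<xi> = W_Om[OF W t]
  have rd: "(t, eta \<xi>) \<in> ch.rdom" using W by (simp add: W_def)
  have "(eta has_derivative (\<lambda>w. (w, grad \<Omega> \<phi>0 \<xi> \<bullet> w, ?Dg w))) (at \<xi>)"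
    unfolding eta_def[abs_def]
    by (intro has_derivative_Pair has_derivative_ident grad_has_derivative[OF C2_phi0 open_Om \<xi>]
        C1_const_deriv(1)[OF C1_grad[OF C2_phi0 open_Om] \<xi>])
  then have "((\<lambda>p::real \<times> (real^3). eta (snd p)) has_derivative (\<lambda>h. (snd h, grad \<Omega> \<phi>0 \<xi> \<bullet> snd h, ?Dg (snd h)))) (at (t, \<xi>))"
    using has_derivative_compose[OF bounded_linear_imp_has_derivative[OF bounded_linear_snd], where x = "(t, \<xi>)"] by simp
  then have i: "((\<lambda>p. (fst p, eta (snd p))) has_derivative (\<lambda>h. (fst h, snd h, grad \<Omega> \<phi>0 \<xi> \<bullet> snd h, ?Dg (snd h)))) (at (t, \<xi>))"
    by (intro has_derivative_Pair bounded_linear_imp_has_derivative[OF bounded_linear_fst])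
  have "(Y has_derivative (\<lambda>h. fst h *\<^sub>R field \<bar>t\<bar> (ch.flow \<bar>t\<bar> (eta \<xi>)) +
      ch.rDflow t (eta \<xi>) (snd h, grad \<Omega> \<phi>0 \<xi> \<bullet> snd h, ?Dg (snd h)))) (at (t, \<xi>))"
  proof -
    have "(ch.rflow has_derivative (\<lambda>h. fst h *\<^sub>R field \<bar>t\<bar> (ch.flow \<bar>t\<bar> (eta \<xi>)) + ch.rDflow t (eta \<xi>) (snd h)))
        (at (fst (t, \<xi>), eta (snd (t, \<xi>))))"
      using ch.rflow_has_derivative[OF rd] by (simp add: case_prod_unfold)
    from has_derivative_compose[OF i this] show ?thesis by (simp add: Y_def[abs_def])
  qed
  from fun_cong[OF has_derivative_unique[OF Y_has_derivative[OF W] this], of "(s, w)"]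
  show thesis using that[of "?Dg w"] t ch.rDflow_eq[OF W_dom[OF W t]] Y_eq[OF W t] by simp
qed

text \<open>The contact form \<open>d\<phi> - p \<bullet> dx - (\<phi> R - p \<bullet> v) dt\<close>
  pulls back to zero under \<open>Y\<close>: in the time direction by the characteristic equations
  and Euler's identity, in the spatial directions by the strip condition. This is what later makes
  \<open>p\<close> the gradient.\<close>

lemma contact_condition:
  assumes W: "(t, \<xi>) \<in> W" and t: "0 \<le> t" and Y: "Y (t, \<xi>) = (x, \<phi>, p)"
  shows "fst (snd (Y' (t, \<xi>) h)) = fst h * (\<phi> * R t x p - p \<bullet> v (t, x)) + p \<bullet> fst (Y' (t, \<xi>) h)"
proof -
  obtain s w where h: "h = (s, w)" by (cases h)
  obtain c where c: "Y' (t, \<xi>) (s, w) = s *\<^sub>R field t (Y (t, \<xi>)) +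
    blinfun_apply (ch.Dflow t (eta \<xi>)) (w, grad \<Omega> \<phi>0 \<xi> \<bullet> w, c)" using Y'_eq[OF W t] by blast
  have p: "p \<noteq> 0" using Y_in_U[OF W t] by (simp add: Y U_def)
  have "(t, (\<xi>, \<phi>0 \<xi>, grad \<Omega> \<phi>0 \<xi>)) \<in> ch.dom" using W_dom[OF W t] by (simp add: eta_def)
  from strip_condition[OF this, of w c] show ?thesis
    unfolding h c using Y Y_eq[OF W t] Rp_inner[OF p]
    by (simp add: eta_def[symmetric] field_def inner_add_right inner_diff_right algebra_simps)
qed

definition G :: "real \<times> (real^3) \<Rightarrow> real \<times> (real^3)" where
  "G p = (fst p, fst (Y p))"

definition G' :: "real \<times> (real^3) \<Rightarrow> (real \<times> (real^3)) \<Rightarrow>\<^sub>L (real \<times> (real^3))" where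
  "G' = C1_deriv W (\<lambda>_. G) 0"

lemma C1_G: "C1_family W (\<lambda>_. G)"
  unfolding G_def[abs_def]
  by (intro C1_family_Pair C1_family_linear bounded_linear_fst C1_family_linear_compose[OF bounded_linear_fst C1_Y])

lemmas G_has_derivative = C1_const_deriv(1)[OF C1_G, folded G'_def]
lemmas G'_continuous = C1_const_deriv(2)[OF C1_G, folded G'_def]

lemma G'_eq:
  assumes "p \<in> W"
  shows "G' p h = (fst h, fst (Y' p h))"
proof -
  have "(G has_derivative (\<lambda>h. (fst h, fst (Y' p h)))) (at p)"
    unfolding G_def[abs_def]
    by (intro has_derivative_Pair bounded_linear_imp_has_derivative[OF bounded_linear_fst]
        has_derivative_compose[OF Y_has_derivative[OF assms] bounded_linear_imp_has_derivative[OF bounded_linear_fst]])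
  from fun_cong[OF has_derivative_unique[OF G_has_derivative[OF assms] this]] show ?thesis .
qed

lemma surface_phi_zero:
  assumes "\<xi> \<in> \<Omega>" "(t, eta \<xi>) \<in> ch.dom"
  shows "fst (snd (ch.flow t (eta \<xi>))) = 0 \<longleftrightarrow> \<xi> \<in> \<Sigma>0"
proof -
  have t: "0 \<le> t" using ch.dom_nonneg assms by blast
  have "fst (snd (ch.flow 0 (eta \<xi>))) = \<phi>0 \<xi>" using ch.flow_0[OF assms(2)] by (simp add: eta_def)
  then have "fst (snd (ch.flow t (eta \<xi>))) = 0 \<longleftrightarrow> \<phi>0 \<xi> = 0"
    using phi_zero_propagates[OF assms(2), of 0 t] phi_zero_propagates[OF assms(2), of t 0] t by auto
  then show ?thesis using zero_phi0 assms(1) by auto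
qed

lemma G_surface: "\<xi> \<in> \<Sigma>0 \<Longrightarrow> 0 \<le> t \<Longrightarrow> G (t, \<xi>) = (t, X t 0 \<xi>)"
  using surface_flow surface_W Y_eq[of t \<xi>] by (auto simp: G_def)

lemma G'_injective_on_surface:
  assumes "p \<in> {0..} \<times> \<Sigma>0"
  shows "inj (blinfun_apply (G' p))"
proof -
  obtain t \<xi> where p: "p = (t, \<xi>)" "0 \<le> t" "\<xi> \<in> \<Sigma>0" using assms by auto
  have W: "(t, \<xi>) \<in> W" using surface_W p by auto
  have \<phi>: "\<phi>0 \<xi> = 0" using p zero_phi0 by auto
  have "h = 0" if h: "G' p h = 0" for h
  proof -
    obtain w where hw: "h = (0, w)" "fst (Y' (t, \<xi>) (0, w)) = 0"
      using h G'_eq[OF W] p(1) by (cases h) (auto simp: zero_prod_def)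
    obtain c where c: "Y' (t, \<xi>) (0, w) = 0 *\<^sub>R field t (Y (t, \<xi>)) +
      blinfun_apply (ch.Dflow t (eta \<xi>)) (w, grad \<Omega> \<phi>0 \<xi> \<bullet> w, c)" using Y'_eq[OF W p(2)] by blast
    have "w = 0"
      by (rule spatial_variation_injective[of t \<xi> "grad \<Omega> \<phi>0 \<xi>" w c])
        (use W_dom[OF W p(2)] hw(2) c in \<open>simp_all add: eta_def \<phi>\<close>)
    then show ?thesis using hw by (simp add: zero_prod_def)
  qed
  then show ?thesis
    using linear_injective_0[of "blinfun_apply (G' p)"] bounded_linear.linear[OF blinfun.bounded_linear_right] by blast
qed

lemma tube_exists:
  obtains N where "open N" "{0..} \<times> \<Sigma>0 \<subseteq> N" "N \<subseteq> W" "inj_on G N"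
    "\<And>p. p \<in> N \<Longrightarrow> bij (blinfun_apply (G' p))"
    "\<And>s t \<xi>. (t, \<xi>) \<in> N \<Longrightarrow> 0 \<le> s \<Longrightarrow> s \<le> t \<Longrightarrow> (s, \<xi>) \<in> N"
proof (rule time_monotone_injective_neighbourhood[OF open_W G_has_derivative G'_continuous _ compact_S0 surface_W])
  show "inj_on G ({0..} \<times> \<Sigma>0)"
  proof (rule inj_onI)
    fix p q assume p: "p \<in> {0..} \<times> \<Sigma>0" and q: "q \<in> {0..} \<times> \<Sigma>0" and eq: "G p = G q"
    have "snd p \<in> \<Omega>" "snd q \<in> \<Omega>" using p q S0_sub by auto
    with p q eq show "p = q"
      using G_surface[of "snd p" "fst p"] G_surface[of "snd q" "fst q"] X_injective[of "snd p" "snd q" "fst p"]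
      by (auto simp: mem_Times_iff prod_eq_iff)
  qed
qed (auto simp: G_def intro: G'_injective_on_surface that)

end

section \<open>The solution on a tubular neighbourhood\<close>

text \<open>The radius is a step function, the minimum of \<open>d 0, ..., d n\<close> with
  \<open>n\<close> the least natural number not below \<open>t\<close>. Taking the minimum makes it
  nonincreasing, and the property passes to smaller radii.\<close>

lemma nonincreasing_positive_radius:
  fixes P :: "real \<Rightarrow> real \<Rightarrow> bool"
  assumes ex: "\<And>n::nat. \<exists>e>0. \<forall>t\<in>{0..real n}. P t e"
    and mono: "\<And>t e e'. P t e \<Longrightarrow> 0 < e' \<Longrightarrow> e' \<le> e \<Longrightarrow> P t e'"
  obtains \<epsilon> :: "real \<Rightarrow> real" where "\<And>t. 0 < \<epsilon> t" "\<And>s t. s \<le> t \<Longrightarrow> \<epsilon> t \<le> \<epsilon> s" "\<And>t. 0 \<le> t \<Longrightarrow> P t (\<epsilon> t)"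
proof -
  obtain d where d: "\<And>n. 0 < d n" "\<And>n t. t \<in> {0..real n} \<Longrightarrow> P t (d n)" using ex by metis
  define \<epsilon> where "\<epsilon> t = Min (d ` {..nat \<lceil>t\<rceil>})" for t :: real
  show thesis
  proof (rule that[of \<epsilon>])
    show pos: "0 < \<epsilon> t" for t using d(1) by (auto simp: \<epsilon>_def)
    show "\<epsilon> t \<le> \<epsilon> s" if "s \<le> t" for s t
    proof -
      have "nat \<lceil>s\<rceil> \<le> nat \<lceil>t\<rceil>" using that by (intro nat_mono ceiling_mono)
      then show ?thesis unfolding \<epsilon>_def by (intro Min_antimono image_mono) auto
    qed
    fix t :: real assume t: "0 \<le> t"
    have "P t (d (nat \<lceil>t\<rceil>))" using t by (intro d(2)) (simp add: real_nat_ceiling_ge)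
    then show "P t (\<epsilon> t)" by (rule mono[OF _ pos]) (auto simp: \<epsilon>_def)
  qed
qed

locale level_set_tube = level_set_problem +
  fixes N :: "(real \<times> (real^3)) set"
  assumes open_N: "open N" and surface_N: "{0..} \<times> \<Sigma>0 \<subseteq> N" and N_W: "N \<subseteq> W" and inj_N: "inj_on G N"
    and bij_G': "\<And>p. p \<in> N \<Longrightarrow> bij (blinfun_apply (G' p))"
    and N_down: "\<And>s t \<xi>. (t, \<xi>) \<in> N \<Longrightarrow> 0 \<le> s \<Longrightarrow> s \<le> t \<Longrightarrow> (s, \<xi>) \<in> N"
begin

text \<open>The uncut image: it may reach into negative times and is therefore open in space-time,
  which gives room for two-sided derivatives at \<open>t = 0\<close>.\<close>

definition \<Theta>0 :: "(real \<times> (real^3)) set" where "\<Theta>0 = G ` N"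
definition \<Theta> :: "(real \<times> (real^3)) set" where "\<Theta> = \<Theta>0 \<inter> ({0..} \<times> UNIV)"
definition phi :: "real \<times> (real^3) \<Rightarrow> real" where "phi q = fst (snd (Y (inv_into N G q)))"
text \<open>Taken from the characteristics as the \<open>p\<close>-component; that it is the
  gradient of \<open>phi\<close> is the content of \<open>phi_has_derivative\<close>.\<close>

definition grd :: "real \<times> (real^3) \<Rightarrow> real^3" where "grd q = snd (snd (Y (inv_into N G q)))"

lemma
  shows open_\<Theta>0: "open \<Theta>0" and C1_inverse_G: "C1_family \<Theta>0 (\<lambda>_. inv_into N G)"
proof -
  have d: "\<And>p. p \<in> N \<Longrightarrow> (G has_derivative blinfun_apply (G' p)) (at p)"
    using G_has_derivative N_W by blast
  have c: "continuous_on N G'" by (rule continuous_on_subset[OF G'_continuous N_W])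
  show "open \<Theta>0" "C1_family \<Theta>0 (\<lambda>_. inv_into N G)"
    unfolding \<Theta>0_def using C1_inverse[OF open_N inj_N d c bij_G'] by auto
qed

lemma half_open_\<Theta>: "half_open \<Theta>"
  unfolding half_open_def \<Theta>_def using open_\<Theta>0 by blast

lemma \<Theta>_sub: "\<Theta> \<subseteq> \<Theta>0" by (simp add: \<Theta>_def)

lemma C1_Y_inverse: "C1_family \<Theta>0 (\<lambda>_ q. Y (inv_into N G q))"
proof (rule C1_family_compose[OF C1_Y C1_inverse_G])
  show "inv_into N G q \<in> W" if "q \<in> \<Theta>0" for q
    by (rule subsetD[OF N_W inv_into_into[OF that[unfolded \<Theta>0_def]]])
qed

lemma C1_phi: "C1_family \<Theta>0 (\<lambda>_. phi)"
  unfolding phi_def[abs_def]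
  by (rule C1_family_linear_compose[OF bounded_linear_fst_comp[OF bounded_linear_snd] C1_Y_inverse])

lemma C1_grd: "C1_family \<Theta>0 (\<lambda>_. grd)"
  unfolding grd_def[abs_def]
  by (rule C1_family_linear_compose[OF bounded_linear_snd_comp[OF bounded_linear_snd] C1_Y_inverse])

lemma \<Theta>_E:
  assumes "q \<in> \<Theta>"
  obtains t \<xi> where "(t, \<xi>) \<in> N" "0 \<le> t" "q = G (t, \<xi>)" "inv_into N G q = (t, \<xi>)"
proof -
  have "q \<in> G ` N" "0 \<le> fst q" using assms by (auto simp: \<Theta>_def \<Theta>0_def mem_Times_iff)
  then obtain p where p: "p \<in> N" "q = G p" "0 \<le> fst q" by blast
  have i: "inv_into N G q = p" unfolding p(2) by (rule inv_into_f_f[OF inj_N p(1)])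
  have f: "fst q = fst p" unfolding p(2) by (simp add: G_def)
  show thesis
    by (rule that[of "fst p" "snd p", unfolded prod.collapse, OF p(1) p(3)[unfolded f] p(2) i])
qed

lemma \<Theta>_I:
  assumes "(t, \<xi>) \<in> N" "0 \<le> t"
  shows "G (t, \<xi>) \<in> \<Theta>" "inv_into N G (G (t, \<xi>)) = (t, \<xi>)"
proof -
  have "G (t, \<xi>) \<in> \<Theta>0" using assms by (simp add: \<Theta>0_def)
  moreover have "fst (G (t, \<xi>)) = t" by (simp add: G_def)
  ultimately show "G (t, \<xi>) \<in> \<Theta>" using assms by (simp add: \<Theta>_def mem_Times_iff)
  show "inv_into N G (G (t, \<xi>)) = (t, \<xi>)" using assms inv_into_f_f[OF inj_N] by simp
qed

lemma \<Theta>_values: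
  assumes "(t, \<xi>) \<in> N" "0 \<le> t"
  shows "Y (t, \<xi>) = (snd (G (t, \<xi>)), phi (G (t, \<xi>)), grd (G (t, \<xi>)))"
  unfolding phi_def grd_def \<Theta>_I(2)[OF assms] by (simp add: G_def)

lemma \<Theta>_in_U:
  assumes "(t, x) \<in> \<Theta>"
  shows "x \<in> \<Omega>" "grd (t, x) \<noteq> 0" "0 \<le> t"
proof -
  obtain s \<xi> where N: "(s, \<xi>) \<in> N" "0 \<le> s" "(t, x) = G (s, \<xi>)" using \<Theta>_E[OF assms] by metis
  then have "s = t" by (simp add: G_def)
  have "(s, \<xi>) \<in> W" using N(1) N_W by blast
  from Y_in_U[OF this N(2)] have "(snd (t, x), phi (t, x), grd (t, x)) \<in> U"
    unfolding \<Theta>_values[OF N(1,2)] N(3) .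
  then show "x \<in> \<Omega>" "grd (t, x) \<noteq> 0" by (auto simp: U_def)
  show "0 \<le> t" using N(2) \<open>s = t\<close> by simp
qed

lemma \<Theta>_spacetime: "\<Theta> \<subseteq> spacetime \<Omega>"
  using \<Theta>_in_U by (auto simp: spacetime_def)

text \<open>The identity saying that \<open>phi (G p)\<close> is the \<open>\<phi>\<close>-component
  of \<open>Y p\<close> is differentiated. As the differential of \<open>G\<close> is onto, every
  direction is an image under it, and there the contact condition gives the value.\<close>

lemma phi_has_derivative:
  assumes q: "(t, x) \<in> \<Theta>"
  shows "(phi has_derivative (\<lambda>k. fst k * (phi (t, x) * R t x (grd (t, x)) - grd (t, x) \<bullet> v (t, x)) + grd (t, x) \<bullet> snd k)) (at (t, x))"
proof -
  obtain s \<xi> where N: "(s, \<xi>) \<in> N" "0 \<le> s" "(t, x) = G (s, \<xi>)" using \<Theta>_E[OF q] by metis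
  then have st: "s = t" by (simp add: G_def)
  have W: "(t, \<xi>) \<in> W" and t: "0 \<le> t" using N N_W st by auto
  have GY: "G (t, \<xi>) = (t, x)" and Y: "Y (t, \<xi>) = (x, phi (t, x), grd (t, x))"
    using \<Theta>_values[OF N(1,2)] N(3)[symmetric] st by auto
  obtain F where F: "\<And>y. y \<in> \<Theta>0 \<Longrightarrow> (phi has_derivative blinfun_apply (F y)) (at y)"
    using C1_family_constE[OF C1_phi] by blast
  have F: "(phi has_derivative F (t, x)) (at (G (t, \<xi>)))" using F q \<Theta>_sub GY by auto
  have "((\<lambda>p. phi (G p)) has_derivative (\<lambda>h. F (t, x) (G' (t, \<xi>) h))) (at (t, \<xi>))"
    by (rule has_derivative_compose[OF G_has_derivative[OF W] F])
  moreover have "((\<lambda>p. phi (G p)) has_derivative (\<lambda>h. fst (snd (Y' (t, \<xi>) h)))) (at (t, \<xi>))"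
  proof (rule has_derivative_transform_within_open[OF _ open_N])
    show "((\<lambda>p. fst (snd (Y p))) has_derivative (\<lambda>h. fst (snd (Y' (t, \<xi>) h)))) (at (t, \<xi>))"
      using has_derivative_compose[OF Y_has_derivative[OF W] bounded_linear_imp_has_derivative[OF bounded_linear_fst_comp[OF bounded_linear_snd]]] .
    show "fst (snd (Y p)) = phi (G p)" if "p \<in> N" for p
      using inv_into_f_f[OF inj_N that] by (simp add: phi_def)
  qed (use N st in simp)
  ultimately have eq: "(\<lambda>h. F (t, x) (G' (t, \<xi>) h)) = (\<lambda>h. fst (snd (Y' (t, \<xi>) h)))"
    by (rule has_derivative_unique)
  have Fk: "F (t, x) k = fst k * (phi (t, x) * R t x (grd (t, x)) - grd (t, x) \<bullet> v (t, x)) + grd (t, x) \<bullet> snd k" for k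
  proof -
    obtain h where h: "k = G' (t, \<xi>) h" using bij_G'[OF N(1)] st by (metis bij_pointE)
    then have "k = (fst h, fst (Y' (t, \<xi>) h))" using G'_eq[OF W] by simp
    then show ?thesis
      using fun_cong[OF eq, of h] contact_condition[OF W t Y, of h] h by simp
  qed
  show ?thesis by (rule has_derivative_eq_rhs[OF F[unfolded GY]]) (rule ext, rule Fk)
qed

lemma open_slice: "open (slice \<Theta> t)"
proof (cases "0 \<le> t")
  case True
  have "slice \<Theta> t = Pair t -` \<Theta>0" using True by (auto simp: slice_def \<Theta>_def)
  moreover have "open (Pair t -` \<Theta>0)" by (rule open_vimage[OF open_\<Theta>0]) (intro continuous_intros)
  ultimately show ?thesis by simp
next
  case False
  then show ?thesis by (auto simp: slice_def \<Theta>_def)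
qed

lemma grad_phi:
  assumes q: "(t, x) \<in> \<Theta>"
  shows "grad (slice \<Theta> t) (\<lambda>y. phi (t, y)) x = grd (t, x)"
proof (rule grad_eqI[OF _ open_slice])
  have "((\<lambda>y. (t, y)) has_derivative (\<lambda>h. (0, h))) (at x)"
    by (intro has_derivative_Pair has_derivative_const has_derivative_ident)
  from has_derivative_compose[OF this phi_has_derivative[OF q]]
  show "((\<lambda>y. phi (t, y)) has_derivative (\<bullet>) (grd (t, x))) (at x)" by simp
qed (use q in \<open>simp add: slice_def\<close>)

lemma
  assumes q: "(t, x) \<in> \<Theta>"
  shows pderiv_time_phi: "pderiv_on \<Theta> (1, 0) phi (t, x) = phi (t, x) * R t x (grd (t, x)) - grd (t, x) \<bullet> v (t, x)"
    and pderiv_space_phi: "pderiv_on \<Theta> (0, axis j 1) phi (t, x) = grd (t, x) $ j"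
proof -
  note D = Ck_on_1I(2)[OF C1_phi half_open_\<Theta> \<Theta>_sub _ q phi_has_derivative[OF q]]
  show "pderiv_on \<Theta> (1, 0) phi (t, x) = phi (t, x) * R t x (grd (t, x)) - grd (t, x) \<bullet> v (t, x)"
    using D[of "(1, 0)"] by (simp add: Basis_spacetime)
  show "pderiv_on \<Theta> (0, axis j 1) phi (t, x) = grd (t, x) $ j"
    using D[of "(0, axis j 1)"] by (auto simp: Basis_spacetime space_dirs_def inner_axis)
qed

lemma grad_vec_mult:
  assumes "0 \<le> t" "x \<in> \<Omega>"
  shows "grad_vec \<Omega> (\<lambda>y. v (t, y)) x *v n = Dv t x n"
  by (simp add: vec_eq_iff matrix_vector_mult_def grad_vec_spd[OF v3 open_Om assms] Dv_def mult.commute)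

lemma R_unit:
  assumes "0 \<le> t" "x \<in> \<Omega>"
  shows "(grad_vec \<Omega> (\<lambda>y. v (t, y)) x *v (p /\<^sub>R norm p)) \<bullet> (p /\<^sub>R norm p) = R t x p"
  by (simp add: grad_vec_mult[OF assms] linear_scale[OF Dv_linear] R_def dot_square_norm power2_eq_square
      inner_commute[of p] divide_inverse mult_ac)

lemma phi_initial:
  assumes "(0, x) \<in> \<Theta>"
  shows "phi (0, x) = \<phi>0 x" "grd (0, x) = grad \<Omega> \<phi>0 x" "(0, x) \<in> N"
proof -
  obtain s \<xi> where N: "(s, \<xi>) \<in> N" "0 \<le> s" "(0, x) = G (s, \<xi>)" using \<Theta>_E[OF assms] by metis
  then have s: "s = 0" by (simp add: G_def)
  have N0: "(0, \<xi>) \<in> N" and G0: "G (0, \<xi>) = (0, x)" using N s by simp_all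
  have W: "(0, \<xi>) \<in> W" using subsetD[OF N_W N0] .
  have "Y (0, \<xi>) = eta \<xi>" using Y_eq[OF W] ch.flow_0[OF W_dom[OF W]] by simp
  from \<Theta>_values[OF N0 order_refl, unfolded G0 this eta_def]
  show "phi (0, x) = \<phi>0 x" "grd (0, x) = grad \<Omega> \<phi>0 x" "(0, x) \<in> N"
    using N0 by auto
qed

lemma phi_solves: "solves_problem \<Omega> v \<phi>0 \<Theta> phi"
  unfolding solves_problem_def
proof (intro conjI ballI)
  fix q assume "q \<in> \<Theta>"
  then obtain t x where q: "q = (t, x)" "(t, x) \<in> \<Theta>" by (cases q) auto
  note tx = \<Theta>_in_U[OF q(2)]
  show "case q of (t, x) \<Rightarrow> let p = grad (slice \<Theta> t) (\<lambda>y. phi (t, y)) x; n = p /\<^sub>R norm p in p \<noteq> 0 \<and>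
      pderiv_on \<Theta> (1, 0) phi (t, x) + v (t, x) \<bullet> p = phi (t, x) * ((grad_vec \<Omega> (\<lambda>y. v (t, y)) x *v n) \<bullet> n)"
    unfolding q Let_def prod.case grad_phi[OF q(2)] R_unit[OF tx(3,1)] pderiv_time_phi[OF q(2)]
    using tx(2) by (simp add: inner_commute)
qed (use phi_initial in \<open>auto simp: slice_def\<close>)

text \<open>The spatial derivatives of \<open>phi\<close> are the components of \<open>grd\<close>,
  which is C1 by the same composition as \<open>phi\<close> itself; this is the gain of one
  derivative.\<close>

lemma phi_C2_upto_tt: "C2_upto_tt \<Theta> phi"
  unfolding C2_upto_tt_def
proof (intro conjI ballI)
  show "Ck_on 1 \<Theta> phi" by (rule Ck_on_1I(1)[OF C1_phi half_open_\<Theta> \<Theta>_sub])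
  fix b :: "real \<times> (real^3)" assume "b \<in> space_dirs"
  then obtain j where b: "b = (0, axis j 1)" by (auto simp: space_dirs_def)
  have "C1_family \<Theta>0 (\<lambda>_ q. grd q $ j)"
    by (rule C1_family_linear_compose[OF bounded_linear_vec_nth C1_grd])
  then have "Ck_on 1 \<Theta> (\<lambda>q. grd q $ j)"
    by (rule Ck_on_1I(1)[OF _ half_open_\<Theta> \<Theta>_sub])
  moreover have "Ck_on 1 \<Theta> (pderiv_on \<Theta> b phi) = Ck_on 1 \<Theta> (\<lambda>q. grd q $ j)"
    unfolding Ck_on_def by (rule Ck_dirs_cong) (auto simp: b pderiv_space_phi)
  ultimately show "Ck_on 1 \<Theta> (pderiv_on \<Theta> b phi)" by simp
qed

lemma openin_\<Theta>: "openin (top_of_set (spacetime \<Omega>)) \<Theta>"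
proof -
  have "\<Theta> = spacetime \<Omega> \<inter> \<Theta>0" using \<Theta>_spacetime by (auto simp: \<Theta>_def spacetime_def)
  then show ?thesis using open_\<Theta>0 by (metis openin_open_Int)
qed

lemma surface_\<Theta>: "\<xi> \<in> \<Sigma>0 \<Longrightarrow> 0 \<le> t \<Longrightarrow> (t, X t 0 \<xi>) \<in> \<Theta>"
  using \<Theta>_I(1)[of t \<xi>] surface_N G_surface[of \<xi> t] by auto

text \<open>Each point of \<open>\<Theta>\<close> lies on exactly one characteristic with parameter
  in \<open>N\<close>, and on it \<open>\<phi>\<close> vanishes always or never. Those with
  \<open>\<phi> = 0\<close> start on \<open>\<Sigma>0\<close>, where \<open>x\<close> follows the
  flow of \<open>v\<close>.\<close>

lemma zero_level:
  assumes t: "0 \<le> t"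
  shows "{x \<in> \<Omega>. (t, x) \<in> \<Theta> \<and> phi (t, x) = 0} = X t 0 ` \<Sigma>0"
proof safe
  fix x assume q: "(t, x) \<in> \<Theta>" and z: "phi (t, x) = 0"
  obtain s \<xi> where N: "(s, \<xi>) \<in> N" "0 \<le> s" "(t, x) = G (s, \<xi>)" using \<Theta>_E[OF q] by metis
  then have st: "s = t" by (simp add: G_def)
  have W: "(t, \<xi>) \<in> W" using N N_W st by auto
  have "\<xi> \<in> \<Sigma>0"
    using surface_phi_zero[OF W_Om[OF W t] W_dom[OF W t]] Y_eq[OF W t] \<Theta>_values[OF N(1,2)] N(3) st z by auto
  then show "x \<in> X t 0 ` \<Sigma>0" using G_surface[OF _ t] N(3) st by auto
next
  fix \<xi> assume \<xi>: "\<xi> \<in> \<Sigma>0"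
  show q: "(t, X t 0 \<xi>) \<in> \<Theta>" by (rule surface_\<Theta>[OF \<xi> t])
  then show "X t 0 \<xi> \<in> \<Omega>" by (rule \<Theta>_in_U)
  have N: "(t, \<xi>) \<in> N" using surface_N \<xi> t by auto
  then have W: "(t, \<xi>) \<in> W" using N_W by auto
  have fl: "ch.flow t (eta \<xi>) = (X t 0 \<xi>, phi (t, X t 0 \<xi>), grd (t, X t 0 \<xi>))"
    unfolding Y_eq[OF W t, symmetric] \<Theta>_values[OF N t] G_surface[OF \<xi> t] by simp
  show "phi (t, X t 0 \<xi>) = 0"
    using surface_phi_zero[OF W_Om[OF W t] W_dom[OF W t]] \<xi> fl by simp
qed

lemma gradient_norm:
  assumes t: "0 \<le> t" and \<xi>: "\<xi> \<in> \<Sigma>0"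
  shows "norm (grad (slice \<Theta> t) (\<lambda>y. phi (t, y)) (X t 0 \<xi>)) = norm (grad \<Omega> \<phi>0 \<xi>)"
proof -
  have N: "(t, \<xi>) \<in> N" using surface_N \<xi> t by auto
  then have W: "(t, \<xi>) \<in> W" using N_W by auto
  have fl: "ch.flow t (eta \<xi>) = (X t 0 \<xi>, phi (t, X t 0 \<xi>), grd (t, X t 0 \<xi>))"
    unfolding Y_eq[OF W t, symmetric] \<Theta>_values[OF N t] G_surface[OF \<xi> t] by simp
  show ?thesis
    unfolding grad_phi[OF surface_\<Theta>[OF \<xi> t]] using surface_norm[OF \<xi> t] fl by simp
qed

text \<open>Over \<open>[0, n]\<close> the surface sweeps out a compact subset of the open set
  \<open>\<Theta>0\<close>, which therefore contains space-time balls of one radius around it; their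
  central time sections are spatial balls of the same radius.\<close>

lemma tubular: "tubular_neighborhood \<Omega> (\<lambda>t. X t 0 ` \<Sigma>0) \<Theta>"
proof -
  define P where "P t e \<longleftrightarrow> {t} \<times> (\<Union>x\<in>X t 0 ` \<Sigma>0. ball x e) \<subseteq> \<Theta>" for t e
  have ex: "\<exists>e>0. \<forall>t\<in>{0..real n}. P t e" for n
  proof -
    have "compact (G ` ({0..real n} \<times> \<Sigma>0))"
    proof (rule compact_continuous_image)
      show "continuous_on ({0..real n} \<times> \<Sigma>0) G"
        by (rule continuous_on_subset[OF C1_const_continuous[OF C1_G]]) (use surface_W in auto)
    qed (intro compact_Times compact_S0 compact_Icc)
    moreover have "G ` ({0..real n} \<times> \<Sigma>0) \<subseteq> \<Theta>0"
      unfolding \<Theta>0_def by (rule image_mono) (use surface_N in auto)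
    ultimately obtain e where e: "e > 0" "(\<Union>x\<in>G ` ({0..real n} \<times> \<Sigma>0). ball x e) \<subseteq> \<Theta>0"
      using compact_subset_open_imp_ball_epsilon_subset[OF _ open_\<Theta>0] by metis
    have "(t, y) \<in> \<Theta>" if t: "t \<in> {0..real n}" and \<xi>: "\<xi> \<in> \<Sigma>0" and y: "dist (X t 0 \<xi>) y < e" for t y \<xi>
    proof -
      have "(t, y) \<in> ball (G (t, \<xi>)) e" using y t G_surface[OF \<xi>, of t] by (simp add: dist_Pair_Pair)
      then have "(t, y) \<in> \<Theta>0" using e(2) t \<xi> by blast
      then show ?thesis using t by (simp add: \<Theta>_def)
    qed
    then show ?thesis using e(1) by (intro exI[of _ e]) (auto simp: P_def)
  qed
  have mono: "P t e'" if "P t e" "0 < e'" "e' \<le> e" for t e e'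
  proof -
    have "(\<Union>x\<in>X t 0 ` \<Sigma>0. ball x e') \<subseteq> (\<Union>x\<in>X t 0 ` \<Sigma>0. ball x e)"
      using that(3) by (intro UN_mono subset_ball) auto
    then show ?thesis using that(1) unfolding P_def by blast
  qed
  obtain \<epsilon> where "\<And>t. 0 < \<epsilon> t" "\<And>s t. s \<le> t \<Longrightarrow> \<epsilon> t \<le> \<epsilon> s" "\<And>t. 0 \<le> t \<Longrightarrow> P t (\<epsilon> t)"
  proof (rule nonincreasing_positive_radius[of P])
    show "\<exists>e>0. \<forall>t\<in>{0..real n}. P t e" for n by (rule ex)
    show "P t e'" if "P t e" "0 < e'" "e' \<le> e" for t e e' by (rule mono[OF that])
  qed blast
  then show ?thesis
    unfolding tubular_neighborhood_def P_def using \<Theta>_spacetime surface_\<Theta>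
    by (intro conjI exI[of _ \<epsilon>]) auto
qed

end

section \<open>Uniqueness\<close>

lemma sum_Basis_spacetime:
  fixes f :: "real \<times> (real^3) \<Rightarrow> 'b::real_vector"
  shows "(\<Sum>b\<in>Basis. (h \<bullet> b) *\<^sub>R f b) = fst h *\<^sub>R f (1, 0) + (\<Sum>j\<in>UNIV. snd h $ j *\<^sub>R f (0, axis j 1))"
proof -
  have sd: "space_dirs = range (\<lambda>j. (0, axis j 1))" by (auto simp: space_dirs_def)
  have "inj (\<lambda>j::3. (0::real, axis j 1 :: real^3))" by (auto simp: inj_on_def axis_eq_axis)
  then have "(\<Sum>b\<in>space_dirs. (h \<bullet> b) *\<^sub>R f b) = (\<Sum>j\<in>UNIV. snd h $ j *\<^sub>R f (0, axis j 1))"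
    unfolding sd by (simp add: sum.reindex inner_prod_def inner_axis)
  moreover have "finite space_dirs" "(1, 0) \<notin> space_dirs" by (auto simp: sd)
  ultimately show ?thesis by (simp add: Basis_spacetime inner_prod_def)
qed

lemma half_open_positive:
  assumes "half_open \<Theta>"
  shows "open (\<Theta> \<inter> {q. 0 < fst q})"
proof -
  obtain W where W: "open W" "\<Theta> = W \<inter> ({0..} \<times> UNIV)" using assms by (auto simp: half_open_def)
  have "\<Theta> \<inter> {q. 0 < fst q} = W \<inter> {q. 0 < fst q}" using W(2) by (auto simp: mem_Times_iff)
  then show ?thesis using W(1) by (simp add: open_Int open_Collect_less continuous_on_fst)
qed

lemma pderiv_interior:
  assumes ho: "half_open \<Theta>" and "has_pderiv \<Theta> b f p" and p: "p \<in> \<Theta>" "0 < fst p"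
  shows "((\<lambda>s. f (p + s *\<^sub>R b)) has_vector_derivative pderiv_on \<Theta> b f p) (at 0)"
proof -
  have "at 0 = at 0 within {s. p + s *\<^sub>R b \<in> \<Theta> \<inter> {q. 0 < fst q}}"
    by (rule at_within_line_open[OF half_open_positive[OF ho], symmetric]) (use p in auto)
  also have "\<dots> \<le> at 0 within {s. p + s *\<^sub>R b \<in> \<Theta>}" by (rule at_le) auto
  finally have le: "at 0 \<le> at 0 within {s. p + s *\<^sub>R b \<in> \<Theta>}" .
  have ge: "at 0 within {s. p + s *\<^sub>R b \<in> \<Theta>} \<le> at 0" by (rule at_le) simp
  from antisym[OF ge le] show ?thesis using pderiv_onD[OF assms(2)] by simp
qed

text \<open>Total differentiability is asserted at positive times only, where
  \<open>\<Theta>\<close> is a full neighbourhood. That is enough for Gronwall, which asks for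
  derivatives in the open interval and for continuity at its ends.\<close>

lemma
  fixes f :: "real \<times> (real^3) \<Rightarrow> 'b::real_normed_vector"
  assumes f: "Ck_on 1 \<Theta> f" and ho: "half_open \<Theta>"
  shows Ck_on_1_pderiv_continuous: "b \<in> Basis \<Longrightarrow> continuous_on \<Theta> (pderiv_on \<Theta> b f)"
    and Ck_on_1_pderiv_continuous_interior: "b \<in> Basis \<Longrightarrow> continuous_on (\<Theta> \<inter> {q. 0 < fst q}) (pderiv_on \<Theta> b f)"
    and Ck_on_1_continuous: "continuous_on \<Theta> f"
    and Ck_on_1_line: "b \<in> Basis \<Longrightarrow> p \<in> \<Theta> \<Longrightarrow> 0 < fst p \<Longrightarrow>
      ((\<lambda>s. f (p + s *\<^sub>R b)) has_vector_derivative pderiv_on \<Theta> b f p) (at 0)"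
    and Ck_on_1_has_derivative: "p \<in> \<Theta> \<Longrightarrow> 0 < fst p \<Longrightarrow> (f has_derivative (\<lambda>h. fst h *\<^sub>R pderiv_on \<Theta> (1, 0) f p +
      (\<Sum>j\<in>UNIV. snd h $ j *\<^sub>R pderiv_on \<Theta> (0, axis j 1) f p))) (at p)"
proof -
  show c: "continuous_on \<Theta> (pderiv_on \<Theta> b f)" if "b \<in> Basis" for b using f that by (simp add: Ck_on_def)
  show c': "continuous_on (\<Theta> \<inter> {q. 0 < fst q}) (pderiv_on \<Theta> b f)" if "b \<in> Basis" for b
    by (rule continuous_on_subset[OF c[OF that]]) simp
  show "continuous_on \<Theta> f" using f by (simp add: Ck_on_def)
  show l: "((\<lambda>s. f (p + s *\<^sub>R b)) has_vector_derivative pderiv_on \<Theta> b f p) (at 0)"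
    if "b \<in> Basis" "p \<in> \<Theta>" "0 < fst p" for b p
    using f that by (intro pderiv_interior[OF ho]) (auto simp: Ck_on_def)
  show "(f has_derivative (\<lambda>h. fst h *\<^sub>R pderiv_on \<Theta> (1, 0) f p +
      (\<Sum>j\<in>UNIV. snd h $ j *\<^sub>R pderiv_on \<Theta> (0, axis j 1) f p))) (at p)" if "p \<in> \<Theta>" "0 < fst p"
    unfolding sum_Basis_spacetime[of _ "\<lambda>b. pderiv_on \<Theta> b f p", symmetric]
    by (rule has_derivative_continuous_partials[OF half_open_positive[OF ho]])
      (use that in \<open>simp_all add: l c'\<close>)
qed

lemma norm_components_le: "norm (fst w) \<le> norm w" "norm (snd w) \<le> norm w"
  for w :: "'a::real_normed_vector \<times> 'b::real_normed_vector"
  by (metis norm_fst_le prod.collapse) (metis norm_snd_le prod.collapse)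

context level_set_tube
begin

lemma C1_family_along:
  assumes "C1_family U F" and "continuous_on \<Theta> a" "continuous_on \<Theta> g" and "\<And>q. q \<in> \<Theta> \<Longrightarrow> g q \<noteq> 0"
  shows "continuous_on \<Theta> (\<lambda>q. F (fst q) (snd q, a q, g q))"
proof -
  have "continuous_on \<Theta> (\<lambda>q. (fst q, snd q, a q, g q))"
    by (intro continuous_on_Pair continuous_on_fst continuous_on_snd continuous_on_id assms)
  moreover have "(\<lambda>q. (fst q, snd q, a q, g q)) ` \<Theta> \<subseteq> {0..} \<times> U"
  proof (rule image_subsetI)
    fix q assume q: "q \<in> \<Theta>"
    then show "(fst q, snd q, a q, g q) \<in> {0..} \<times> U"
      using assms(4)[OF q] \<Theta>_in_U(1,3)[of "fst q" "snd q"] by (simp add: U_def)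
  qed
  ultimately show ?thesis
    using continuous_on_compose2[OF C1_family_continuous[OF assms(1)], of \<Theta> "\<lambda>q. (fst q, snd q, a q, g q)"]
    by (simp only: prod.case)
qed

lemma continuous_A: "continuous_on \<Theta> (\<lambda>q. A j (fst q) (snd q))"
  unfolding prod.collapse by (rule continuous_on_subset[OF Ck_dirs_continuous[OF v2] \<Theta>_spacetime])

lemma continuous_v: "continuous_on \<Theta> v"
  by (rule continuous_on_subset[OF Ck_dirs_continuous[OF v3] \<Theta>_spacetime])

section \<open>Comparison with an arbitrary solution\<close>

context
  fixes \<psi> :: "real \<times> (real^3) \<Rightarrow> real"
  assumes C2: "C2_upto_tt \<Theta> \<psi>" and sol: "solves_problem \<Omega> v \<phi>0 \<Theta> \<psi>"
begin

definition gr :: "real \<times> (real^3) \<Rightarrow> real^3" where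
  "gr q = (\<chi> j. pderiv_on \<Theta> (0, axis j 1) \<psi> q)"

definition hs :: "3 \<Rightarrow> real \<times> (real^3) \<Rightarrow> real^3" where
  "hs j q = (\<chi> k. pderiv_on \<Theta> (0, axis k 1) (pderiv_on \<Theta> (0, axis j 1) \<psi>) q)"

lemma \<psi>_C1: "Ck_on 1 \<Theta> \<psi>" and \<psi>j_C1: "Ck_on 1 \<Theta> (pderiv_on \<Theta> (0, axis j 1) \<psi>)"
  using C2 by (auto simp: C2_upto_tt_def space_dirs_def)

lemma dirs_Basis: "(1, 0) \<in> (Basis :: (real \<times> (real^3)) set)" "(0, axis j 1) \<in> (Basis :: (real \<times> (real^3)) set)"
  by (auto simp: Basis_spacetime space_dirs_def)

lemma grad_\<psi>: "grad (slice \<Theta> t) (\<lambda>y. \<psi> (t, y)) x = gr (t, x)"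
  by (simp add: grad_def gr_def pderiv_on_def slice_def)

lemma \<psi>_equation:
  assumes q: "(t, x) \<in> \<Theta>"
  shows "gr (t, x) \<noteq> 0"
    and "pderiv_on \<Theta> (1, 0) \<psi> (t, x) = \<psi> (t, x) * R t x (gr (t, x)) - v (t, x) \<bullet> gr (t, x)"
proof -
  note tx = \<Theta>_in_U[OF q]
  have "case (t, x) of (t, x) \<Rightarrow> let p = grad (slice \<Theta> t) (\<lambda>y. \<psi> (t, y)) x; n = p /\<^sub>R norm p in p \<noteq> 0 \<and>
      pderiv_on \<Theta> (1, 0) \<psi> (t, x) + v (t, x) \<bullet> p = \<psi> (t, x) * ((grad_vec \<Omega> (\<lambda>y. v (t, y)) x *v n) \<bullet> n)"
    using sol q unfolding solves_problem_def by blast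
  then have "gr (t, x) \<noteq> 0 \<and> pderiv_on \<Theta> (1, 0) \<psi> (t, x) + v (t, x) \<bullet> gr (t, x) = \<psi> (t, x) * R t x (gr (t, x))"
    unfolding Let_def prod.case grad_\<psi> R_unit[OF tx(3,1)] .
  then show "gr (t, x) \<noteq> 0"
    "pderiv_on \<Theta> (1, 0) \<psi> (t, x) = \<psi> (t, x) * R t x (gr (t, x)) - v (t, x) \<bullet> gr (t, x)" by auto
qed

lemma continuous_gr: "continuous_on \<Theta> gr"
  unfolding gr_def[abs_def]
  by (intro continuous_on_vec_lambda Ck_on_1_pderiv_continuous[OF \<psi>_C1 half_open_\<Theta>] dirs_Basis)

lemma continuous_hs: "continuous_on \<Theta> (hs j)"
  unfolding hs_def[abs_def]
  by (intro continuous_on_vec_lambda Ck_on_1_pderiv_continuous[OF \<psi>j_C1 half_open_\<Theta>] dirs_Basis)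

lemma continuous_\<psi>: "continuous_on \<Theta> \<psi>"
  by (rule Ck_on_1_continuous[OF \<psi>_C1 half_open_\<Theta>])

abbreviation "interior_\<Theta> \<equiv> \<Theta> \<inter> {q. 0 < fst q}"

lemma hessian_symmetric:
  assumes "q \<in> \<Theta>" "0 < fst q"
  shows "hs j q $ k = hs k q $ j"
proof -
  have "pderiv_on \<Theta> (0, axis k 1) (pderiv_on \<Theta> (0, axis j 1) \<psi>) q = pderiv_on \<Theta> (0, axis j 1) (pderiv_on \<Theta> (0, axis k 1) \<psi>) q"
  proof (rule mixed_partials_commute[OF half_open_positive[OF half_open_\<Theta>], where f = \<psi>
        and fa = "pderiv_on \<Theta> (0, axis j 1) \<psi>" and fb = "pderiv_on \<Theta> (0, axis k 1) \<psi>"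
        and a = "(0, axis j 1)" and b = "(0, axis k 1)"])
    fix z assume "z \<in> interior_\<Theta>"
    then have z: "z \<in> \<Theta>" "0 < fst z" by auto
    have 1: "((\<lambda>s. \<psi> (z + s *\<^sub>R (0, axis i 1))) has_real_derivative pderiv_on \<Theta> (0, axis i 1) \<psi> z) (at 0)" for i
      unfolding has_real_derivative_iff_has_vector_derivative by (rule Ck_on_1_line[OF \<psi>_C1 half_open_\<Theta> dirs_Basis(2) z])
    have 2: "((\<lambda>s. pderiv_on \<Theta> (0, axis i 1) \<psi> (z + s *\<^sub>R (0, axis l 1))) has_real_derivative
        pderiv_on \<Theta> (0, axis l 1) (pderiv_on \<Theta> (0, axis i 1) \<psi>) z) (at 0)" for i l
      unfolding has_real_derivative_iff_has_vector_derivative by (rule Ck_on_1_line[OF \<psi>j_C1 half_open_\<Theta> dirs_Basis(2) z])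
    show "((\<lambda>s. \<psi> (z + s *\<^sub>R (0, axis j 1))) has_real_derivative pderiv_on \<Theta> (0, axis j 1) \<psi> z) (at 0)"
      "((\<lambda>s. \<psi> (z + s *\<^sub>R (0, axis k 1))) has_real_derivative pderiv_on \<Theta> (0, axis k 1) \<psi> z) (at 0)"
      by (rule 1)+
    show "((\<lambda>s. pderiv_on \<Theta> (0, axis j 1) \<psi> (z + s *\<^sub>R (0, axis k 1))) has_real_derivative
        pderiv_on \<Theta> (0, axis k 1) (pderiv_on \<Theta> (0, axis j 1) \<psi>) z) (at 0)"
      "((\<lambda>s. pderiv_on \<Theta> (0, axis k 1) \<psi> (z + s *\<^sub>R (0, axis j 1))) has_real_derivative
        pderiv_on \<Theta> (0, axis j 1) (pderiv_on \<Theta> (0, axis k 1) \<psi>) z) (at 0)"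
      by (rule 2)+
  qed (use assms in \<open>auto intro: Ck_on_1_pderiv_continuous_interior[OF \<psi>j_C1 half_open_\<Theta> dirs_Basis(2)]\<close>)
  then show ?thesis by (simp add: hs_def)
qed

text \<open>The \<open>x_j\<close>-derivative of
  \<open>\<psi> R(t, x, \<nabla>\<psi>) - v \<bullet> \<nabla>\<psi>\<close>, that is, of the time
  derivative of \<open>\<psi>\<close> as given by the equation.\<close>

definition rhs :: "3 \<Rightarrow> real \<times> (real^3) \<Rightarrow> real" where
  "rhs j q = gr q $ j * R (fst q) (snd q) (gr q)
     + \<psi> q * (Rx (fst q) (snd q) (gr q) $ j + Rp (fst q) (snd q) (gr q) \<bullet> hs j q)
     - A j (fst q) (snd q) \<bullet> gr q - v q \<bullet> hs j q"

lemma continuous_rhs: "continuous_on \<Theta> (rhs j)"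
proof -
  have g: "gr q \<noteq> 0" if "q \<in> \<Theta>" for q using \<psi>_equation(1)[of "fst q" "snd q"] that by simp
  note al = C1_family_along[OF _ continuous_\<psi> continuous_gr g, simplified]
  show ?thesis unfolding rhs_def[abs_def]
    by (intro continuous_intros continuous_gr continuous_\<psi> continuous_hs continuous_A continuous_v
        al[OF C1_R, simplified] al[OF C1_Rx, simplified] al[OF C1_Rp, simplified])
qed

text \<open>The regularity class provides the time derivative of the \<open>j\<close>-th spatial
  derivative of \<open>\<psi>\<close>, but not these derivatives in the opposite order. The latter
  exists because the equation expresses the time derivative through terms differentiable in
  \<open>x_j\<close>; its value \<open>rhs j\<close> is continuous, so the order may be
  exchanged.\<close>

lemma time_derivative_gr:
  assumes q: "q \<in> \<Theta>" "0 < fst q"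
  shows "pderiv_on \<Theta> (1, 0) (pderiv_on \<Theta> (0, axis j 1) \<psi>) q = rhs j q"
proof -
  have line: "((\<lambda>s. pderiv_on \<Theta> (1, 0) \<psi> (z + s *\<^sub>R (0, axis j 1))) has_real_derivative rhs j z) (at 0)"
    if z: "z \<in> interior_\<Theta>" for z
  proof -
    obtain t x where tx: "z = (t, x)" by (cases z)
    have q: "(t, x) \<in> \<Theta>" and t: "0 < t" using z tx by auto
    note xO = \<Theta>_in_U(1)[OF q]
    let ?c = "\<lambda>s::real. x + s *\<^sub>R axis j 1"
    \<comment> \<open>The \<open>\<phi>\<close>-component \<open>0\<close> is a dummy:
      \<open>R\<close> depends on \<open>x\<close> and \<open>p\<close> alone, but its
      differentiability is stated on the phase space.\<close>
    have y: "(x, 0, gr (t, x)) \<in> U" using \<psi>_equation(1)[OF q] xO by (simp add: U_def)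
    have dc: "(?c has_derivative (\<lambda>s. s *\<^sub>R axis j 1)) (at 0)" by (auto intro!: derivative_eq_intros)
    have d\<psi>: "((\<lambda>s. \<psi> (t, ?c s)) has_derivative (\<lambda>s. s * gr (t, x) $ j)) (at 0)"
      using Ck_on_1_line[OF \<psi>_C1 half_open_\<Theta> dirs_Basis(2) q, of j] t
      by (simp add: has_vector_derivative_def gr_def)
    have "((\<lambda>s. pderiv_on \<Theta> (0, axis i 1) \<psi> (t, ?c s)) has_derivative (\<lambda>s. s * hs i (t, x) $ j)) (at 0)" for i
      using Ck_on_1_line[OF \<psi>j_C1 half_open_\<Theta> dirs_Basis(2) q, of i j] t
      by (simp add: has_vector_derivative_def hs_def)
    then have "((\<lambda>s. pderiv_on \<Theta> (0, axis i 1) \<psi> (t, ?c s)) has_derivative (\<lambda>s. (s *\<^sub>R hs j (t, x)) $ i)) (at 0)" for i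
      using hessian_symmetric[OF q, of j i] t by simp
    then have dg: "((\<lambda>s. gr (t, ?c s)) has_derivative (\<lambda>s. s *\<^sub>R hs j (t, x))) (at 0)"
      unfolding gr_def by (subst has_derivative_componentwise_within) (auto simp: Basis_vec3 inner_axis)
    have dv: "((\<lambda>s. v (t, ?c s)) has_derivative (\<lambda>s. s *\<^sub>R A j t x)) (at 0)"
      using has_derivative_compose[OF dc, of "\<lambda>x. v (t, x)" "Dv t x"] v_has_derivative[of t x] t xO
      by (simp add: linear_scale[OF Dv_linear]) (simp add: Dv_def axis_def if_distrib if_distribR cong: if_cong)
    have "((\<lambda>s. (?c s, 0::real, gr (t, ?c s))) has_derivative (\<lambda>s. (s *\<^sub>R axis j 1, 0, s *\<^sub>R hs j (t, x)))) (at 0)"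
      by (intro has_derivative_Pair dc dg has_derivative_const)
    moreover have "((\<lambda>y. R t (fst y) (snd (snd y))) has_derivative
        (\<lambda>h. Rx t x (gr (t, x)) \<bullet> fst h + Rp t x (gr (t, x)) \<bullet> snd (snd h))) (at (?c 0, 0::real, gr (t, ?c 0)))"
      using R_has_derivative[OF less_imp_le[OF t] y] by simp
    ultimately have "((\<lambda>s. (\<lambda>y. R t (fst y) (snd (snd y))) (?c s, 0::real, gr (t, ?c s))) has_derivative
        (\<lambda>s. (\<lambda>h. Rx t x (gr (t, x)) \<bullet> fst h + Rp t x (gr (t, x)) \<bullet> snd (snd h)) (s *\<^sub>R axis j 1, 0::real, s *\<^sub>R hs j (t, x)))) (at 0)"
      by (rule has_derivative_compose)
    then have dR: "((\<lambda>s. R t (?c s) (gr (t, ?c s))) has_derivative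
        (\<lambda>s. s * (Rx t x (gr (t, x)) $ j + Rp t x (gr (t, x)) \<bullet> hs j (t, x)))) (at 0)"
      by (simp add: inner_axis distrib_left)
    have "((\<lambda>s. \<psi> (t, ?c s) * R t (?c s) (gr (t, ?c s)) - v (t, ?c s) \<bullet> gr (t, ?c s)) has_derivative
        (\<lambda>s. rhs j (t, x) * s)) (at 0)"
      by (rule has_derivative_eq_rhs[OF has_derivative_diff[OF has_derivative_mult[OF d\<psi> dR] has_derivative_inner[OF dv dg]]])
        (auto simp: rhs_def fun_eq_iff algebra_simps)
    then have "((\<lambda>s. \<psi> (t, ?c s) * R t (?c s) (gr (t, ?c s)) - v (t, ?c s) \<bullet> gr (t, ?c s)) has_real_derivative rhs j (t, x)) (at 0)"
      by (simp add: has_field_derivative_def)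
    moreover have "open ((\<lambda>s. (t, ?c s)) -` interior_\<Theta>)"
      by (rule open_vimage[OF half_open_positive[OF half_open_\<Theta>]]) (intro continuous_intros)
    ultimately have "((\<lambda>s. pderiv_on \<Theta> (1, 0) \<psi> (t, ?c s)) has_real_derivative rhs j (t, x)) (at 0)"
      by (rule has_field_derivative_transform_within_open) (use q t \<psi>_equation(2) in auto)
    then show ?thesis by (simp add: tx)
  qed
  have "rhs j q = pderiv_on \<Theta> (1, 0) (pderiv_on \<Theta> (0, axis j 1) \<psi>) q"
  proof (rule mixed_partials_commute[OF half_open_positive[OF half_open_\<Theta>], where f = \<psi>
        and fa = "pderiv_on \<Theta> (1, 0) \<psi>" and fb = "pderiv_on \<Theta> (0, axis j 1) \<psi>"
        and a = "(1, 0)" and b = "(0, axis j 1)"])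
    fix z assume zi: "z \<in> interior_\<Theta>"
    then have z: "z \<in> \<Theta>" "0 < fst z" by auto
    show "((\<lambda>s. \<psi> (z + s *\<^sub>R (1, 0))) has_real_derivative pderiv_on \<Theta> (1, 0) \<psi> z) (at 0)"
      "((\<lambda>s. \<psi> (z + s *\<^sub>R (0, axis j 1))) has_real_derivative pderiv_on \<Theta> (0, axis j 1) \<psi> z) (at 0)"
      unfolding has_real_derivative_iff_has_vector_derivative by (rule Ck_on_1_line[OF \<psi>_C1 half_open_\<Theta> dirs_Basis(1) z]
          Ck_on_1_line[OF \<psi>_C1 half_open_\<Theta> dirs_Basis(2) z])+
    show "((\<lambda>s. pderiv_on \<Theta> (0, axis j 1) \<psi> (z + s *\<^sub>R (1, 0))) has_real_derivative
        pderiv_on \<Theta> (1, 0) (pderiv_on \<Theta> (0, axis j 1) \<psi>) z) (at 0)"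
      unfolding has_real_derivative_iff_has_vector_derivative by (rule Ck_on_1_line[OF \<psi>j_C1 half_open_\<Theta> dirs_Basis(1) z])
    show "((\<lambda>s. pderiv_on \<Theta> (1, 0) \<psi> (z + s *\<^sub>R (0, axis j 1))) has_real_derivative rhs j z) (at 0)"
      by (rule line[OF zi])
  next
    show "continuous_on interior_\<Theta> (rhs j)" by (rule continuous_on_subset[OF continuous_rhs]) simp
  qed (use q in \<open>auto intro: Ck_on_1_pderiv_continuous_interior[OF \<psi>j_C1 half_open_\<Theta> dirs_Basis(1)]\<close>)
  then show ?thesis by simp
qed

text \<open>The slice at time \<open>0\<close> is open in space, so agreement of the functions on it
  carries over to their gradients.\<close>

lemma initial_gr:
  assumes "(0, x) \<in> \<Theta>"
  shows "\<psi> (0, x) = \<phi>0 x" "gr (0, x) = grad \<Omega> \<phi>0 x"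
proof -
  have eq: "\<psi> (0, y) = \<phi>0 y" if "y \<in> slice \<Theta> 0" for y
    using sol that by (simp add: solves_problem_def)
  have x: "x \<in> slice \<Theta> 0" using assms by (simp add: slice_def)
  then show "\<psi> (0, x) = \<phi>0 x" by (rule eq)
  have "((\<lambda>y. \<psi> (0, y)) has_derivative (\<bullet>) (grad \<Omega> \<phi>0 x)) (at x)"
    by (rule has_derivative_transform_within_open[OF grad_has_derivative[OF C2_phi0 open_Om \<Theta>_in_U(1)[OF assms]] open_slice x])
      (simp add: eq)
  from grad_eqI[OF this open_slice x] show "gr (0, x) = grad \<Omega> \<phi>0 x" by (simp add: grad_\<psi>)
qed

text \<open>Along a characteristic of \<open>phi\<close> the pair \<open>(\<psi>, \<nabla>\<psi>)\<close> satisfies the characteristic equations up to an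
  error which is the product of the (bounded) second derivatives of \<open>\<psi>\<close> and of the difference of the
  two \<open>x\<close>-velocities, hence is bounded by the distance to \<open>(phi, \<nabla>phi)\<close>.\<close>

lemma \<psi>_eq_phi_on_characteristic:
  assumes N: "(T, \<xi>) \<in> N" and T: "0 < T"
  shows "\<psi> (G (T, \<xi>)) = phi (G (T, \<xi>))"
proof -
  let ?y = "\<lambda>s. ch.flow s (eta \<xi>)"
  define c where "c s = (s, fst (?y s))" for s
  \<comment> \<open>\<open>z\<close> shares its \<open>x\<close>-component with the characteristic,
    so the distance between them is carried by the other two components.\<close>
  define z where "z s = (fst (?y s), \<psi> (c s), gr (c s))" for s
  have Ns: "(s, \<xi>) \<in> N" if "s \<in> {0..T}" for s using N_down[OF N] that by auto
  have Ws: "(s, \<xi>) \<in> W" if "s \<in> {0..T}" for s using subsetD[OF N_W Ns[OF that]] .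
  have dom: "(T, eta \<xi>) \<in> ch.dom" using W_dom[OF Ws[of T]] T by simp
  have Gc: "G (s, \<xi>) = c s" if "s \<in> {0..T}" for s
    using Y_eq[OF Ws[OF that]] that by (simp add: G_def c_def)
  have c\<Theta>: "c s \<in> \<Theta>" if "s \<in> {0..T}" for s using \<Theta>_I(1)[OF Ns[OF that]] that by (simp add: Gc)
  have yc: "?y s = (fst (?y s), phi (c s), grd (c s))" if "s \<in> {0..T}" for s
    using \<Theta>_values[OF Ns[OF that]] Y_eq[OF Ws[OF that]] that unfolding Gc[OF that] by (simp add: c_def)
  have cy: "continuous_on {0..T} ?y" by (rule ch.flow_continuous_time[OF dom])
  have cc: "continuous_on {0..T} c" unfolding c_def by (intro continuous_intros cy)
  have comp: "continuous_on {0..T} (\<lambda>s. g (c s))" if "continuous_on \<Theta> g" for g :: "_ \<Rightarrow> 'z::topological_space"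
    by (rule continuous_on_compose2[OF that cc]) (use c\<Theta> in auto)
  have cz: "continuous_on {0..T} z"
    unfolding z_def by (intro continuous_on_Pair continuous_on_fst cy comp continuous_\<psi> continuous_gr)
  have zU: "z s \<in> U" if "s \<in> {0..T}" for s
    using \<Theta>_in_U(1)[of s "fst (?y s)"] \<psi>_equation(1)[of s "fst (?y s)"] c\<Theta>[OF that] by (simp add: z_def U_def c_def)
  have yU: "?y s \<in> U" if "s \<in> {0..T}" for s using ch.flow_in[OF ch.dom_down[OF dom]] that by auto
  let ?K = "?y ` {0..T} \<union> z ` {0..T}"
  have "compact ?K" "?K \<subseteq> U" using zU yU by (auto intro!: compact_Un compact_continuous_image cy cz)
  then obtain L where L: "\<And>s a b. s \<in> {0..T} \<Longrightarrow> a \<in> ?K \<Longrightarrow> b \<in> ?K \<Longrightarrow> norm (field s a - field s b) \<le> L * norm (a - b)"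
    using ch.lipschitz_on_compact[of ?K T] by blast
  \<comment> \<open>\<open>M s w\<close> is the derivative of
    \<open>(\<psi>, \<nabla>\<psi>)\<close> at \<open>c s\<close> in the spatial direction
    \<open>w\<close>. It is applied to the difference between the velocity of \<open>c\<close> and
    the one that the characteristic system assigns to \<open>z s\<close>.\<close>
  define M where "M s w = (gr (c s) \<bullet> w, \<Sum>j\<in>UNIV. (hs j (c s) \<bullet> w) *\<^sub>R axis j 1 :: real^3)" for s w
  have "continuous_on {0..T} (\<lambda>s. norm (gr (c s)) + (\<Sum>j\<in>UNIV. norm (hs j (c s))))"
    by (intro continuous_intros comp continuous_gr continuous_hs)
  from continuous_on_Icc_bounded[OF this] obtain m where m: "0 < m"
    "\<And>s. s \<in> {0..T} \<Longrightarrow> norm (norm (gr (c s)) + (\<Sum>j\<in>UNIV. norm (hs j (c s)))) \<le> m" by blast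
  have Mb: "norm (M s w) \<le> m * norm w" if "s \<in> {0..T}" for s w
  proof -
    have "norm (M s w) \<le> norm (gr (c s) \<bullet> w) + norm (\<Sum>j\<in>UNIV. (hs j (c s) \<bullet> w) *\<^sub>R axis j 1 :: real^3)"
      unfolding M_def by (rule norm_Pair_le)
    also have "\<dots> \<le> norm (gr (c s)) * norm w + (\<Sum>j\<in>UNIV. norm (hs j (c s)) * norm w)"
      by (intro add_mono sum_norm_le) (simp_all add: Cauchy_Schwarz_ineq2)
    also have "\<dots> = (norm (gr (c s)) + (\<Sum>j\<in>UNIV. norm (hs j (c s)))) * norm w"
      by (simp add: sum_distrib_right distrib_right)
    also have "\<dots> \<le> m * norm w" using m(2)[OF that] by (intro mult_right_mono) auto
    finally show ?thesis .
  qed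
  have "snd (z T) - snd (?y T) = 0"
  proof (rule gronwall_zero[where e = "\<lambda>s. snd (z s) - snd (?y s)" and s = 0 and T = T and L = "L + m * L"
        and e' = "\<lambda>s. snd (field s (z s)) + M s (fst (field s (?y s)) - fst (field s (z s))) - snd (field s (?y s))"])
    show "continuous_on {0..T} (\<lambda>s. snd (z s) - snd (?y s))" by (intro continuous_intros cz cy)
    have c0: "c 0 = (0, \<xi>)" using ch.flow_0[OF dom] by (simp add: c_def eta_def)
    then have "(0, \<xi>) \<in> \<Theta>" using c\<Theta>[of 0] T by simp
    then show "snd (z 0) - snd (?y 0) = 0"
      using ch.flow_0[OF dom] initial_gr by (simp add: z_def c0 eta_def)
    fix s assume s: "0 < s" "s < T"
    then have sT: "s \<in> {0..T}" by simp
    let ?x = "fst (?y s)"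
    have q: "(s, ?x) \<in> \<Theta>" using c\<Theta>[OF sT] by (simp add: c_def)
    have g: "gr (s, ?x) \<noteq> 0" using \<psi>_equation(1)[OF q] .
    let ?u = "fst (field s (?y s))"
    have dy: "(?y has_vector_derivative field s (?y s)) (at s)" by (rule ch.flow_at[OF dom s])
    have dx: "((\<lambda>s. fst (?y s)) has_vector_derivative ?u) (at s)"
      by (rule bounded_linear.has_vector_derivative[OF bounded_linear_fst dy])
    have dc: "(c has_derivative (\<lambda>h. (h, h *\<^sub>R ?u))) (at s)"
      using dx unfolding c_def[abs_def] has_vector_derivative_def
      by (intro has_derivative_Pair has_derivative_ident)
    have fz: "field s (z s) = (v (s, ?x) - \<psi> (s, ?x) *\<^sub>R Rp s ?x (gr (s, ?x)), \<psi> (s, ?x) * R s ?x (gr (s, ?x)),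
        \<psi> (s, ?x) *\<^sub>R Rx s ?x (gr (s, ?x)) + R s ?x (gr (s, ?x)) *\<^sub>R gr (s, ?x) - DvT s ?x (gr (s, ?x)))"
      by (simp add: field_def Let_def z_def c_def)
    have "((\<lambda>s. \<psi> (c s)) has_vector_derivative pderiv_on \<Theta> (1, 0) \<psi> (s, ?x) + gr (s, ?x) \<bullet> ?u) (at s)"
      unfolding has_vector_derivative_def
    proof (rule has_derivative_eq_rhs[OF has_derivative_compose[OF dc]])
      show "(\<psi> has_derivative (\<lambda>h. fst h *\<^sub>R pderiv_on \<Theta> (1, 0) \<psi> (s, ?x) +
          (\<Sum>j\<in>UNIV. snd h $ j *\<^sub>R pderiv_on \<Theta> (0, axis j 1) \<psi> (s, ?x)))) (at (c s))"
        using Ck_on_1_has_derivative[OF \<psi>_C1 half_open_\<Theta> q] s by (simp add: c_def)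
    qed (simp add: fun_eq_iff gr_def inner_vec_def sum_distrib_left algebra_simps)
    then have d1: "((\<lambda>s. \<psi> (c s)) has_vector_derivative fst (snd (field s (z s)) + M s (?u - fst (field s (z s))))) (at s)"
      unfolding \<psi>_equation(2)[OF q] fz using Rp_inner[OF g]
      by (simp add: M_def c_def inner_diff_right inner_commute[of "v _"] algebra_simps)
    have dj: "((\<lambda>s. gr (c s) $ j) has_vector_derivative rhs j (s, ?x) + hs j (s, ?x) \<bullet> ?u) (at s)" for j
      unfolding has_vector_derivative_def
    proof (rule has_derivative_eq_rhs)
      have "(pderiv_on \<Theta> (0, axis j 1) \<psi> has_derivative (\<lambda>h. fst h *\<^sub>R rhs j (s, ?x) +
          (\<Sum>k\<in>UNIV. snd h $ k *\<^sub>R hs j (s, ?x) $ k))) (at (c s))"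
        using Ck_on_1_has_derivative[OF \<psi>j_C1 half_open_\<Theta> q, of j] time_derivative_gr[OF q, of j] s
        by (simp add: c_def hs_def)
      from has_derivative_compose[OF dc this]
      show "((\<lambda>s. gr (c s) $ j) has_derivative (\<lambda>h. h *\<^sub>R rhs j (s, ?x) + (\<Sum>k\<in>UNIV. (h *\<^sub>R ?u) $ k *\<^sub>R hs j (s, ?x) $ k))) (at s)"
        by (simp add: gr_def)
    qed (simp add: fun_eq_iff inner_vec_def sum_distrib_left algebra_simps)
    \<comment> \<open>In \<open>rhs j\<close> the terms with \<open>hs j\<close> combine to minus
      \<open>hs j \<bullet> fst (field s (z s))\<close>, which belongs to \<open>M\<close>; the
      others form the \<open>j\<close>-th entry of the \<open>p\<close>-equation at
      \<open>z s\<close>.\<close>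
    have eqj: "rhs j (s, ?x) + hs j (s, ?x) \<bullet> ?u = snd (snd (field s (z s)) + M s (?u - fst (field s (z s)))) $ j" for j
      unfolding fz rhs_def
      by (simp add: M_def c_def axis_def DvT_def inner_diff_right if_distrib if_distribR inner_commute cong: if_cong)
        (simp add: algebra_simps inner_commute)
    have "((\<lambda>s. gr (c s) $ j) has_vector_derivative
        snd (snd (field s (z s)) + M s (?u - fst (field s (z s)))) $ j) (at s)" for j
      using dj[of j] unfolding eqj[of j] .
    then have d2: "((\<lambda>s. gr (c s)) has_vector_derivative snd (snd (field s (z s)) + M s (?u - fst (field s (z s))))) (at s)"
      unfolding has_vector_derivative_def
      by (subst has_derivative_componentwise_within) (auto simp: Basis_vec3 inner_axis)
    have "((\<lambda>s. snd (z s)) has_vector_derivative snd (field s (z s)) + M s (?u - fst (field s (z s)))) (at s)"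
    proof -
      have zs: "(\<lambda>s. snd (z s)) = (\<lambda>s. (\<psi> (c s), gr (c s)))" by (simp add: z_def)
      show ?thesis unfolding zs using has_vector_derivative_Pair[OF d1 d2] by (simp only: prod.collapse)
    qed
    moreover have "((\<lambda>s. snd (?y s)) has_vector_derivative snd (field s (?y s))) (at s)"
      by (rule bounded_linear.has_vector_derivative[OF bounded_linear_snd dy])
    ultimately show "((\<lambda>s. snd (z s) - snd (?y s)) has_vector_derivative
        snd (field s (z s)) + M s (?u - fst (field s (z s))) - snd (field s (?y s))) (at s)"
      by (rule has_vector_derivative_diff)
    have zy: "norm (z s - ?y s) = norm (snd (z s) - snd (?y s))"
      by (simp add: norm_prod_def z_def)
    have l: "norm (field s (z s) - field s (?y s)) \<le> L * norm (snd (z s) - snd (?y s))"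
      using L[OF sT, of "z s" "?y s"] sT by (simp add: zy)
    have "norm (snd (field s (z s)) + M s (?u - fst (field s (z s))) - snd (field s (?y s))) =
        norm (snd (field s (z s) - field s (?y s)) + M s (fst (field s (?y s) - field s (z s))))"
      by (simp add: algebra_simps)
    also have "\<dots> \<le> norm (field s (z s) - field s (?y s)) + m * norm (field s (z s) - field s (?y s))"
    proof (rule norm_triangle_mono)
      show "norm (snd (field s (z s) - field s (?y s))) \<le> norm (field s (z s) - field s (?y s))"
        by (rule norm_components_le)
      have "norm (M s (fst (field s (?y s) - field s (z s)))) \<le> m * norm (fst (field s (?y s) - field s (z s)))"
        by (rule Mb[OF sT])
      also have "\<dots> \<le> m * norm (field s (?y s) - field s (z s))"
        using m(1) by (intro mult_left_mono norm_components_le) simp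
      finally show "norm (M s (fst (field s (?y s) - field s (z s)))) \<le> m * norm (field s (z s) - field s (?y s))"
        by (simp add: norm_minus_commute)
    qed
    \<comment> \<open>\<open>L\<close> comes from the Lipschitz bound of \<open>field\<close> on the
      two compact curves, \<open>m * L\<close> from \<open>M\<close> applied to the velocity
      difference under the same bound.\<close>
    also have "\<dots> \<le> (L + m * L) * norm (snd (z s) - snd (?y s))"
      using add_mono[OF l mult_left_mono[OF l less_imp_le[OF m(1)]]] by (simp add: algebra_simps)
    finally show "norm (snd (field s (z s)) + M s (?u - fst (field s (z s))) - snd (field s (?y s)))
        \<le> (L + m * L) * norm (snd (z s) - snd (?y s))" .
  qed (use T in auto)
  moreover have TT: "T \<in> {0..T}" using T by simp
  ultimately show ?thesis using arg_cong[OF yc[OF TT], of "\<lambda>y. fst (snd y)"] by (simp add: z_def Gc[OF TT] prod_eq_iff)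
qed

lemma \<psi>_eq_phi:
  assumes "q \<in> \<Theta>"
  shows "\<psi> q = phi q"
proof -
  obtain t \<xi> where N: "(t, \<xi>) \<in> N" "0 \<le> t" "q = G (t, \<xi>)" using \<Theta>_E[OF assms] by blast
  show ?thesis
  proof (cases "t = 0")
    case True
    obtain x where q: "q = (0, x)" using N(3) True by (simp add: G_def)
    have "(0, x) \<in> \<Theta>" using assms unfolding q .
    from initial_gr(1)[OF this] phi_initial(1)[OF this] show ?thesis by (simp add: q)
  next
    case False
    then show ?thesis using \<psi>_eq_phi_on_characteristic[OF N(1)] N by simp
  qed
qed

end

end

section \<open>Full second-order regularity\<close>

text \<open>\<open>v\<close> and its derivatives are controlled for \<open>t \<ge> 0\<close> only,
  so expressions containing them are not C1 families on an open set around \<open>\<Theta>\<close>.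
  Derivatives along lines within \<open>\<Theta>\<close> are used instead.\<close>

lemma Ck_on_1_lineI:
  fixes f :: "real \<times> (real^3) \<Rightarrow> 'b::real_normed_vector"
  assumes ho: "half_open \<Theta>" and c: "continuous_on \<Theta> f"
    and d: "\<And>b p. b \<in> Basis \<Longrightarrow> p \<in> \<Theta> \<Longrightarrow>
      ((\<lambda>s. f (p + s *\<^sub>R b)) has_vector_derivative d b p) (at 0 within {s. p + s *\<^sub>R b \<in> \<Theta>})"
    and cd: "\<And>b. b \<in> Basis \<Longrightarrow> continuous_on \<Theta> (d b)"
  shows "Ck_on 1 \<Theta> f"
proof -
  have pd: "has_pderiv \<Theta> b f p" "pderiv_on \<Theta> b f p = d b p" if "b \<in> Basis" "p \<in> \<Theta>" for b p
    using pderiv_onI[OF half_open_line_nontrivial[OF ho that(2) fst_Basis_spacetime[OF that(1)]] d[OF that]] by auto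
  have "continuous_on \<Theta> (pderiv_on \<Theta> b f)" if "b \<in> Basis" for b
    by (rule continuous_on_eq[OF cd[OF that]]) (simp add: pd that)
  then show ?thesis using pd c by (simp add: Ck_on_def)
qed

lemma Ck_on_1_D:
  assumes "Ck_on 1 \<Theta> f"
  shows "continuous_on \<Theta> f"
    and "\<And>b. b \<in> Basis \<Longrightarrow> continuous_on \<Theta> (pderiv_on \<Theta> b f)"
    and "\<And>b p. b \<in> Basis \<Longrightarrow> p \<in> \<Theta> \<Longrightarrow>
      ((\<lambda>s. f (p + s *\<^sub>R b)) has_vector_derivative pderiv_on \<Theta> b f p) (at 0 within {s. p + s *\<^sub>R b \<in> \<Theta>})"
  using assms by (simp_all add: Ck_on_def pderiv_onD)

lemma Ck_on_1_subset:
  fixes f :: "real \<times> (real^3) \<Rightarrow> 'b::real_normed_vector"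
  assumes f: "Ck_on 1 \<Theta>' f" and ho: "half_open \<Theta>" "half_open \<Theta>'" and sub: "\<Theta> \<subseteq> \<Theta>'"
  shows "Ck_on 1 \<Theta> f"
proof -
  have "has_pderiv \<Theta> b f p" "pderiv_on \<Theta> b f p = pderiv_on \<Theta>' b f p" if "b \<in> Basis" "p \<in> \<Theta>" for b p
    using pderiv_on_local[OF ho that(2), of b f] f sub that by (auto simp: Ck_on_def)
  moreover have "continuous_on \<Theta> (pderiv_on \<Theta> b f)" if "b \<in> Basis" for b
    by (rule continuous_on_eq[OF continuous_on_subset[OF Ck_on_1_D(2)[OF f that] sub]]) (simp add: calculation that)
  ultimately show ?thesis using continuous_on_subset[OF Ck_on_1_D(1)[OF f] sub] by (simp add: Ck_on_def)
qed

lemma Ck_on_1_bilinear: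
  fixes f :: "real \<times> (real^3) \<Rightarrow> 'b::real_normed_vector" and g :: "real \<times> (real^3) \<Rightarrow> 'c::real_normed_vector"
  assumes B: "bounded_bilinear B" and ho: "half_open \<Theta>" and f: "Ck_on 1 \<Theta> f" and g: "Ck_on 1 \<Theta> g"
  shows "Ck_on 1 \<Theta> (\<lambda>q. B (f q) (g q))"
proof (rule Ck_on_1_lineI[OF ho, where d = "\<lambda>b p. B (f p) (pderiv_on \<Theta> b g p) + B (pderiv_on \<Theta> b f p) (g p)"])
  show "continuous_on \<Theta> (\<lambda>q. B (f q) (g q))"
    by (rule bounded_bilinear.continuous_on[OF B Ck_on_1_D(1)[OF f] Ck_on_1_D(1)[OF g]])
  fix b :: "real \<times> (real^3)" assume b: "b \<in> Basis"
  show "continuous_on \<Theta> (\<lambda>p. B (f p) (pderiv_on \<Theta> b g p) + B (pderiv_on \<Theta> b f p) (g p))"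
    by (intro continuous_on_add bounded_bilinear.continuous_on[OF B] Ck_on_1_D(1)[OF f] Ck_on_1_D(1)[OF g]
        Ck_on_1_D(2)[OF f b] Ck_on_1_D(2)[OF g b])
  fix p assume p: "p \<in> \<Theta>"
  from bounded_bilinear.has_vector_derivative[OF B Ck_on_1_D(3)[OF f b p] Ck_on_1_D(3)[OF g b p]]
  show "((\<lambda>s. B (f (p + s *\<^sub>R b)) (g (p + s *\<^sub>R b))) has_vector_derivative
      B (f p) (pderiv_on \<Theta> b g p) + B (pderiv_on \<Theta> b f p) (g p)) (at 0 within {s. p + s *\<^sub>R b \<in> \<Theta>})" by simp
qed

lemma Ck_on_1_add:
  fixes f :: "real \<times> (real^3) \<Rightarrow> 'b::real_normed_vector"
  assumes ho: "half_open \<Theta>" and f: "Ck_on 1 \<Theta> f" and g: "Ck_on 1 \<Theta> g"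
  shows "Ck_on 1 \<Theta> (\<lambda>q. f q + g q)"
  by (rule Ck_on_1_lineI[OF ho, where d = "\<lambda>b p. pderiv_on \<Theta> b f p + pderiv_on \<Theta> b g p"])
    (intro continuous_on_add has_vector_derivative_add Ck_on_1_D[OF f] Ck_on_1_D[OF g]; assumption)+

lemma Ck_on_1_const:
  fixes c :: "'b::real_normed_vector"
  assumes ho: "half_open \<Theta>"
  shows "Ck_on 1 \<Theta> (\<lambda>q::real \<times> (real^3). c)"
  by (rule Ck_on_1_lineI[OF ho, where d = "\<lambda>b p. 0"]) auto

lemma Ck_on_1_sum:
  fixes f :: "'i \<Rightarrow> real \<times> (real^3) \<Rightarrow> 'b::real_normed_vector"
  assumes ho: "half_open \<Theta>" and f: "\<And>i. i \<in> I \<Longrightarrow> Ck_on 1 \<Theta> (f i)"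
  shows "Ck_on 1 \<Theta> (\<lambda>q. \<Sum>i\<in>I. f i q)"
  using f by (induction I rule: infinite_finite_induct) (simp_all add: Ck_on_1_const[OF ho] Ck_on_1_add[OF ho] del: One_nat_def)

lemma Ck_on_1_inverse:
  fixes f :: "real \<times> (real^3) \<Rightarrow> real"
  assumes ho: "half_open \<Theta>" and f: "Ck_on 1 \<Theta> f" and nz: "\<And>q. q \<in> \<Theta> \<Longrightarrow> f q \<noteq> 0"
  shows "Ck_on 1 \<Theta> (\<lambda>q. inverse (f q))"
proof (rule Ck_on_1_lineI[OF ho, where d = "\<lambda>b p. - (inverse (f p) * pderiv_on \<Theta> b f p * inverse (f p))"])
  show "continuous_on \<Theta> (\<lambda>q. inverse (f q))"
    using nz by (intro continuous_on_inverse Ck_on_1_D(1)[OF f]) auto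
  fix b :: "real \<times> (real^3)" assume b: "b \<in> Basis"
  show "continuous_on \<Theta> (\<lambda>p. - (inverse (f p) * pderiv_on \<Theta> b f p * inverse (f p)))"
    using nz by (intro continuous_on_minus continuous_on_mult continuous_on_inverse Ck_on_1_D(1)[OF f] Ck_on_1_D(2)[OF f b]) auto
  fix p assume p: "p \<in> \<Theta>"
  have "((\<lambda>s. f (p + s *\<^sub>R b)) has_real_derivative pderiv_on \<Theta> b f p) (at 0 within {s. p + s *\<^sub>R b \<in> \<Theta>})"
    using Ck_on_1_D(3)[OF f b p] by (simp add: has_real_derivative_iff_has_vector_derivative)
  from DERIV_inverse'[OF this] nz[OF p]
  show "((\<lambda>s. inverse (f (p + s *\<^sub>R b))) has_vector_derivative
      - (inverse (f p) * pderiv_on \<Theta> b f p * inverse (f p))) (at 0 within {s. p + s *\<^sub>R b \<in> \<Theta>})"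
    by (simp add: has_real_derivative_iff_has_vector_derivative)
qed

context level_set_tube
begin

text \<open>By the equation the time derivative of \<open>phi\<close> is an algebraic expression in
  \<open>phi\<close>, \<open>grd\<close>, \<open>v\<close> and \<open>\<nabla>v\<close>. All of
  these are C1 in \<open>(t, x)\<close>, the last by assumption, and the denominator
  \<open>grd q \<bullet> grd q\<close> does not vanish on \<open>\<Theta>\<close>.\<close>

lemma phi_C2:
  assumes A_C1: "\<And>j. Ck_on 1 (spacetime \<Omega>) (spd \<Omega> j v)"
  shows "Ck_on 2 \<Theta> phi"
proof -
  note ho = half_open_\<Theta>
  have hs: "half_open (spacetime \<Omega>)" by (rule half_open_spacetime[OF open_Om])
  have vC: "Ck_on 1 \<Theta> v" using H1 by (intro Ck_on_1_subset[OF _ ho hs \<Theta>_spacetime]) (simp add: H1_def)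
  have AC: "Ck_on 1 \<Theta> (spd \<Omega> j v)" for j by (rule Ck_on_1_subset[OF A_C1 ho hs \<Theta>_spacetime])
  have pC: "Ck_on 1 \<Theta> phi" by (rule Ck_on_1I(1)[OF C1_phi ho \<Theta>_sub])
  have gC: "Ck_on 1 \<Theta> grd" by (rule Ck_on_1I(1)[OF C1_grd ho \<Theta>_sub])
  have gjC: "Ck_on 1 \<Theta> (\<lambda>q. grd q $ j)" for j
    by (rule Ck_on_1I(1)[OF C1_family_linear_compose[OF bounded_linear_vec_nth C1_grd] ho \<Theta>_sub])
  have nz: "grd q \<bullet> grd q \<noteq> 0" if "q \<in> \<Theta>" for q using \<Theta>_in_U(2)[of "fst q" "snd q"] that by simp
  note mult = Ck_on_1_bilinear[OF bounded_bilinear_mult ho] and inner = Ck_on_1_bilinear[OF bounded_bilinear_inner ho]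
    and scaleR = Ck_on_1_bilinear[OF bounded_bilinear_scaleR ho]
  \<comment> \<open>The expression is written with sums, products and one inverse, so that it falls
    under the closure rules for C1 functions on half-open sets.\<close>
  have "Ck_on 1 \<Theta> (\<lambda>q. phi q * ((grd q \<bullet> (\<Sum>j\<in>UNIV. grd q $ j *\<^sub>R spd \<Omega> j v q)) * inverse (grd q \<bullet> grd q)) + (- 1) * (grd q \<bullet> v q))"
    by (intro Ck_on_1_add[OF ho] mult inner scaleR Ck_on_1_sum[OF ho] Ck_on_1_inverse[OF ho] Ck_on_1_const[OF ho] pC gC gjC AC vC nz)
  moreover have "Ck_on 1 \<Theta> (pderiv_on \<Theta> (1, 0) phi) =
      Ck_on 1 \<Theta> (\<lambda>q. phi q * ((grd q \<bullet> (\<Sum>j\<in>UNIV. grd q $ j *\<^sub>R spd \<Omega> j v q)) * inverse (grd q \<bullet> grd q)) + (- 1) * (grd q \<bullet> v q))"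
    unfolding Ck_on_def by (rule Ck_dirs_cong) (auto simp: pderiv_time_phi R_def Dv_def divide_inverse)
  ultimately have "Ck_on 1 \<Theta> (pderiv_on \<Theta> (1, 0) phi)" by simp
  then have "Ck_on 1 \<Theta> (pderiv_on \<Theta> b phi)" if "b \<in> Basis" for b
    using that phi_C2_upto_tt by (auto simp: Basis_spacetime C2_upto_tt_def)
  with pC show ?thesis by (simp add: Ck_on_def numeral_2_eq_2)
qed

end

text \<open>Uniqueness is stated in the class without the second time derivative, which contains all
  C2-solutions; so when \<open>\<nabla>v\<close> is C1 in \<open>(t, x)\<close>,
  \<open>\<phi>\<close> is also the unique C2-solution. Relative openness of \<open>\<Theta>\<close>
  gives the partial derivatives within \<open>\<Theta>\<close> their usual meaning.\<close>

theorem theorem2p2: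
  fixes \<Omega> :: "(real^3) set"
    and v :: "real \<times> (real^3) \<Rightarrow> real^3"
    and X :: "real \<Rightarrow> real \<Rightarrow> real^3 \<Rightarrow> real^3"
    and \<Sigma>0 :: "(real^3) set"
    and \<Sigma> :: "real \<Rightarrow> (real^3) set"
    and \<phi>0 :: "real^3 \<Rightarrow> real"
  assumes "bounded \<Omega>" and "connected \<Omega>" and "open \<Omega>"
    and "H1 \<Omega> v" and "H2 \<Omega> v" and "H3 \<Omega> v"
    and "is_flow \<Omega> v X"
    and "\<Sigma>0 \<subseteq> \<Omega>" and "closed_C2_surface \<Sigma>0"
    and "Ck_on 2 \<Omega> \<phi>0"
    and "{x \<in> \<Omega>. \<phi>0 x = 0} = \<Sigma>0"
    and "\<forall>x\<in>\<Sigma>0. grad \<Omega> \<phi>0 x \<noteq> 0"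
    and "\<And>t. t \<ge> 0 \<Longrightarrow> \<Sigma> t = X t 0 ` \<Sigma>0"
  shows "\<exists>\<Theta> \<phi>.
      tubular_neighborhood \<Omega> \<Sigma> \<Theta> \<and>
      openin (top_of_set (spacetime \<Omega>)) \<Theta> \<and>
      C2_upto_tt \<Theta> \<phi> \<and> solves_problem \<Omega> v \<phi>0 \<Theta> \<phi> \<and>
      ((\<forall>b\<in>space_dirs. Ck_on 1 (spacetime \<Omega>) (pderiv_on (spacetime \<Omega>) b v)) \<longrightarrow> Ck_on 2 \<Theta> \<phi>) \<and>
      (\<forall>\<psi>. C2_upto_tt \<Theta> \<psi> \<and> solves_problem \<Omega> v \<phi>0 \<Theta> \<psi> \<longrightarrow> (\<forall>p\<in>\<Theta>. \<psi> p = \<phi> p)) \<and>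
      (\<forall>t\<ge>0. {x \<in> \<Omega>. (t, x) \<in> \<Theta> \<and> \<phi> (t, x) = 0} = \<Sigma> t) \<and>
      (\<forall>t\<ge>0. \<forall>x\<in>\<Sigma> t. \<exists>\<xi>\<in>\<Sigma>0.
         norm (grad (slice \<Theta> t) (\<lambda>y. \<phi> (t, y)) x) = norm (grad \<Omega> \<phi>0 \<xi>))"
proof -
  interpret level_set_problem \<Omega> v X \<Sigma>0 \<phi>0
    by unfold_locales (use assms in \<open>auto simp: closed_C2_surface_def\<close>)
  obtain N where N: "open N" "{0..} \<times> \<Sigma>0 \<subseteq> N" "N \<subseteq> W" "inj_on G N"
    "\<And>p. p \<in> N \<Longrightarrow> bij (blinfun_apply (G' p))"
    "\<And>s t \<xi>. (t, \<xi>) \<in> N \<Longrightarrow> 0 \<le> s \<Longrightarrow> s \<le> t \<Longrightarrow> (s, \<xi>) \<in> N"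
    using tube_exists by blast
  interpret level_set_tube \<Omega> v X \<Sigma>0 \<phi>0 N
    by unfold_locales (use N in auto)
  have \<Sigma>: "\<And>t. 0 \<le> t \<Longrightarrow> \<Sigma> t = X t 0 ` \<Sigma>0" by (rule assms(13))
  show ?thesis
  proof (intro exI[of _ \<Theta>] exI[of _ phi] conjI allI impI ballI)
    show "tubular_neighborhood \<Omega> \<Sigma> \<Theta>"
      using tubular \<Sigma> by (simp add: tubular_neighborhood_def)
    show "openin (top_of_set (spacetime \<Omega>)) \<Theta>" by (rule openin_\<Theta>)
    show "C2_upto_tt \<Theta> phi" by (rule phi_C2_upto_tt)
    show "solves_problem \<Omega> v \<phi>0 \<Theta> phi" by (rule phi_solves)
    show "Ck_on 2 \<Theta> phi" if "\<forall>b\<in>space_dirs. Ck_on 1 (spacetime \<Omega>) (pderiv_on (spacetime \<Omega>) b v)"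
      by (rule phi_C2) (use that in \<open>auto simp: spd_def space_dirs_def\<close>)
    show "\<psi> p = phi p" if "C2_upto_tt \<Theta> \<psi> \<and> solves_problem \<Omega> v \<phi>0 \<Theta> \<psi>" "p \<in> \<Theta>" for \<psi> p
      using \<psi>_eq_phi[of \<psi> p] that by blast
    show "{x \<in> \<Omega>. (t, x) \<in> \<Theta> \<and> phi (t, x) = 0} = \<Sigma> t" if "0 \<le> t" for t
      using zero_level[OF that] \<Sigma>[OF that] by simp
    show "\<exists>\<xi>\<in>\<Sigma>0. norm (grad (slice \<Theta> t) (\<lambda>y. phi (t, y)) x) = norm (grad \<Omega> \<phi>0 \<xi>)"
      if t: "0 \<le> t" and x: "x \<in> \<Sigma> t" for t x
    proof -
      obtain \<xi> where \<xi>: "\<xi> \<in> \<Sigma>0" "x = X t 0 \<xi>" using x \<Sigma>[OF t] by auto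
      then show ?thesis using gradient_norm[OF t \<xi>(1)] by (intro bexI[of _ \<xi>]) simp_all
    qed
  qed
qed

end
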